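(* Let $1\le k\le n-1$. The noncrossing complex $\Delta^{NC}_{k,n}$ is a flag, regular, unimodular triangulation of the order polytope $\mathcal{O}_{k,n}$, and it is Gorenstein, i.e. as a simplicial complex it is the join of a simplex with a simplicial complex homeomorphic to a sphere (with the convention that the empty complex is the $(-1)$-sphere). In particular, $\Delta^{NC}_{k,n}$ and $\Delta^{NN}_{k,n}$ have the same $f$-vector and the same $h$-vector.
   Context: Let $[n]=\{1,\dots,n\}$. $V_{k,n}$ denotes the set of integer vectors $I=(i_1,\dots,i_k)$ with $1\le i_1<\dots<i_k\le n$ (identified with $k$-subsets of $[n]$). Two arcs $(p<p')$ and $(q<q')$ cross if $p<q<p'<q'$ or $q<p<q'<p'$; they nest if $p<q<q'<p'$ or $q<p<p'<q'$. Two vectors $I=(i_1,\dots,i_k)$, $J=(j_1,\dots,j_k)\in V_{k,n}$ are noncrossing if for all indices $1\le a<b\le k$ such that $i_\ell=j_\ell$ for all $a<\ell<b$, the arcs $(i_a<i_b)$ and $(j_a<j_b)$ do not cross; they are nonnesting if for all $1\le a<b\le k$ the arcs $(i_a<i_b)$ and $(j_a<j_b)$ do not nest (equivalently, $I\le J$ or $J\le I$ componentwise). The noncrossing complex $\Delta^{NC}_{k,n}$ (resp. nonnesting complex $\Delta^{NN}_{k,n}$) is the flag simplicial complex with vertex set $V_{k,n}$ whose faces are the sets of pairwise noncrossing (resp. pairwise nonnesting) vectors. Let $P_{k,n}=\{(a,b): a\in[k], b\in[n-k]\}$. For $I\in V_{k,n}$ let $\chi_I\in\{0,1\}^{P_{k,n}}$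 be given by $(\chi_I)_{a,b}=1$ iff $i_a\le a+b-1$. The order polytope is $\mathcal{O}_{k,n}=\{x\in[0,1]^{P_{k,n}}: x_{a,b}\le x_{a,b+1},\ x_{a+1,b}\le x_{a,b}\}$; its vertices are exactly the points $\chi_I$, $I\in V_{k,n}$ (it is the order polytope of the product of a $k$-chain and an $(n-k)$-chain). A simplicial complex $\Delta$ on vertex set $V_{k,n}$ is a triangulation of $\mathcal{O}_{k,n}$ if for every face $\sigma$ the points $\chi_I$, $I\in\sigma$, are affinely independent, and the simplices $\mathrm{conv}\{\chi_I:I\in\sigma\}$ cover $\mathcal{O}_{k,n}$ and pairwise intersect in common faces. It is unimodular if every maximal simplex has Euclidean volume $1/(k(n-k))!$ (i.e. is a lattice basis simplex for $\mathbb{Z}^{P_{k,n}}$), and regular if there is $w:V_{k,n}\to\mathbb{R}$ such that the simplices of $\Delta$ are exactly the projections of the lower faces of $\mathrm{conv}\{(\chi_I,w(I))\}$. A flag complex is the clique complex of its 1-skeleton. *)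

theory Defs
  imports "HOL-Analysis.Analysis"
begin

definition Vkn :: "nat \<Rightarrow> nat \<Rightarrow> nat set set" where
  "Vkn k n = {I. I \<subseteq> {1..n} \<and> card I = k}"

definition ent :: "nat set \<Rightarrow> nat \<Rightarrow> nat" where
  "ent I a = sorted_list_of_set I ! (a - 1)"

definition crosses :: "nat \<Rightarrow> nat \<Rightarrow> nat \<Rightarrow> nat \<Rightarrow> bool" where
  "crosses p p' q q' \<longleftrightarrow> (p < q \<and> q < p' \<and> p' < q') \<or> (q < p \<and> p < q' \<and> q' < p')"

definition nests :: "nat \<Rightarrow> nat \<Rightarrow> nat \<Rightarrow> nat \<Rightarrow> bool" where
  "nests p p' q q' \<longleftrightarrow> (p < q \<and> q < q' \<and> q' < p') \<or> (q < p \<and> p < p' \<and> p' < q')"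

definition noncrossing :: "nat \<Rightarrow> nat set \<Rightarrow> nat set \<Rightarrow> bool" where
  "noncrossing k I J \<longleftrightarrow>
     (\<forall>a b. 1 \<le> a \<and> a < b \<and> b \<le> k \<and> (\<forall>l. a < l \<and> l < b \<longrightarrow> ent I l = ent J l)
        \<longrightarrow> \<not> crosses (ent I a) (ent I b) (ent J a) (ent J b))"

definition nonnesting :: "nat \<Rightarrow> nat set \<Rightarrow> nat set \<Rightarrow> bool" where
  "nonnesting k I J \<longleftrightarrow>
     (\<forall>a b. 1 \<le> a \<and> a < b \<and> b \<le> k \<longrightarrow> \<not> nests (ent I a) (ent I b) (ent J a) (ent J b))"

definition clique_complex :: "'v set \<Rightarrow> ('v \<Rightarrow> 'v \<Rightarrow> bool) \<Rightarrow> 'v set set" where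
  "clique_complex V R = {\<sigma>. \<sigma> \<subseteq> V \<and> (\<forall>I\<in>\<sigma>. \<forall>J\<in>\<sigma>. R I J)}"

definition NC_complex :: "nat \<Rightarrow> nat \<Rightarrow> nat set set set" where
  "NC_complex k n = clique_complex (Vkn k n) (noncrossing k)"

definition NN_complex :: "nat \<Rightarrow> nat \<Rightarrow> nat set set set" where
  "NN_complex k n = clique_complex (Vkn k n) (nonnesting k)"

definition is_flag :: "'v set set \<Rightarrow> 'v set \<Rightarrow> bool" where
  "is_flag \<Delta> V \<longleftrightarrow> (\<forall>\<sigma>. \<sigma> \<in> \<Delta> \<longleftrightarrow> (\<sigma> \<subseteq> V \<and> (\<forall>I\<in>\<sigma>. \<forall>J\<in>\<sigma>. {I, J} \<in> \<Delta>)))"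

text \<open>R^{P_{k,n}} is represented by functions on nat \<times> nat vanishing outside P_{k,n}.\<close>
definition Pkn :: "nat \<Rightarrow> nat \<Rightarrow> (nat \<times> nat) set" where
  "Pkn k n = {1..k} \<times> {1..n - k}"

definition chi :: "nat \<Rightarrow> nat \<Rightarrow> nat set \<Rightarrow> (nat \<times> nat) \<Rightarrow> real" where
  "chi k n I = (\<lambda>(a, b). if (a, b) \<in> Pkn k n \<and> ent I a \<le> a + b - 1 then 1 else 0)"

definition order_polytope :: "nat \<Rightarrow> nat \<Rightarrow> ((nat \<times> nat) \<Rightarrow> real) set" where
  "order_polytope k n =
    {x. (\<forall>p. p \<notin> Pkn k n \<longrightarrow> x p = 0) \<and> (\<forall>p\<in>Pkn k n. 0 \<le> x p \<and> x p \<le> 1) \<and>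
        (\<forall>a b. (a, b) \<in> Pkn k n \<and> (a, b + 1) \<in> Pkn k n \<longrightarrow> x (a, b) \<le> x (a, b + 1)) \<and>
        (\<forall>a b. (a, b) \<in> Pkn k n \<and> (a + 1, b) \<in> Pkn k n \<longrightarrow> x (a + 1, b) \<le> x (a, b))}"

definition int_lattice :: "nat \<Rightarrow> nat \<Rightarrow> ((nat \<times> nat) \<Rightarrow> real) set" where
  "int_lattice k n = {z. (\<forall>p. p \<notin> Pkn k n \<longrightarrow> z p = 0) \<and> (\<forall>p. z p \<in> \<int>)}"

definition conv_pts :: "'v set \<Rightarrow> ('v \<Rightarrow> 'i \<Rightarrow> real) \<Rightarrow> ('i \<Rightarrow> real) set" where
  "conv_pts S f = {x. \<exists>u. (\<forall>s\<in>S. 0 \<le> u s) \<and> sum u S = 1 \<and> x = (\<lambda>p. \<Sum>s\<in>S. u s * f s p)}"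

definition aff_indep :: "'v set \<Rightarrow> ('v \<Rightarrow> 'i \<Rightarrow> real) \<Rightarrow> bool" where
  "aff_indep S f \<longleftrightarrow>
     (\<forall>u. sum u S = 0 \<and> (\<lambda>p. \<Sum>s\<in>S. u s * f s p) = (\<lambda>p. 0) \<longrightarrow> (\<forall>s\<in>S. u s = 0))"

definition is_triangulation ::
  "'v set set \<Rightarrow> 'v set \<Rightarrow> ('v \<Rightarrow> 'i \<Rightarrow> real) \<Rightarrow> ('i \<Rightarrow> real) set \<Rightarrow> bool" where
  "is_triangulation \<Delta> V f Q \<longleftrightarrow>
     (\<forall>\<sigma>\<in>\<Delta>. \<sigma> \<subseteq> V \<and> finite \<sigma> \<and> aff_indep \<sigma> f) \<and>
     (\<Union>\<sigma>\<in>\<Delta>. conv_pts \<sigma> f) = Q \<and>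
     (\<forall>\<sigma>\<in>\<Delta>. \<forall>\<tau>\<in>\<Delta>. conv_pts \<sigma> f \<inter> conv_pts \<tau> f = conv_pts (\<sigma> \<inter> \<tau>) f)"

text \<open>Regularity: there is a height function w such that the faces are exactly the vertex sets
  of lower faces of the lifted point configuration, i.e. the sets of points where some affine
  function (a, c) on R^P lying weakly below the heights attains them.\<close>
definition is_regular ::
  "'v set set \<Rightarrow> 'v set \<Rightarrow> 'i set \<Rightarrow> ('v \<Rightarrow> 'i \<Rightarrow> real) \<Rightarrow> bool" where
  "is_regular \<Delta> V P f \<longleftrightarrow>
     (\<exists>w :: 'v \<Rightarrow> real. \<forall>\<sigma>. \<sigma> \<in> \<Delta> \<longleftrightarrow>
        (\<sigma> \<subseteq> V \<and> (\<exists>(a :: 'i \<Rightarrow> real) (c :: real). \<forall>I\<in>V.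
            (\<Sum>p\<in>P. a p * f I p) + c \<le> w I \<and> ((\<Sum>p\<in>P. a p * f I p) + c = w I \<longleftrightarrow> I \<in> \<sigma>))))"

definition is_unimodular ::
  "'v set set \<Rightarrow> ('v \<Rightarrow> 'i \<Rightarrow> real) \<Rightarrow> ('i \<Rightarrow> real) set \<Rightarrow> nat \<Rightarrow> bool" where
  "is_unimodular \<Delta> f L d \<longleftrightarrow>
     (\<forall>\<sigma>\<in>\<Delta>. (\<forall>\<tau>\<in>\<Delta>. \<sigma> \<subseteq> \<tau> \<longrightarrow> \<tau> = \<sigma>) \<longrightarrow>
        card \<sigma> = d + 1 \<and>
        (\<exists>I0\<in>\<sigma>. \<forall>z\<in>L. \<exists>c :: 'v \<Rightarrow> int. z = (\<lambda>p. \<Sum>J\<in>\<sigma>. of_int (c J) * (f J p - f I0 p))))"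

definition is_simplicial_complex :: "'v set set \<Rightarrow> bool" where
  "is_simplicial_complex \<Gamma> \<longleftrightarrow> \<Gamma> \<noteq> {} \<and> finite \<Gamma> \<and> (\<forall>\<sigma>\<in>\<Gamma>. finite \<sigma> \<and> (\<forall>\<tau>. \<tau> \<subseteq> \<sigma> \<longrightarrow> \<tau> \<in> \<Gamma>))"

definition realization :: "'v set set \<Rightarrow> ('v \<Rightarrow> real) topology" where
  "realization \<Gamma> = subtopology (powertop_real (\<Union>\<Gamma>))
     {x. (\<forall>v\<in>\<Union>\<Gamma>. 0 \<le> x v) \<and> sum x (\<Union>\<Gamma>) = 1 \<and> {v\<in>\<Union>\<Gamma>. x v \<noteq> 0} \<in> \<Gamma>}"

text \<open>Homeomorphic to a sphere; the complex {\<emptyset>} counts as the (-1)-sphere.\<close>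
definition is_sphere_complex :: "'v set set \<Rightarrow> bool" where
  "is_sphere_complex \<Gamma> \<longleftrightarrow> \<Gamma> = {{}} \<or> (\<exists>d. realization \<Gamma> homeomorphic_space nsphere d)"

definition is_gorenstein :: "'v set set \<Rightarrow> bool" where
  "is_gorenstein \<Delta> \<longleftrightarrow>
     (\<exists>A \<Gamma>. finite A \<and> is_simplicial_complex \<Gamma> \<and> A \<inter> \<Union>\<Gamma> = {} \<and> is_sphere_complex \<Gamma> \<and>
        \<Delta> = {\<alpha> \<union> \<gamma> | \<alpha> \<gamma>. \<alpha> \<subseteq> A \<and> \<gamma> \<in> \<Gamma>})"

text \<open>fvec \<Delta> i = number of faces with i vertices (= f_{i-1}).\<close>
definition fvec :: "'v set set \<Rightarrow> nat \<Rightarrow> nat" where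
  "fvec \<Delta> i = card {\<sigma>\<in>\<Delta>. card \<sigma> = i}"

definition hvec :: "'v set set \<Rightarrow> nat \<Rightarrow> int" where
  "hvec \<Delta> j = (let D = Max (card ` \<Delta>) in
     (\<Sum>i=0..j. (-1) ^ (j - i) * int ((D - i) choose (j - i)) * int (fvec \<Delta> i)))"

end

theory Submission
  imports Defs
begin

text \<open>
  Homogenise the points \<open>\<chi>\<^sub>I\<close> by an extra coordinate 1. Two properties of the noncrossing relation suffice.
  \<^item> Exchange: a crossing pair \<open>I, J\<close> can be replaced by a pair with the same sum and smaller total cost, by
    swapping tails, where the cost \<open>\<Sum> \<epsilon>\<^bsup>d - c\<^esup> i\<^sub>c i\<^sub>d\<close> favours nestings and gives short arcs priority.
  \<^item> Uniqueness: nonnegative combinations with pairwise noncrossing support are determined by their value. The value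
    determines the distribution of the entries in each column, noncrossing matchings are determined by their
    marginals, and one extends windows of consecutive columns.

  By exchange, the cheapest representation of an integer point is noncrossing. For a maximal face \<open>\<sigma>\<close> and a vertex
  \<open>J\<close>, the noncrossing representation of \<open>N \<cdot> \<sigma> + J\<close> is supported on \<open>\<sigma>\<close> for some \<open>N\<close>, so \<open>J\<close> is an integer
  combination of \<open>\<sigma>\<close>, strictly cheaper than \<open>J\<close> if \<open>J \<notin> \<sigma>\<close>. This yields unimodularity and regularity, and the
  covering property by approximating real combinations by integer ones.

  The cyclic intervals are noncrossing with every vertex and their sum is in the interior of the cone. Modulo their
  span the other faces form a complete fan, hence a sphere.

  Nonnesting pairs satisfy exchange and uniqueness too. So both complexes have the same number of integer weights of
  total \<open>N\<close> supported on a face, namely the number of values of such combinations, and this determines the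
  \<open>f\<close>-vector.
\<close>

section \<open>Triangulations from exchange and uniqueness\<close>

text \<open>The obstacle is that the dimension of a maximal face is not known in advance. If the
  cone over \<sigma> were known to be full-dimensional, \<open>N * \<sigma> + J\<close> would
  clearly enter it for large \<open>N\<close>; a pigeonhole argument on supports proves this entry
  without the dimension, which then comes out as a corollary. Integer weights are treated before
  real ones because only finitely many have a given total, so a cheapest one exists, and because
  they make the coordinates integral. The strict decrease in the exchange is used twice: it forces
  cheapest weights onto faces, and it places every vertex outside a maximal face strictly above the
  affine function that interpolates the costs on that face. Hence the cost itself is a height
  function inducing the triangulation.\<close>

definition hom :: "('v \<Rightarrow> 'i \<Rightarrow> real) \<Rightarrow> 'v \<Rightarrow> 'i option \<Rightarrow> real" where
  "hom f I q = (case q of None \<Rightarrow> 1 | Some p \<Rightarrow> f I p)"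

lemma hom_simps [simp]: "hom f I None = 1" "hom f I (Some p) = f I p"
  by (simp_all add: hom_def)

lemma clique_complex_mono: "\<sigma> \<in> clique_complex V R \<Longrightarrow> \<tau> \<subseteq> \<sigma> \<Longrightarrow> \<tau> \<in> clique_complex V R"
  unfolding clique_complex_def by blast

text \<open>The cost \<open>w\<close> has two roles: it orders the representations of a value, and
  it is the height function in \<open>regular\<close>. The relation enters only through
  \<open>exchange\<close> and \<open>unique\<close>, so noncrossing and nonnesting vectors are two
  instances over the same points.\<close>

locale exchange_config =
  fixes V :: "'v set" and f :: "'v \<Rightarrow> 'i \<Rightarrow> real" and R :: "'v \<Rightarrow> 'v \<Rightarrow> bool" and w :: "'v \<Rightarrow> real"
  assumes finite_V: "finite V"
    and R_refl: "I \<in> V \<Longrightarrow> R I I"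
    and R_sym: "R I J \<Longrightarrow> R J I"
    and exchange: "\<lbrakk>I \<in> V; J \<in> V; \<not> R I J\<rbrakk> \<Longrightarrow>
      \<exists>I'\<in>V. \<exists>J'\<in>V. (\<forall>p. f I' p + f J' p = f I p + f J p) \<and> w I' + w J' < w I + w J"
    and unique: "\<lbrakk>\<And>I. I \<in> V \<Longrightarrow> 0 \<le> u I; \<And>I. I \<in> V \<Longrightarrow> 0 \<le> v I;
      {I \<in> V. u I \<noteq> 0} \<in> clique_complex V R; {I \<in> V. v I \<noteq> 0} \<in> clique_complex V R;
      sum u V = sum v V; \<And>p. (\<Sum>I\<in>V. u I * f I p) = (\<Sum>I\<in>V. v I * f I p); I \<in> V\<rbrakk> \<Longrightarrow> u I = v I"
begin

abbreviation h :: "'v \<Rightarrow> 'i option \<Rightarrow> real" where "h \<equiv> hom f"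
abbreviation \<Delta> :: "'v set set" where "\<Delta> \<equiv> clique_complex V R"

definition comb :: "('v \<Rightarrow> real) \<Rightarrow> 'i option \<Rightarrow> real" where
  "comb u q = (\<Sum>I\<in>V. u I * h I q)"

definition cost :: "('v \<Rightarrow> real) \<Rightarrow> real" where
  "cost u = (\<Sum>I\<in>V. u I * w I)"

definition maximal_face :: "'v set \<Rightarrow> bool" where
  "maximal_face \<sigma> \<longleftrightarrow> \<sigma> \<in> \<Delta> \<and> (\<forall>\<tau>\<in>\<Delta>. \<sigma> \<subseteq> \<tau> \<longrightarrow> \<tau> = \<sigma>)"

section \<open>Linear combinations and faces\<close>

lemma comb_cong: "(\<And>I. I \<in> V \<Longrightarrow> u I = v I) \<Longrightarrow> comb u = comb v"
  unfolding comb_def by (intro ext sum.cong) auto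

lemma comb_None: "comb u None = sum u V"
  by (simp add: comb_def)

lemma comb_add: "comb (\<lambda>I. u I + v I) q = comb u q + comb v q"
  by (simp add: comb_def sum.distrib algebra_simps)

lemma comb_diff: "comb (\<lambda>I. u I - v I) q = comb u q - comb v q"
  by (simp add: comb_def sum_subtractf algebra_simps)

lemma comb_scale: "comb (\<lambda>I. c * u I) q = c * comb u q"
  by (simp add: comb_def sum_distrib_left algebra_simps)

lemma comb_single: "J \<in> V \<Longrightarrow> comb (\<lambda>I. of_bool (I = J)) q = h J q"
  using finite_V by (simp add: comb_def of_bool_def if_distrib [where f="\<lambda>x. x * _"] cong: if_cong)

lemma comb_indicator: "\<sigma> \<subseteq> V \<Longrightarrow> comb (\<lambda>I. of_bool (I \<in> \<sigma>) * c I) q = (\<Sum>I\<in>\<sigma>. c I * h I q)"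
  unfolding comb_def using finite_V
  by (intro sum.mono_neutral_cong_right) auto

lemma cost_single: "J \<in> V \<Longrightarrow> cost (\<lambda>I. of_bool (I = J)) = w J"
  using finite_V by (simp add: cost_def of_bool_def if_distrib [where f="\<lambda>x. x * _"] cong: if_cong)

lemma unique_comb:
  assumes "\<And>I. I \<in> V \<Longrightarrow> 0 \<le> u I" "\<And>I. I \<in> V \<Longrightarrow> 0 \<le> v I"
    "{I \<in> V. u I \<noteq> 0} \<in> \<Delta>" "{I \<in> V. v I \<noteq> 0} \<in> \<Delta>" "comb u = comb v" "I \<in> V"
  shows "u I = v I"
proof (rule unique)
  show "sum u V = sum v V" using fun_cong [OF assms(5), of None] by (simp add: comb_None)
  show "(\<Sum>I\<in>V. u I * f I p) = (\<Sum>I\<in>V. v I * f I p)" for p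
    using fun_cong [OF assms(5), of "Some p"] by (simp add: comb_def)
qed (use assms in auto)

lemma finite_face: "\<sigma> \<in> \<Delta> \<Longrightarrow> finite \<sigma>"
  using finite_V finite_subset unfolding clique_complex_def by blast

lemma face_subset: "\<sigma> \<in> \<Delta> \<Longrightarrow> \<sigma> \<subseteq> V"
  unfolding clique_complex_def by blast

lemma finite_complex: "finite \<Delta>"
  by (rule finite_subset [of _ "Pow V"]) (use finite_V face_subset in auto)

lemma face_in_maximal_face:
  assumes "\<sigma> \<in> \<Delta>" obtains \<tau> where "maximal_face \<tau>" "\<sigma> \<subseteq> \<tau>"
proof -
  obtain \<tau> where "\<tau> \<in> \<Delta>" "\<sigma> \<subseteq> \<tau>" "\<forall>\<rho>\<in>\<Delta>. \<tau> \<subseteq> \<rho> \<longrightarrow> \<tau> = \<rho>"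
    using finite_has_maximal2 [OF finite_complex assms] by blast
  then show thesis by (intro that [of \<tau>]) (auto simp: maximal_face_def)
qed

text \<open>The positive and the negative part of a relation \<open>c\<close> are nonnegative
  weightings of equal value on \<sigma>, so \<open>unique_comb\<close> equates them; at each vertex
  at most one of them is nonzero, so both vanish.\<close>

lemma face_independent:
  assumes \<sigma>: "\<sigma> \<in> \<Delta>" and z: "\<And>q. (\<Sum>I\<in>\<sigma>. c I * h I q) = 0" and I: "I \<in> \<sigma>"
  shows "c I = 0"
proof -
  have \<sigma>V: "\<sigma> \<subseteq> V" by (rule face_subset [OF \<sigma>])
  define u v where "u = (\<lambda>I. of_bool (I \<in> \<sigma>) * max (c I) 0)" and "v = (\<lambda>I. of_bool (I \<in> \<sigma>) * max (- c I) 0)"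
  have "u I = v I"
  proof (rule unique_comb)
    show "{I \<in> V. u I \<noteq> 0} \<in> \<Delta>" "{I \<in> V. v I \<noteq> 0} \<in> \<Delta>"
      by (rule clique_complex_mono [OF \<sigma>]; auto simp: u_def v_def)+
    show "comb u = comb v"
    proof
      fix q
      have "comb u q - comb v q = comb (\<lambda>I. of_bool (I \<in> \<sigma>) * c I) q"
        unfolding comb_diff [symmetric] by (intro fun_cong [OF comb_cong]) (auto simp: u_def v_def)
      also have "\<dots> = 0" by (simp add: comb_indicator [OF \<sigma>V] z)
      finally show "comb u q = comb v q" by simp
    qed
  qed (use I \<sigma>V in \<open>auto simp: u_def v_def\<close>)
  then show ?thesis using I by (auto simp: u_def v_def max_def split: if_splits)
qed

lemma face_coordinates_unique:
  assumes \<sigma>: "\<sigma> \<in> \<Delta>" and z: "\<And>q. (\<Sum>I\<in>\<sigma>. c I * h I q) = (\<Sum>I\<in>\<sigma>. d I * h I q)" and I: "I \<in> \<sigma>"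
  shows "c I = d I"
proof -
  have "c I - d I = 0"
    by (rule face_independent [OF \<sigma> _ I]) (simp add: left_diff_distrib sum_subtractf z)
  then show ?thesis by simp
qed

section \<open>Integer weights and coordinates on maximal faces\<close>

definition nat_weights :: "nat \<Rightarrow> ('v \<Rightarrow> nat) set" where
  "nat_weights N = {m. (\<forall>x. x \<notin> V \<longrightarrow> m x = 0) \<and> sum m V = N}"

lemma finite_nat_weights: "finite (nat_weights N)"
proof (rule finite_subset)
  show "nat_weights N \<subseteq> {m. \<forall>x. (x \<in> V \<longrightarrow> m x \<in> {..N}) \<and> (x \<notin> V \<longrightarrow> m x = 0)}"
    unfolding nat_weights_def using finite_V by (auto intro: member_le_sum)
  show "finite \<dots>" by (intro finite_set_of_finite_funs finite_V) auto
qed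

lemma exchange_step:
  assumes m: "m \<in> nat_weights N" and n: "{x. m x \<noteq> 0} \<notin> \<Delta>"
  shows "\<exists>m'\<in>nat_weights N. comb (real \<circ> m') = comb (real \<circ> m) \<and> cost (real \<circ> m') < cost (real \<circ> m)"
proof -
  have "{x. m x \<noteq> 0} \<subseteq> V" using m by (auto simp: nat_weights_def)
  then obtain I J where IJ: "m I \<noteq> 0" "m J \<noteq> 0" "\<not> R I J" "I \<in> V" "J \<in> V"
    using n unfolding clique_complex_def by blast
  then have ne: "I \<noteq> J" using R_refl by blast
  obtain I' J' where IJ': "I' \<in> V" "J' \<in> V" "\<And>p. f I' p + f J' p = f I p + f J p" "w I' + w J' < w I + w J"
    using exchange [OF IJ(4,5,3)] by blast
  \<comment> \<open>Truncated subtraction is exact here, since \<open>I\<close> and \<open>J\<close>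
    are distinct and have positive weight.\<close>
  define m' where "m' x = m x - of_bool (x = I) - of_bool (x = J) + of_bool (x = I') + of_bool (x = J')" for x
  have r: "(real \<circ> m') = (\<lambda>x. ((real \<circ> m) x - of_bool (x = I) - of_bool (x = J)) + (of_bool (x = I') + of_bool (x = J')))"
    using IJ(1,2) ne by (auto simp: m'_def fun_eq_iff of_nat_diff)
  have hh: "h I' q + h J' q = h I q + h J q" for q using IJ'(3) by (cases q) auto
  have "comb (real \<circ> m') q = comb (real \<circ> m) q" for q
    unfolding r comb_add comb_diff using hh [of q] by (simp add: comb_single IJ IJ' o_def)
  then have c: "comb (real \<circ> m') = comb (real \<circ> m)" by blast
  have lin: "cost (real \<circ> m') = cost (real \<circ> m) - w I - w J + (w I' + w J')"
    unfolding r using cost_single [OF IJ(4)] cost_single [OF IJ(5)] cost_single [OF IJ'(1)] cost_single [OF IJ'(2)]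
    unfolding cost_def by (simp add: sum.distrib sum_subtractf algebra_simps)
  have "sum m' V = sum m V"
    using fun_cong [OF c, of None] by (simp add: comb_None flip: of_nat_sum)
  then have "m' \<in> nat_weights N"
    using m IJ IJ' by (auto simp: nat_weights_def m'_def)
  then show ?thesis using c lin IJ'(4) by (intro bexI [of _ m']) auto
qed

text \<open>Among the finitely many weights of the same total and value, a cheapest one admits no
  exchange step, so its support is a face. The last clause holds because weights not supported on a
  face cannot be cheapest.\<close>

lemma nat_reduce:
  assumes m: "m \<in> nat_weights N"
  obtains m' where "m' \<in> nat_weights N" "{x. m' x \<noteq> 0} \<in> \<Delta>" "comb (real \<circ> m') = comb (real \<circ> m)"
    "{x. m x \<noteq> 0} \<notin> \<Delta> \<longrightarrow> cost (real \<circ> m') < cost (real \<circ> m)"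
proof -
  define S where "S = {m' \<in> nat_weights N. comb (real \<circ> m') = comb (real \<circ> m)}"
  have "finite S" "m \<in> S" using finite_nat_weights m by (auto simp: S_def)
  then obtain m' where m': "m' \<in> S" "\<And>m''. m'' \<in> S \<Longrightarrow> cost (real \<circ> m') \<le> cost (real \<circ> m'')"
    using arg_min_if_finite [of S "\<lambda>m. cost (real \<circ> m)"] by (metis (no_types, lifting) empty_iff linorder_not_le)
  have *: "\<exists>m2\<in>S. cost (real \<circ> m2) < cost (real \<circ> m1)" if "m1 \<in> S" "{x. m1 x \<noteq> 0} \<notin> \<Delta>" for m1
    using exchange_step [of m1 N] that unfolding S_def by auto
  show thesis
  proof (rule that [of m'])
    show "{x. m' x \<noteq> 0} \<in> \<Delta>" using * m' by (meson linorder_not_le)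
    show "{x. m x \<noteq> 0} \<notin> \<Delta> \<longrightarrow> cost (real \<circ> m') < cost (real \<circ> m)"
      using * [OF \<open>m \<in> S\<close>] m'(2) by force
  qed (use m' S_def in auto)
qed

text \<open>The reduced representations of \<open>N \<cdot> \<sigma> + J\<close> have, for infinitely many \<open>N\<close>, the same support \<open>\<tau>\<close>;
  on \<open>\<tau>\<close> they are affine in \<open>N\<close>, with slope the reduced representation of \<open>\<sigma>\<close>. So \<open>\<sigma> \<subseteq> \<tau>\<close>.\<close>
lemma maximal_face_reduction:
  assumes \<sigma>: "maximal_face \<sigma>" and J: "J \<in> V"
  obtains N m where "{x. m x \<noteq> 0} \<subseteq> \<sigma>" "comb (real \<circ> m) = comb (\<lambda>I. real N * of_bool (I \<in> \<sigma>) + of_bool (I = J))"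
    "J \<notin> \<sigma> \<Longrightarrow> cost (real \<circ> m) < cost (\<lambda>I. real N * of_bool (I \<in> \<sigma>) + of_bool (I = J))"
proof -
  have \<sigma>\<Delta>: "\<sigma> \<in> \<Delta>" and \<sigma>V: "\<sigma> \<subseteq> V" using \<sigma> face_subset by (auto simp: maximal_face_def)
  define g :: "nat \<Rightarrow> 'v \<Rightarrow> nat" where "g N I = N * of_bool (I \<in> \<sigma>) + of_bool (I = J)" for N I
  have rg: "(real \<circ> g N) = (\<lambda>I. real N * of_bool (I \<in> \<sigma>) + of_bool (I = J))" for N
    by (auto simp: g_def)
  have "g N \<in> nat_weights (sum (g N) V)" for N
    using \<sigma>V J by (auto simp: nat_weights_def g_def)
  then have "\<exists>m. m \<in> nat_weights (sum (g N) V) \<and> {x. m x \<noteq> 0} \<in> \<Delta> \<and> comb (real \<circ> m) = comb (real \<circ> g N) \<and>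
    ({x. g N x \<noteq> 0} \<notin> \<Delta> \<longrightarrow> cost (real \<circ> m) < cost (real \<circ> g N))" for N
    using nat_reduce by metis
  then obtain m where m: "\<And>N. m N \<in> nat_weights (sum (g N) V)" "\<And>N. {x. m N x \<noteq> 0} \<in> \<Delta>"
    "\<And>N. comb (real \<circ> m N) = comb (real \<circ> g N)"
    "\<And>N. {x. g N x \<noteq> 0} \<notin> \<Delta> \<longrightarrow> cost (real \<circ> m N) < cost (real \<circ> g N)"
    by metis
  define s where "s N = {x. m N x \<noteq> 0}" for N
  have "finite (range s)" by (rule finite_subset [OF _ finite_complex]) (use m s_def in auto)
  then obtain N0 where inf: "infinite {N. s N = s N0}"
    using pigeonhole_infinite [of "UNIV :: nat set" s] by auto
  define \<tau> where "\<tau> = s N0"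
  have \<tau>: "\<tau> \<in> \<Delta>" "\<tau> \<subseteq> V" using m face_subset by (auto simp: \<tau>_def s_def)
  define X where "X = {N. s N = \<tau>}"
  have Xinf: "infinite X" using inf by (simp add: X_def \<tau>_def)
  have cb: "comb (real \<circ> m N) q = (\<Sum>I\<in>\<tau>. real (m N I) * h I q)" if "N \<in> X" for N q
  proof -
    have "(real \<circ> m N) = (\<lambda>I. of_bool (I \<in> \<tau>) * real (m N I))" using that by (auto simp: X_def s_def)
    then show ?thesis using comb_indicator [OF \<tau>(2)] by metis
  qed
  have cg: "comb (real \<circ> g N) q = real N * comb (\<lambda>I. of_bool (I \<in> \<sigma>)) q + h J q" for N q
    unfolding rg comb_add comb_scale by (simp add: comb_single J)
  obtain N1 where N1: "N1 \<in> X" using Xinf by (metis finite.emptyI ex_in_conv)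
  obtain N2 where N2: "N2 \<in> X" "N1 < N2" using Xinf by (meson infinite_nat_iff_unbounded)
  define d where "d I = (real (m N2 I) - real (m N1 I)) / (real N2 - real N1)" for I
  have dq: "(\<Sum>I\<in>\<tau>. d I * h I q) = comb (\<lambda>I. of_bool (I \<in> \<sigma>)) q" for q
  proof -
    have "(\<Sum>I\<in>\<tau>. d I * h I q) = (comb (real \<circ> m N2) q - comb (real \<circ> m N1) q) / (real N2 - real N1)"
      unfolding cb [OF N1] cb [OF N2(1)] d_def
      by (simp add: left_diff_distrib sum_subtractf flip: sum_divide_distrib diff_divide_distrib)
    also have "\<dots> = comb (\<lambda>I. of_bool (I \<in> \<sigma>)) q"
      using N2(2) by (simp add: m(3) cg field_simps)
    finally show ?thesis .
  qed
  \<comment> \<open>A negative slope would drive the weight of \<open>I\<close> below 0 along the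
    infinite set \<open>X\<close>.\<close>
  have dnn: "0 \<le> d I" if I: "I \<in> \<tau>" for I
  proof (rule ccontr)
    assume neg: "\<not> 0 \<le> d I"
    have line: "real (m N I) = real (m N1 I) + (real N - real N1) * d I" if N: "N \<in> X" for N
    proof (rule face_coordinates_unique [OF \<tau>(1) _ I])
      fix q
      show "(\<Sum>I\<in>\<tau>. real (m N I) * h I q) = (\<Sum>I\<in>\<tau>. (real (m N1 I) + (real N - real N1) * d I) * h I q)"
      proof -
        have "(\<Sum>I\<in>\<tau>. (real (m N1 I) + (real N - real N1) * d I) * h I q)
          = (\<Sum>I\<in>\<tau>. real (m N1 I) * h I q) + (real N - real N1) * (\<Sum>I\<in>\<tau>. d I * h I q)"
          by (simp add: distrib_right sum.distrib mult.assoc sum_distrib_left)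
        also have "\<dots> = (\<Sum>I\<in>\<tau>. real (m N I) * h I q)"
          unfolding dq cb [OF N1, symmetric] cb [OF N, symmetric] by (simp add: m(3) cg algebra_simps)
        finally show ?thesis by simp
      qed
    qed
    obtain N where N: "N \<in> X" "N > N1 + nat \<lceil>real (m N1 I) / (- d I)\<rceil>"
      using Xinf by (meson infinite_nat_iff_unbounded)
    have "real (m N1 I) / (- d I) < real N - real N1" using N(2) by linarith
    then have "real (m N1 I) < (real N - real N1) * (- d I)" using neg by (simp add: field_simps)
    then show False using line [OF N(1)] by simp
  qed
  have slope: "of_bool (I \<in> \<tau>) * d I = of_bool (I \<in> \<sigma>)" if "I \<in> V" for I
  proof (rule unique_comb [OF _ _ _ _ _ that])
    show "{I \<in> V. of_bool (I \<in> \<tau>) * d I \<noteq> 0} \<in> \<Delta>" by (rule clique_complex_mono [OF \<tau>(1)]) auto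
    show "{I \<in> V. (of_bool (I \<in> \<sigma>) :: real) \<noteq> 0} \<in> \<Delta>" by (rule clique_complex_mono [OF \<sigma>\<Delta>]) auto
    show "comb (\<lambda>I. of_bool (I \<in> \<tau>) * d I) = comb (\<lambda>I. of_bool (I \<in> \<sigma>))"
      by (rule ext) (simp add: comb_indicator [OF \<tau>(2)] dq)
  qed (use dnn in auto)
  have "\<sigma> \<subseteq> \<tau>"
  proof
    fix I assume "I \<in> \<sigma>"
    then show "I \<in> \<tau>" using slope [of I] \<sigma>V by (cases "I \<in> \<tau>") auto
  qed
  then have eq: "\<tau> = \<sigma>" using \<sigma> \<tau>(1) unfolding maximal_face_def by blast
  \<comment> \<open>Since \<open>N2\<close> is positive, the support of \<open>g N2\<close> contains
    all of \<sigma>; together with \<open>J\<close> it is not a face by maximality, which yields the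
    strict drop in cost.\<close>
  have N: "N2 \<in> X" "0 < N2" using N2 by auto
  show thesis
  proof (rule that [of "m N2" N2])
    show "{x. m N2 x \<noteq> 0} \<subseteq> \<sigma>" using N(1) eq by (auto simp: X_def s_def)
    show "comb (real \<circ> m N2) = comb (\<lambda>I. real N2 * of_bool (I \<in> \<sigma>) + of_bool (I = J))"
      using m(3) rg by simp
    assume "J \<notin> \<sigma>"
    moreover have "{x. g N2 x \<noteq> 0} = insert J \<sigma>" using N(2) by (auto simp: g_def)
    ultimately have "{x. g N2 x \<noteq> 0} \<notin> \<Delta>" using \<sigma> unfolding maximal_face_def by blast
    then show "cost (real \<circ> m N2) < cost (\<lambda>I. real N2 * of_bool (I \<in> \<sigma>) + of_bool (I = J))"
      using m(4) [of N2] rg by simp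
  qed
qed

text \<open>Subtracting \<open>N\<close> copies of \<sigma> from the reduced representation leaves
  integer, possibly negative, coefficients. The cost is linear, so the strict drop survives. The
  equations lead to lattice bases, the inequality to regularity.\<close>

lemma maximal_face_coordinates:
  assumes \<sigma>: "maximal_face \<sigma>" and J: "J \<in> V"
  obtains c :: "'v \<Rightarrow> int" where "\<And>q. h J q = (\<Sum>I\<in>\<sigma>. of_int (c I) * h I q)"
    "J \<notin> \<sigma> \<Longrightarrow> (\<Sum>I\<in>\<sigma>. of_int (c I) * w I) < w J"
proof -
  have \<sigma>V: "\<sigma> \<subseteq> V" using \<sigma> face_subset by (auto simp: maximal_face_def)
  obtain m N where m: "{x. m x \<noteq> 0} \<subseteq> \<sigma>" "comb (real \<circ> m) = comb (\<lambda>I. real N * of_bool (I \<in> \<sigma>) + of_bool (I = J))"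
    "J \<notin> \<sigma> \<Longrightarrow> cost (real \<circ> m) < cost (\<lambda>I. real N * of_bool (I \<in> \<sigma>) + of_bool (I = J))"
    by (rule maximal_face_reduction [OF assms]) blast
  have sums: "(\<Sum>I\<in>\<sigma>. of_int (int (m I) - int N) * F I) = (\<Sum>I\<in>V. (real \<circ> m) I * F I) - real N * (\<Sum>I\<in>V. of_bool (I \<in> \<sigma>) * F I)" for F :: "'v \<Rightarrow> real"
  proof -
    have "(\<Sum>I\<in>V. (real \<circ> m) I * F I) - real N * (\<Sum>I\<in>V. of_bool (I \<in> \<sigma>) * F I)
       = (\<Sum>I\<in>V. (real (m I) - real N * of_bool (I \<in> \<sigma>)) * F I)"
      by (simp add: sum_distrib_left sum_subtractf algebra_simps)
    also have "\<dots> = (\<Sum>I\<in>\<sigma>. of_int (int (m I) - int N) * F I)"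
      by (rule sum.mono_neutral_cong_right) (use finite_V \<sigma>V m(1) in auto)
    finally show ?thesis by simp
  qed
  show thesis
  proof (rule that [of "\<lambda>I. int (m I) - int N"])
    fix q
    have "comb (real \<circ> m) q = real N * comb (\<lambda>I. of_bool (I \<in> \<sigma>)) q + h J q"
      unfolding m(2) comb_add comb_scale by (simp add: comb_single J)
    then show "h J q = (\<Sum>I\<in>\<sigma>. of_int (int (m I) - int N) * h I q)"
      unfolding sums by (simp add: comb_def)
  next
    assume "J \<notin> \<sigma>"
    have "cost (\<lambda>I. real N * of_bool (I \<in> \<sigma>) + of_bool (I = J)) = real N * (\<Sum>I\<in>V. of_bool (I \<in> \<sigma>) * w I) + w J"
      using cost_single [OF J] unfolding cost_def by (simp add: sum.distrib sum_distrib_left algebra_simps)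
    then show "(\<Sum>I\<in>\<sigma>. of_int (int (m I) - int N) * w I) < w J"
      using m(3) [OF \<open>J \<notin> \<sigma>\<close>] unfolding sums by (simp add: cost_def)
  qed
qed

text \<open>Finiteness does not provide a cheapest real representation, so \<open>N * u\<close> is
  rounded down to integer weights. One maximal face \<sigma> carries the reductions for infinitely
  many \<open>N\<close>. Coordinates on \<sigma> are linear in the weights and the rounding error
  stays bounded, so the coordinates of \<open>u\<close> itself are nonnegative.\<close>

lemma real_reduce:
  assumes u: "\<And>I. I \<in> V \<Longrightarrow> 0 \<le> u I"
  obtains u' where "\<And>I. 0 \<le> u' I" "{I. u' I \<noteq> 0} \<in> \<Delta>" "comb u' = comb u"
proof -
  define g :: "nat \<Rightarrow> 'v \<Rightarrow> nat" where "g N I = of_bool (I \<in> V) * nat \<lfloor>real N * u I\<rfloor>" for N I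
  have "g N \<in> nat_weights (sum (g N) V)" for N by (auto simp: nat_weights_def g_def)
  \<comment> \<open>Supports are enlarged to maximal faces, on which every vertex has
    coordinates.\<close>
  then have "\<exists>m \<sigma>. {x. m x \<noteq> 0} \<subseteq> \<sigma> \<and> maximal_face \<sigma> \<and> comb (real \<circ> m) = comb (real \<circ> g N)" for N
    using nat_reduce face_in_maximal_face by metis
  then obtain m s where m: "\<And>N. {x. m N x \<noteq> 0} \<subseteq> s N" "\<And>N. maximal_face (s N)"
    "\<And>N. comb (real \<circ> m N) = comb (real \<circ> g N)" by metis
  have "finite (range s)" by (rule finite_subset [OF _ finite_complex]) (use m maximal_face_def in auto)
  then obtain N0 where inf: "infinite {N. s N = s N0}"
    using pigeonhole_infinite [of "UNIV :: nat set" s] by auto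
  define \<sigma> where "\<sigma> = s N0"
  have \<sigma>: "maximal_face \<sigma>" "\<sigma> \<in> \<Delta>" using m(2) [of N0] by (simp_all add: \<sigma>_def maximal_face_def)
  have \<sigma>V: "\<sigma> \<subseteq> V" by (rule face_subset [OF \<sigma>(2)])
  have "\<exists>c :: 'v \<Rightarrow> int. \<forall>q. h J q = (\<Sum>I\<in>\<sigma>. of_int (c I) * h I q)" if "J \<in> V" for J
    using maximal_face_coordinates [OF \<sigma>(1) that] by blast
  then obtain c :: "'v \<Rightarrow> 'v \<Rightarrow> int" where c: "\<And>J q. J \<in> V \<Longrightarrow> h J q = (\<Sum>I\<in>\<sigma>. of_int (c J I) * h I q)"
    by metis
  have exp: "comb v q = (\<Sum>I\<in>\<sigma>. (\<Sum>J\<in>V. v J * of_int (c J I)) * h I q)" for v q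
  proof -
    have "comb v q = (\<Sum>J\<in>V. \<Sum>I\<in>\<sigma>. v J * (of_int (c J I) * h I q))"
      unfolding comb_def by (intro sum.cong refl) (simp add: c sum_distrib_left)
    also have "\<dots> = (\<Sum>I\<in>\<sigma>. (\<Sum>J\<in>V. v J * of_int (c J I)) * h I q)"
      by (subst sum.swap) (simp add: sum_distrib_right mult.assoc)
    finally show ?thesis .
  qed
  define L where "L I = (\<Sum>J\<in>V. u J * of_int (c J I))" for I
  have Lnn: "0 \<le> L I" if I: "I \<in> \<sigma>" for I
  proof (rule ccontr)
    assume neg: "\<not> 0 \<le> L I"
    \<comment> \<open>Rounding changes each weight by at most 1, so \<open>C\<close> bounds the
      error in coordinate \<open>I\<close> independently of \<open>N\<close>.\<close>
    define C where "C = (\<Sum>J\<in>V. \<bar>of_int (c J I)\<bar> :: real)"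
    have "0 \<le> real N * L I + C" if N: "s N = \<sigma>" for N
    proof -
      have "real (m N I) = (\<Sum>J\<in>V. real (g N J) * of_int (c J I))"
      proof (rule face_coordinates_unique [OF \<sigma>(2) _ I])
        fix q
        have "(\<Sum>I\<in>\<sigma>. real (m N I) * h I q) = comb (real \<circ> m N) q"
          unfolding comb_def by (rule sum.mono_neutral_cong_left) (use \<sigma>V finite_V N m(1) [of N] in auto)
        then show "(\<Sum>I\<in>\<sigma>. real (m N I) * h I q) = (\<Sum>I\<in>\<sigma>. (\<Sum>J\<in>V. real (g N J) * of_int (c J I)) * h I q)"
          by (simp add: m(3) exp)
      qed
      also have "\<dots> \<le> (\<Sum>J\<in>V. real N * (u J * of_int (c J I)) + \<bar>of_int (c J I)\<bar>)"
      proof (rule sum_mono)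
        fix J assume J: "J \<in> V"
        have b: "real N * u J - 1 \<le> real (g N J)" "real (g N J) \<le> real N * u J"
          using J u [OF J] by (auto simp: g_def)
        have "\<bar>(real (g N J) - real N * u J) * of_int (c J I)\<bar> \<le> 1 * \<bar>of_int (c J I)\<bar>"
          unfolding abs_mult by (rule mult_right_mono) (use b in auto)
        then show "real (g N J) * of_int (c J I) \<le> real N * (u J * of_int (c J I)) + \<bar>of_int (c J I)\<bar>"
          by (simp add: algebra_simps)
      qed
      also have "\<dots> = real N * L I + C"
        by (simp add: L_def C_def sum.distrib sum_distrib_left)
      finally show ?thesis by linarith
    qed
    moreover obtain N where "s N = \<sigma>" "N > nat \<lceil>C / (- L I)\<rceil>"
      using inf unfolding infinite_nat_iff_unbounded \<sigma>_def by blast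
    ultimately have "0 \<le> real N * L I + C" "C / (- L I) < real N" by (auto, linarith)
    then show False using neg by (simp add: field_simps)
  qed
  show thesis
  proof (rule that [of "\<lambda>I. of_bool (I \<in> \<sigma>) * L I"])
    show "{I. of_bool (I \<in> \<sigma>) * L I \<noteq> 0} \<in> \<Delta>" by (rule clique_complex_mono [OF \<sigma>(2)]) auto
    show "comb (\<lambda>I. of_bool (I \<in> \<sigma>) * L I) = comb u"
      by (rule ext) (simp add: comb_indicator [OF \<sigma>V] exp L_def)
  qed (use Lnn in auto)
qed

section \<open>Convex hulls and the triangulation\<close>

lemma conv_pts_subset_iff:
  assumes "\<sigma> \<subseteq> V"
  shows "x \<in> conv_pts \<sigma> f \<longleftrightarrow>
    (\<exists>u. (\<forall>I\<in>V. 0 \<le> u I) \<and> (\<forall>I\<in>V - \<sigma>. u I = 0) \<and> (\<forall>q. comb u q = (case q of None \<Rightarrow> 1 | Some p \<Rightarrow> x p)))"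
    (is "?l = ?r")
proof
  assume ?l
  then obtain u where u: "\<forall>s\<in>\<sigma>. 0 \<le> u s" "sum u \<sigma> = 1" "x = (\<lambda>p. \<Sum>s\<in>\<sigma>. u s * f s p)"
    unfolding conv_pts_def by blast
  show ?r
  proof (intro exI [of _ "\<lambda>I. of_bool (I \<in> \<sigma>) * u I"] conjI allI)
    show "comb (\<lambda>I. of_bool (I \<in> \<sigma>) * u I) q = (case q of None \<Rightarrow> 1 | Some p \<Rightarrow> x p)" for q
      using u(2,3) by (simp add: comb_indicator [OF assms] split: option.split)
  qed (use u in auto)
next
  assume ?r
  then obtain u where u: "\<forall>I\<in>V. 0 \<le> u I" "\<forall>I\<in>V - \<sigma>. u I = 0"
    "\<And>q. comb u q = (case q of None \<Rightarrow> 1 | Some p \<Rightarrow> x p)" by blast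
  have e: "comb u q = (\<Sum>I\<in>\<sigma>. u I * h I q)" for q
    unfolding comb_def by (rule sum.mono_neutral_right) (use assms finite_V u(2) in auto)
  show ?l unfolding conv_pts_def
    using u(1) u(3) [of None] u(3) [of "Some _"] assms by (auto simp: e intro!: exI [of _ u])
qed

text \<open>A point of two simplices has a weighting on each; uniqueness makes them equal, hence
  supported on the intersection. Covering is \<open>real_reduce\<close> at total weight 1.\<close>

lemma triangulation: "is_triangulation \<Delta> V f (conv_pts V f)"
  unfolding is_triangulation_def
proof (intro conjI ballI)
  fix \<sigma> assume \<sigma>: "\<sigma> \<in> \<Delta>"
  show "\<sigma> \<subseteq> V" "finite \<sigma>" using face_subset finite_face \<sigma> by auto
  show "aff_indep \<sigma> f" unfolding aff_indep_def
  proof (intro allI impI ballI)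
    fix u I assume u: "sum u \<sigma> = 0 \<and> (\<lambda>p. \<Sum>s\<in>\<sigma>. u s * f s p) = (\<lambda>p. 0)" and I: "I \<in> \<sigma>"
    have "(\<Sum>s\<in>\<sigma>. u s * h s q) = 0" for q using u by (cases q) (auto dest: fun_cong)
    then show "u I = 0" by (rule face_independent [OF \<sigma> _ I])
  qed
next
  show "(\<Union>\<sigma>\<in>\<Delta>. conv_pts \<sigma> f) = conv_pts V f"
  proof
    show "(\<Union>\<sigma>\<in>\<Delta>. conv_pts \<sigma> f) \<subseteq> conv_pts V f"
    proof clarify
      fix \<sigma> x assume s: "\<sigma> \<in> \<Delta>" "x \<in> conv_pts \<sigma> f"
      then show "x \<in> conv_pts V f"
        unfolding conv_pts_subset_iff [OF face_subset [OF s(1)]] conv_pts_subset_iff [OF order_refl] by blast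
    qed
    show "conv_pts V f \<subseteq> (\<Union>\<sigma>\<in>\<Delta>. conv_pts \<sigma> f)"
    proof
      fix x assume "x \<in> conv_pts V f"
      then obtain u where u: "\<And>I. I \<in> V \<Longrightarrow> 0 \<le> u I" "\<And>q. comb u q = (case q of None \<Rightarrow> 1 | Some p \<Rightarrow> x p)"
        unfolding conv_pts_subset_iff [OF order_refl] by blast
      obtain u' where u': "\<And>I. 0 \<le> u' I" "{I. u' I \<noteq> 0} \<in> \<Delta>" "comb u' = comb u"
        by (rule real_reduce [OF u(1)]) blast+
      have "x \<in> conv_pts {I. u' I \<noteq> 0} f"
        unfolding conv_pts_subset_iff [OF face_subset [OF u'(2)]] using u' u(2) by (auto intro!: exI [of _ u'])
      then show "x \<in> (\<Union>\<sigma>\<in>\<Delta>. conv_pts \<sigma> f)" using u'(2) by blast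
    qed
  qed
next
  fix \<sigma> \<tau> assume \<sigma>: "\<sigma> \<in> \<Delta>" and \<tau>: "\<tau> \<in> \<Delta>"
  have st: "\<sigma> \<subseteq> V" "\<tau> \<subseteq> V" "\<sigma> \<inter> \<tau> \<subseteq> V" using \<sigma> \<tau> face_subset by auto
  show "conv_pts \<sigma> f \<inter> conv_pts \<tau> f = conv_pts (\<sigma> \<inter> \<tau>) f"
  proof (intro equalityI subsetI)
    fix x assume x: "x \<in> conv_pts \<sigma> f \<inter> conv_pts \<tau> f"
    then obtain u where u: "\<forall>I\<in>V. 0 \<le> u I" "\<forall>I\<in>V - \<sigma>. u I = 0" "\<forall>q. comb u q = (case q of None \<Rightarrow> 1 | Some p \<Rightarrow> x p)"
      unfolding Int_iff conv_pts_subset_iff [OF st(1)] by auto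
    from x obtain v where v: "\<forall>I\<in>V. 0 \<le> v I" "\<forall>I\<in>V - \<tau>. v I = 0" "\<forall>q. comb v q = (case q of None \<Rightarrow> 1 | Some p \<Rightarrow> x p)"
      unfolding Int_iff conv_pts_subset_iff [OF st(2)] by auto
    have "u I = v I" if "I \<in> V" for I
    proof (rule unique_comb [OF _ _ _ _ _ that])
      show "{I \<in> V. u I \<noteq> 0} \<in> \<Delta>" by (rule clique_complex_mono [OF \<sigma>]) (use u(2) in auto)
      show "{I \<in> V. v I \<noteq> 0} \<in> \<Delta>" by (rule clique_complex_mono [OF \<tau>]) (use v(2) in auto)
      show "comb u = comb v" using u(3) v(3) by auto
    qed (use u(1) v(1) in auto)
    then show "x \<in> conv_pts (\<sigma> \<inter> \<tau>) f"
      unfolding conv_pts_subset_iff [OF st(3)] using u v by (intro exI [of _ u]) auto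
  next
    fix x assume "x \<in> conv_pts (\<sigma> \<inter> \<tau>) f"
    then show "x \<in> conv_pts \<sigma> f \<inter> conv_pts \<tau> f"
      unfolding Int_iff conv_pts_subset_iff [OF st(1)] conv_pts_subset_iff [OF st(2)] conv_pts_subset_iff [OF st(3)]
      by blast
  qed
qed

end

text \<open>The last two assumptions make the homogenised points generate the whole integer lattice:
  \<open>origin\<close> provides the unit vector at \<open>None\<close>, \<open>unit_vectors\<close>
  those at the elements of \<open>P\<close>.\<close>

locale lattice_config = exchange_config V f R w
  for V :: "'v set" and f :: "'v \<Rightarrow> 'i \<Rightarrow> real" and R w +
  fixes P :: "'i set"
  assumes finite_P: "finite P"
    and outside_P: "p \<notin> P \<Longrightarrow> f I p = 0"
    and origin: "\<exists>I\<in>V. \<forall>p. f I p = 0"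
    and unit_vectors: "p \<in> P \<Longrightarrow> \<exists>J\<in>V. \<exists>J'\<in>V. \<forall>q. f J q - f J' q = of_bool (q = p)"
begin

section \<open>Lattice bases, unimodularity and regularity\<close>

abbreviation Q :: "'i option set" where "Q \<equiv> insert None (Some ` P)"

lemma finite_Q: "finite Q"
  using finite_P by simp

lemma outside_Q: "q \<notin> Q \<Longrightarrow> h I q = 0"
  by (cases q) (auto intro!: outside_P)

lemma sum_Q: "(\<Sum>q\<in>Q. g q) = (\<Sum>p\<in>P. g (Some p)) + g None" for g :: "'i option \<Rightarrow> real"
  using finite_P by (simp add: sum.reindex add.commute image_iff)

lemma unit_coordinates:
  assumes \<sigma>: "maximal_face \<sigma>" and q: "q \<in> Q"
  shows "\<exists>d :: 'v \<Rightarrow> int. \<forall>r. (\<Sum>I\<in>\<sigma>. of_int (d I) * h I r) = of_bool (r = q)"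
proof (cases q)
  case None
  obtain J where J: "J \<in> V" "\<forall>p. f J p = 0" using origin by blast
  obtain c :: "'v \<Rightarrow> int" where c: "\<And>r. h J r = (\<Sum>I\<in>\<sigma>. of_int (c I) * h I r)"
    using maximal_face_coordinates [OF \<sigma> J(1)] by metis
  have "h J r = of_bool (r = q)" for r using J None by (cases r) auto
  then show ?thesis using c by metis
next
  case (Some p)
  then have "p \<in> P" using q by auto
  then obtain J J' where J: "J \<in> V" "J' \<in> V" "\<And>q. f J q - f J' q = of_bool (q = p)"
    using unit_vectors by meson
  obtain c :: "'v \<Rightarrow> int" where c: "\<And>r. h J r = (\<Sum>I\<in>\<sigma>. of_int (c I) * h I r)"
    using maximal_face_coordinates [OF \<sigma> J(1)] by metis
  obtain c' :: "'v \<Rightarrow> int" where c': "\<And>r. h J' r = (\<Sum>I\<in>\<sigma>. of_int (c' I) * h I r)"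
    using maximal_face_coordinates [OF \<sigma> J(2)] by metis
  have "(\<Sum>I\<in>\<sigma>. of_int (c I - c' I) * h I r) = h J r - h J' r" for r
    by (simp add: c c' left_diff_distrib sum_subtractf)
  moreover have "h J r - h J' r = of_bool (r = q)" for r
    using J(3) Some by (cases r) auto
  ultimately show ?thesis by metis
qed

text \<open>The rows of \<open>d\<close> express unit vectors through \<sigma>. Expanding
  \<open>h I\<close> in unit vectors thus gives a second expression of \<open>h I\<close> through
  \<sigma>, and independence forces the other matrix product to be the identity too.\<close>

lemma maximal_face_dual_basis:
  assumes \<sigma>: "maximal_face \<sigma>"
  obtains d :: "'i option \<Rightarrow> 'v \<Rightarrow> int"
  where "\<And>q r. q \<in> Q \<Longrightarrow> (\<Sum>I\<in>\<sigma>. of_int (d q I) * h I r) = of_bool (r = q)"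
    "\<And>I J. I \<in> \<sigma> \<Longrightarrow> J \<in> \<sigma> \<Longrightarrow> (\<Sum>q\<in>Q. h I q * of_int (d q J)) = of_bool (J = I)"
proof -
  obtain d :: "'i option \<Rightarrow> 'v \<Rightarrow> int" where d: "\<And>q r. q \<in> Q \<Longrightarrow> (\<Sum>I\<in>\<sigma>. of_int (d q I) * h I r) = of_bool (r = q)"
    using unit_coordinates [OF \<sigma>] by metis
  have \<sigma>\<Delta>: "\<sigma> \<in> \<Delta>" using \<sigma> by (simp add: maximal_face_def)
  have "(\<Sum>q\<in>Q. h I q * of_int (d q J)) = of_bool (J = I)" if I: "I \<in> \<sigma>" and J: "J \<in> \<sigma>" for I J
  proof (rule face_coordinates_unique [OF \<sigma>\<Delta> _ J])
    fix r
    have "(\<Sum>J\<in>\<sigma>. (\<Sum>q\<in>Q. h I q * of_int (d q J)) * h J r) = (\<Sum>q\<in>Q. h I q * (\<Sum>J\<in>\<sigma>. of_int (d q J) * h J r))"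
      by (subst sum_distrib_left, subst sum.swap) (simp only: sum_distrib_right mult.assoc)
    also have "\<dots> = (\<Sum>q\<in>Q. h I q * of_bool (r = q))" by (intro sum.cong refl) (simp add: d)
    also have "\<dots> = (\<Sum>q\<in>Q. if r = q then h I q else 0)" by (intro sum.cong refl) auto
    also have "\<dots> = h I r" using finite_Q outside_Q by (subst sum.delta') auto
    also have "\<dots> = (\<Sum>J\<in>\<sigma>. if J = I then h J r else 0)" using I finite_face [OF \<sigma>\<Delta>] by simp
    also have "\<dots> = (\<Sum>J\<in>\<sigma>. of_bool (J = I) * h J r)" by (intro sum.cong) auto
    finally show "(\<Sum>J\<in>\<sigma>. (\<Sum>q\<in>Q. h I q * of_int (d q J)) * h J r) = (\<Sum>J\<in>\<sigma>. of_bool (J = I) * h J r)" .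
  qed
  then show thesis using that d by blast
qed

text \<open>The matrices \<open>h\<close> and \<open>d\<close> are mutually inverse, and comparing the traces of the two products
  shows that they are square.\<close>
lemma card_maximal_face:
  assumes \<sigma>: "maximal_face \<sigma>"
  shows "card \<sigma> = card P + 1"
proof -
  obtain d :: "'i option \<Rightarrow> 'v \<Rightarrow> int"
    where d: "\<And>q r. q \<in> Q \<Longrightarrow> (\<Sum>I\<in>\<sigma>. of_int (d q I) * h I r) = of_bool (r = q)"
    "\<And>I J. I \<in> \<sigma> \<Longrightarrow> J \<in> \<sigma> \<Longrightarrow> (\<Sum>q\<in>Q. h I q * of_int (d q J)) = of_bool (J = I)"
    by (rule maximal_face_dual_basis [OF \<sigma>]) blast
  have "real (card Q) = (\<Sum>q\<in>Q. \<Sum>I\<in>\<sigma>. of_int (d q I) * h I q)" by (simp add: d(1))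
  also have "\<dots> = (\<Sum>I\<in>\<sigma>. \<Sum>q\<in>Q. h I q * of_int (d q I))" by (subst sum.swap) (simp only: mult.commute)
  also have "\<dots> = real (card \<sigma>)" using d(2) by simp
  finally have "card Q = card \<sigma>" by simp
  then show ?thesis using finite_P by (simp add: card_image)
qed

text \<open>An integer point is lifted with homogenising coordinate 0. Its coefficients on the face
  then add up to 0, so subtracting a base vertex \<open>I0\<close> from every point does not change
  the combination.\<close>

lemma unimodular: "is_unimodular \<Delta> f {z. (\<forall>p. p \<notin> P \<longrightarrow> z p = 0) \<and> (\<forall>p. z p \<in> \<int>)} (card P)"
  unfolding is_unimodular_def
proof (intro ballI impI)
  fix \<sigma> assume "\<sigma> \<in> \<Delta>" "\<forall>\<tau>\<in>\<Delta>. \<sigma> \<subseteq> \<tau> \<longrightarrow> \<tau> = \<sigma>"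
  then have \<sigma>: "maximal_face \<sigma>" by (simp add: maximal_face_def)
  obtain d :: "'i option \<Rightarrow> 'v \<Rightarrow> int"
    where d: "\<And>q r. q \<in> Q \<Longrightarrow> (\<Sum>I\<in>\<sigma>. of_int (d q I) * h I r) = of_bool (r = q)"
    by (rule maximal_face_dual_basis [OF \<sigma>]) blast
  have "\<sigma> \<noteq> {}" using card_maximal_face [OF \<sigma>] by auto
  then obtain I0 where I0: "I0 \<in> \<sigma>" by blast
  show "card \<sigma> = card P + 1 \<and> (\<exists>I0\<in>\<sigma>. \<forall>z\<in>{z. (\<forall>p. p \<notin> P \<longrightarrow> z p = 0) \<and> (\<forall>p. z p \<in> \<int>)}.
    \<exists>c :: 'v \<Rightarrow> int. z = (\<lambda>p. \<Sum>J\<in>\<sigma>. of_int (c J) * (f J p - f I0 p)))"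
  proof (intro conjI card_maximal_face [OF \<sigma>] bexI [OF _ I0] ballI)
    fix z :: "'i \<Rightarrow> real" assume "z \<in> {z. (\<forall>p. p \<notin> P \<longrightarrow> z p = 0) \<and> (\<forall>p. z p \<in> \<int>)}"
    then have z: "\<And>p. p \<notin> P \<Longrightarrow> z p = 0" "\<And>p. of_int \<lfloor>z p\<rfloor> = z p" by auto
    define c where "c J = (\<Sum>p\<in>P. \<lfloor>z p\<rfloor> * d (Some p) J)" for J
    have c: "(\<Sum>J\<in>\<sigma>. of_int (c J) * h J q) = (\<Sum>p\<in>P. z p * of_bool (q = Some p))" for q
    proof -
      have "(\<Sum>J\<in>\<sigma>. of_int (c J) * h J q) = (\<Sum>p\<in>P. z p * (\<Sum>J\<in>\<sigma>. of_int (d (Some p) J) * h J q))"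
        unfolding c_def by (subst sum_distrib_left, subst sum.swap)
          (simp add: sum_distrib_right mult.assoc z(2))
      also have "\<dots> = (\<Sum>p\<in>P. z p * of_bool (q = Some p))" by (intro sum.cong refl) (simp add: d)
      finally show ?thesis .
    qed
    have c1: "(\<Sum>J\<in>\<sigma>. of_int (c J) :: real) = 0" using c [of None] by simp
    have c2: "(\<Sum>J\<in>\<sigma>. of_int (c J) * f J p) = z p" for p
    proof -
      have "(\<Sum>J\<in>\<sigma>. of_int (c J) * f J p) = (\<Sum>p'\<in>P. if p = p' then z p' else 0)"
        using c [of "Some p"] by (auto intro: sum.cong)
      also have "\<dots> = z p" using finite_P z(1) by (subst sum.delta') auto
      finally show ?thesis .
    qed
    show "\<exists>c :: 'v \<Rightarrow> int. z = (\<lambda>p. \<Sum>J\<in>\<sigma>. of_int (c J) * (f J p - f I0 p))"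
    proof (intro exI ext)
      fix p
      show "z p = (\<Sum>J\<in>\<sigma>. of_int (c J) * (f J p - f I0 p))"
        by (simp add: right_diff_distrib sum_subtractf c2 c1 flip: sum_distrib_right)
    qed
  qed
qed

text \<open>On a maximal face \<tau> containing \<sigma>, interpolate the costs lowered by a small
  \<delta> off \<sigma>. Outside \<tau> the unperturbed interpolation is already strictly below
  \<open>w\<close>, and finitely many strict inequalities survive a small \<delta>.\<close>

lemma face_supporting_functional:
  assumes \<sigma>: "\<sigma> \<in> \<Delta>"
  obtains \<alpha> where "\<And>J. J \<in> \<sigma> \<Longrightarrow> (\<Sum>q\<in>Q. \<alpha> q * h J q) = w J" "\<And>J. J \<in> V - \<sigma> \<Longrightarrow> (\<Sum>q\<in>Q. \<alpha> q * h J q) < w J"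
proof -
  obtain \<tau> where \<tau>: "maximal_face \<tau>" "\<sigma> \<subseteq> \<tau>" using face_in_maximal_face [OF \<sigma>] by blast
  have \<tau>\<Delta>: "\<tau> \<in> \<Delta>" using \<tau> by (simp add: maximal_face_def)
  obtain d :: "'i option \<Rightarrow> 'v \<Rightarrow> int"
    where d: "\<And>I J. I \<in> \<tau> \<Longrightarrow> J \<in> \<tau> \<Longrightarrow> (\<Sum>q\<in>Q. h I q * of_int (d q J)) = of_bool (J = I)"
    by (rule maximal_face_dual_basis [OF \<tau>(1)]) blast
  have "\<exists>c :: 'v \<Rightarrow> int. (\<forall>q. h J q = (\<Sum>I\<in>\<tau>. of_int (c I) * h I q)) \<and> (J \<notin> \<tau> \<longrightarrow> (\<Sum>I\<in>\<tau>. of_int (c I) * w I) < w J)" if "J \<in> V" for J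
    using maximal_face_coordinates [OF \<tau>(1) that] by metis
  then obtain c :: "'v \<Rightarrow> 'v \<Rightarrow> int" where c: "\<And>J q. J \<in> V \<Longrightarrow> h J q = (\<Sum>I\<in>\<tau>. of_int (c J I) * h I q)"
    "\<And>J. J \<in> V - \<tau> \<Longrightarrow> (\<Sum>I\<in>\<tau>. of_int (c J I) * w I) < w J"
    by (metis Diff_iff)
  \<comment> \<open>\<open>\<delta> * K J\<close> is the amount by which the perturbation shifts the
    interpolated value at \<open>J\<close>.\<close>
  define K where "K J = - (\<Sum>I\<in>\<tau>. of_int (c J I) * of_bool (I \<notin> \<sigma>) :: real)" for J
  have "\<forall>\<^sub>F \<delta> in at_right 0. \<delta> * K J < w J - (\<Sum>I\<in>\<tau>. of_int (c J I) * w I)" if "J \<in> V - \<tau>" for J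
  proof -
    have "((\<lambda>\<delta>. \<delta> * K J) \<longlongrightarrow> 0 * K J) (at_right 0)" by (intro tendsto_intros)
    then show ?thesis using c(2) [OF that] by (intro order_tendstoD(2)) auto
  qed
  then have "\<forall>\<^sub>F \<delta> in at_right 0. \<forall>J\<in>V - \<tau>. \<delta> * K J < w J - (\<Sum>I\<in>\<tau>. of_int (c J I) * w I)"
    using finite_V by (intro eventually_ball_finite) auto
  then have ev: "\<forall>\<^sub>F \<delta> in at_right 0. (\<forall>J\<in>V - \<tau>. \<delta> * K J < w J - (\<Sum>I\<in>\<tau>. of_int (c J I) * w I)) \<and> (0 :: real) < \<delta>"
    using eventually_at_right_less by (rule eventually_conj)
  obtain \<delta> :: real where "(\<forall>J\<in>V - \<tau>. \<delta> * K J < w J - (\<Sum>I\<in>\<tau>. of_int (c J I) * w I)) \<and> 0 < \<delta>"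
    using eventually_happens' [OF trivial_limit_at_right_real ev] ..
  then have \<delta>: "\<And>J. J \<in> V - \<tau> \<Longrightarrow> \<delta> * K J < w J - (\<Sum>I\<in>\<tau>. of_int (c J I) * w I)" "0 < \<delta>"
    by simp_all
  define t where "t I = w I - \<delta> * of_bool (I \<notin> \<sigma>)" for I
  define \<alpha> where "\<alpha> q = (\<Sum>I\<in>\<tau>. t I * of_int (d q I))" for q
  have \<alpha>\<tau>: "(\<Sum>q\<in>Q. \<alpha> q * h I q) = t I" if I: "I \<in> \<tau>" for I
  proof -
    have "(\<Sum>q\<in>Q. \<alpha> q * h I q) = (\<Sum>q\<in>Q. \<Sum>J\<in>\<tau>. t J * (h I q * of_int (d q J)))"
      unfolding \<alpha>_def by (intro sum.cong refl) (simp add: sum_distrib_left mult_ac)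
    also have "\<dots> = (\<Sum>J\<in>\<tau>. t J * (\<Sum>q\<in>Q. h I q * of_int (d q J)))"
      by (subst sum.swap) (simp only: sum_distrib_left)
    also have "\<dots> = (\<Sum>J\<in>\<tau>. if J = I then t J else 0)" by (intro sum.cong refl) (simp add: d [OF I])
    also have "\<dots> = t I" using I finite_face [OF \<tau>\<Delta>] by simp
    finally show ?thesis .
  qed
  show thesis
  proof (rule that [of \<alpha>])
    show "(\<Sum>q\<in>Q. \<alpha> q * h J q) = w J" if "J \<in> \<sigma>" for J
      using \<alpha>\<tau> [of J] that \<tau>(2) by (auto simp: t_def)
    show "(\<Sum>q\<in>Q. \<alpha> q * h J q) < w J" if J: "J \<in> V - \<sigma>" for J
    proof (cases "J \<in> \<tau>")
      case True
      then show ?thesis using \<alpha>\<tau> [of J] J \<delta>(2) by (auto simp: t_def)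
    next
      case False
      have "(\<Sum>q\<in>Q. \<alpha> q * h J q) = (\<Sum>q\<in>Q. \<Sum>I\<in>\<tau>. of_int (c J I) * (\<alpha> q * h I q))"
        using J by (intro sum.cong refl) (simp add: c(1) sum_distrib_left mult_ac)
      also have "\<dots> = (\<Sum>I\<in>\<tau>. of_int (c J I) * (\<Sum>q\<in>Q. \<alpha> q * h I q))"
        by (subst sum.swap) (simp only: sum_distrib_left)
      also have "\<dots> = (\<Sum>I\<in>\<tau>. of_int (c J I) * t I)" by (intro sum.cong refl) (simp only: \<alpha>\<tau>)
      also have "\<dots> = (\<Sum>I\<in>\<tau>. of_int (c J I) * w I) + \<delta> * K J"
        by (simp add: t_def K_def right_diff_distrib sum_subtractf sum_distrib_left mult_ac)
      finally show ?thesis using \<delta>(1) [of J] J False by auto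
    qed
  qed
qed

text \<open>For the converse, suppose an affine function below the heights touches them at
  \<open>I\<close> and \<open>J\<close>. It has the same total on an exchanged pair, so that pair
  would have to cost at least as much as \<open>I\<close> and \<open>J\<close>.\<close>

lemma regular: "is_regular \<Delta> V P f"
  unfolding is_regular_def
proof (intro exI [of _ w] allI iffI conjI)
  fix \<sigma> assume \<sigma>: "\<sigma> \<in> \<Delta>"
  show "\<sigma> \<subseteq> V" by (rule face_subset [OF \<sigma>])
  obtain \<alpha> where \<alpha>: "\<And>J. J \<in> \<sigma> \<Longrightarrow> (\<Sum>q\<in>Q. \<alpha> q * h J q) = w J" "\<And>J. J \<in> V - \<sigma> \<Longrightarrow> (\<Sum>q\<in>Q. \<alpha> q * h J q) < w J"
    by (rule face_supporting_functional [OF \<sigma>]) blast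
  show "\<exists>a c. \<forall>I\<in>V. (\<Sum>p\<in>P. a p * f I p) + c \<le> w I \<and> ((\<Sum>p\<in>P. a p * f I p) + c = w I) = (I \<in> \<sigma>)"
  proof (intro exI ballI)
    fix I assume "I \<in> V"
    then show "(\<Sum>p\<in>P. \<alpha> (Some p) * f I p) + \<alpha> None \<le> w I \<and> ((\<Sum>p\<in>P. \<alpha> (Some p) * f I p) + \<alpha> None = w I) = (I \<in> \<sigma>)"
      using \<alpha>(1) [of I] \<alpha>(2) [of I] unfolding sum_Q by (cases "I \<in> \<sigma>") auto
  qed
next
  fix \<sigma> assume "\<sigma> \<subseteq> V \<and> (\<exists>a c. \<forall>I\<in>V. (\<Sum>p\<in>P. a p * f I p) + c \<le> w I \<and> ((\<Sum>p\<in>P. a p * f I p) + c = w I) = (I \<in> \<sigma>))"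
  then obtain a c where \<sigma>: "\<sigma> \<subseteq> V" and ac: "\<And>I. I \<in> V \<Longrightarrow> (\<Sum>p\<in>P. a p * f I p) + c \<le> w I"
    "\<And>I. I \<in> \<sigma> \<Longrightarrow> (\<Sum>p\<in>P. a p * f I p) + c = w I" by blast
  have "R I J" if IJ: "I \<in> \<sigma>" "J \<in> \<sigma>" for I J
  proof (rule ccontr)
    assume "\<not> R I J"
    then obtain I' J' where IJ': "I' \<in> V" "J' \<in> V" "\<And>p. f I' p + f J' p = f I p + f J p" "w I' + w J' < w I + w J"
      using exchange [of I J] IJ \<sigma> by blast
    have "(\<Sum>p\<in>P. a p * f I' p) + (\<Sum>p\<in>P. a p * f J' p) = (\<Sum>p\<in>P. a p * f I p) + (\<Sum>p\<in>P. a p * f J p)"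
      by (simp add: IJ'(3) flip: sum.distrib distrib_left)
    then show False using ac(1) [OF IJ'(1)] ac(1) [OF IJ'(2)] ac(2) [OF IJ(1)] ac(2) [OF IJ(2)] IJ'(4) by linarith
  qed
  then show "\<sigma> \<in> \<Delta>" using \<sigma> by (auto simp: clique_complex_def)
qed

end

section \<open>Complete fans and spheres\<close>

text \<open>A finite union of closed simplices \<open>C \<gamma>\<close> inside a cube. Compactness
  later turns a continuous bijection onto the sphere into a homeomorphism.\<close>

lemma compact_space_realization:
  assumes "is_simplicial_complex \<Gamma>"
  shows "compact_space (realization \<Gamma>)"
proof -
  define W where "W = \<Union>\<Gamma>"
  define S :: "('a \<Rightarrow> real) set" where "S = {x. (\<forall>v\<in>W. 0 \<le> x v) \<and> sum x W = 1 \<and> {v\<in>W. x v \<noteq> 0} \<in> \<Gamma>}"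
  have \<Gamma>: "finite \<Gamma>" "\<And>\<sigma> \<tau>. \<sigma> \<in> \<Gamma> \<Longrightarrow> \<tau> \<subseteq> \<sigma> \<Longrightarrow> \<tau> \<in> \<Gamma>" "finite W"
    using assms unfolding is_simplicial_complex_def W_def by auto
  define C where "C \<gamma> = {x \<in> topspace (powertop_real W). sum x W \<in> {1}} \<inter> PiE W (\<lambda>v. if v \<in> \<gamma> then {0..} else {0})" for \<gamma>
  have "closedin (powertop_real W) (C \<gamma>)" for \<gamma>
    unfolding C_def
  proof (intro closedin_Int closedin_continuous_map_preimage)
    show "continuous_map (powertop_real W) euclideanreal (\<lambda>x. sum x W)"
      using \<Gamma>(3) by (intro continuous_intros) auto
    show "closedin (powertop_real W) (PiE W (\<lambda>v. if v \<in> \<gamma> then {0..} else {0}))"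
      by (auto simp: closedin_product_topology)
  qed auto
  then have "closedin (powertop_real W) (\<Union>(C ` \<Gamma>))" using \<Gamma>(1) by (intro closedin_Union) auto
  also have "\<Union>(C ` \<Gamma>) = topspace (powertop_real W) \<inter> S"
  proof (intro equalityI subsetI)
    fix x assume "x \<in> \<Union>(C ` \<Gamma>)"
    then obtain \<gamma> where \<gamma>: "\<gamma> \<in> \<Gamma>" "x \<in> topspace (powertop_real W)" "sum x W = 1"
      "\<And>v. v \<in> W \<Longrightarrow> x v \<in> (if v \<in> \<gamma> then {0..} else {0})" by (auto simp: C_def PiE_iff)
    have "{v\<in>W. x v \<noteq> 0} \<subseteq> \<gamma>" using \<gamma>(4) by (force split: if_splits)
    moreover have "0 \<le> x v" if "v \<in> W" for v using \<gamma>(4) [OF that] by (auto split: if_splits)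
    ultimately show "x \<in> topspace (powertop_real W) \<inter> S" using \<gamma> \<Gamma>(2) by (auto simp: S_def)
  next
    fix x assume "x \<in> topspace (powertop_real W) \<inter> S"
    then have "x \<in> C {v\<in>W. x v \<noteq> 0}" "{v\<in>W. x v \<noteq> 0} \<in> \<Gamma>" by (auto simp: S_def C_def PiE_iff)
    then show "x \<in> \<Union>(C ` \<Gamma>)" by blast
  qed
  finally have cl: "closedin (powertop_real W) (topspace (powertop_real W) \<inter> S)" .
  have "compactin (powertop_real W) (PiE W (\<lambda>_. {0..1}))" by (auto simp: compactin_PiE)
  moreover have "topspace (powertop_real W) \<inter> S \<subseteq> PiE W (\<lambda>_. {0..1})"
  proof
    fix x assume x: "x \<in> topspace (powertop_real W) \<inter> S"
    have "x v \<le> 1" if "v \<in> W" for v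
      using member_le_sum [of v W x] x that \<Gamma>(3) by (auto simp: S_def)
    then show "x \<in> PiE W (\<lambda>_. {0..1})" using x by (auto simp: S_def PiE_iff)
  qed
  ultimately have "compactin (powertop_real W) (topspace (powertop_real W) \<inter> S)"
    using cl by (rule closed_compactin)
  then have "compact_space (subtopology (powertop_real W) (topspace (powertop_real W) \<inter> S))"
    by (rule compact_space_subtopology)
  then show ?thesis
    unfolding realization_def W_def [symmetric] S_def [symmetric] by (metis subtopology_restrict)
qed

text \<open>The rays through \<open>\<phi> v\<close> span a complete simplicial fan with face complex \<open>\<Gamma>\<close>, and radial projection
  identifies \<open>\<Gamma>\<close> with the unit sphere.\<close>
lemma complete_fan_sphere:
  fixes \<phi> :: "'v \<Rightarrow> nat \<Rightarrow> real"
  assumes \<Gamma>: "is_simplicial_complex \<Gamma>" and W: "W = \<Union>\<Gamma>"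
    and complete: "\<And>y. \<exists>u. (\<forall>v\<in>W. 0 \<le> u v) \<and> {v \<in> W. u v \<noteq> 0} \<in> \<Gamma> \<and> (\<forall>i<D. (\<Sum>v\<in>W. u v * \<phi> v i) = y i)"
    and fan: "\<And>u u' v. \<lbrakk>\<And>v. v \<in> W \<Longrightarrow> 0 \<le> u v; \<And>v. v \<in> W \<Longrightarrow> 0 \<le> u' v; {v \<in> W. u v \<noteq> 0} \<in> \<Gamma>; {v \<in> W. u' v \<noteq> 0} \<in> \<Gamma>;
      \<And>i. i < D \<Longrightarrow> (\<Sum>v\<in>W. u v * \<phi> v i) = (\<Sum>v\<in>W. u' v * \<phi> v i); v \<in> W\<rbrakk> \<Longrightarrow> u v = u' v"
  shows "is_sphere_complex \<Gamma>"
proof (cases "W = {}")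
  case True
  then have "\<Gamma> = {{}}" using \<Gamma> W unfolding is_simplicial_complex_def by auto
  then show ?thesis by (simp add: is_sphere_complex_def)
next
  case False
  have fW: "finite W" and down: "\<And>\<sigma> \<tau>. \<sigma> \<in> \<Gamma> \<Longrightarrow> \<tau> \<subseteq> \<sigma> \<Longrightarrow> \<tau> \<in> \<Gamma>" and e: "{} \<in> \<Gamma>"
    using \<Gamma> unfolding is_simplicial_complex_def W by auto
  \<comment> \<open>In dimension 0, a unit weight on a vertex and the zero weight would have the
    same value, against uniqueness.\<close>
  have "D \<noteq> 0"
  proof
    assume "D = 0"
    obtain v where v: "v \<in> W" using False by blast
    then have "{v} \<in> \<Gamma>" using down W by blast
    moreover have "{x \<in> W. (of_bool (x = v) :: real) \<noteq> 0} = {v}" using v by auto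
    ultimately have "(of_bool (v = v) :: real) = 0"
      using e v \<open>D = 0\<close> by (intro fan [of "\<lambda>x. of_bool (x = v)" "\<lambda>x. 0"]) auto
    then show False by simp
  qed
  then obtain d where D: "D = Suc d" using not0_implies_Suc by blast
  define S :: "('v \<Rightarrow> real) set" where "S = {x. (\<forall>v\<in>W. 0 \<le> x v) \<and> sum x W = 1 \<and> {v\<in>W. x v \<noteq> 0} \<in> \<Gamma>}"
  define X where "X = realization \<Gamma>"
  have X: "X = subtopology (powertop_real W) S" by (simp add: X_def realization_def S_def W)
  have topX: "topspace X = extensional W \<inter> S" by (auto simp: X PiE_iff extensional_def)
  define \<psi> where "\<psi> x i = (\<Sum>v\<in>W. x v * \<phi> v i)" for x i
  define r where "r x = sqrt (\<Sum>i\<le>d. (\<psi> x i)\<^sup>2)" for x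
  \<comment> \<open>Points of \<open>nsphere d\<close> are functions vanishing beyond index
    \<open>d\<close>, hence the default 0.\<close>
  define F where "F x = (\<lambda>i. if i < Suc d then \<psi> x i / r x else 0)" for x
  have \<psi>_scale: "\<psi> (\<lambda>v. c * x v) i = c * \<psi> x i" for c x i
    by (simp add: \<psi>_def sum_distrib_left mult.assoc)
  have \<psi>_div: "\<psi> (\<lambda>v. x v / c) i = \<psi> x i / c" for c x i
    using \<psi>_scale [of "1 / c"] by simp
  have r0: "r x > 0" if x: "x \<in> S" for x
  proof (rule ccontr)
    assume "\<not> r x > 0"
    then have "(\<Sum>i\<le>d. (\<psi> x i)\<^sup>2) = 0"
      unfolding r_def by (metis real_sqrt_gt_zero sum_nonneg zero_le_power2 less_eq_real_def)
    then have "\<psi> x i = 0" if "i < D" for i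
      using that D by (subst (asm) sum_nonneg_eq_0_iff) auto
    then have "x v = 0" if "v \<in> W" for v
      using x e that by (intro fan [of x "\<lambda>_. 0" v]) (auto simp: S_def \<psi>_def)
    then show False using x by (simp add: S_def)
  qed
  have cont: "continuous_map X (nsphere d) F"
    unfolding nsphere_def continuous_map_in_subtopology
  proof (intro conjI)
    have c: "continuous_map X euclideanreal (\<lambda>x. \<psi> x i)" for i
      unfolding \<psi>_def X using fW by (intro continuous_intros) auto
    then have "continuous_map X euclideanreal (\<lambda>x. \<psi> x i / r x)" for i
      unfolding r_def
    proof (intro continuous_intros)
      show "sqrt (\<Sum>i\<le>d. (\<psi> x i)\<^sup>2) \<noteq> 0" if "x \<in> topspace X" for x
        using r0 [of x] that topX unfolding r_def by auto
    qed auto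
    then show "continuous_map X (Euclidean_space (Suc d)) F"
      unfolding F_def continuous_map_componentwise_Euclidean_space by blast
    show "F \<in> topspace X \<rightarrow> {x. (\<Sum>i\<le>d. (x i)\<^sup>2) = 1}"
    proof
      fix x assume "x \<in> topspace X"
      then have "r x > 0" using r0 topX by auto
      moreover have "(r x)\<^sup>2 = (\<Sum>i\<le>d. (\<psi> x i)\<^sup>2)" unfolding r_def by (simp add: sum_nonneg)
      ultimately show "F x \<in> {x. (\<Sum>i\<le>d. (x i)\<^sup>2) = 1}"
        by (auto simp: F_def less_Suc_eq_le power_divide simp flip: sum_divide_distrib)
    qed
  qed
  have inj: "inj_on F (topspace X)"
  proof (rule inj_onI)
    fix x x' assume x: "x \<in> topspace X" and x': "x' \<in> topspace X" and eq: "F x = F x'"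
    have S: "x \<in> S" "x' \<in> S" using x x' topX by auto
    have pos: "r x > 0" "r x' > 0" using r0 S by auto
    \<comment> \<open>Equal projections only make the points proportional; both have total 1, so the
      factor is 1.\<close>
    have "x v / r x = x' v / r x'" if "v \<in> W" for v
    proof (rule fan [OF _ _ _ _ _ that])
      show "(\<Sum>v\<in>W. x v / r x * \<phi> v i) = (\<Sum>v\<in>W. x' v / r x' * \<phi> v i)" if "i < D" for i
        using fun_cong [OF eq, of i] that D \<psi>_div [of x "r x" i] \<psi>_div [of x' "r x'" i]
        by (simp add: F_def) (simp add: \<psi>_def)
    qed (use S pos in \<open>auto simp: S_def\<close>)
    then have xv: "x v = (r x / r x') * x' v" if "v \<in> W" for v
      using that pos by (simp add: field_simps)
    have "sum x W = (r x / r x') * sum x' W"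
      unfolding sum_distrib_left using xv by (intro sum.cong) auto
    then have "r x / r x' = 1" using S by (simp add: S_def)
    then have "x v = x' v" if "v \<in> W" for v using xv that by simp
    moreover have "x \<in> extensional W" "x' \<in> extensional W" using x x' topX by auto
    ultimately show "x = x'" by (rule extensionalityI [rotated 2])
  qed
  have surj: "F ` topspace X = topspace (nsphere d)"
  proof
    show "F ` topspace X \<subseteq> topspace (nsphere d)" using cont by (rule continuous_map_image_subset_topspace)
    show "topspace (nsphere d) \<subseteq> F ` topspace X"
    proof
      fix y assume y: "y \<in> topspace (nsphere d)"
      then have y1: "(\<Sum>i\<le>d. (y i)\<^sup>2) = 1" "\<And>i. i > d \<Longrightarrow> y i = 0" by (auto simp: nsphere)
      obtain u where u: "\<forall>v\<in>W. 0 \<le> u v" "{v \<in> W. u v \<noteq> 0} \<in> \<Gamma>" "\<forall>i<D. (\<Sum>v\<in>W. u v * \<phi> v i) = y i"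
        using complete [of y] by blast
      have \<psi>u: "\<psi> u i = y i" if "i \<le> d" for i using u(3) that D by (simp add: \<psi>_def)
      define s where "s = sum u W"
      have "s \<noteq> 0"
      proof
        assume "s = 0"
        then have "u v = 0" if "v \<in> W" for v
          using u(1) that fW unfolding s_def by (subst (asm) sum_nonneg_eq_0_iff) auto
        then have "y i = 0" if "i \<le> d" for i using \<psi>u [OF that] by (simp add: \<psi>_def)
        then show False using y1(1) by simp
      qed
      moreover have "s \<ge> 0" unfolding s_def using u(1) by (simp add: sum_nonneg)
      ultimately have s: "s > 0" by simp
      \<comment> \<open>Positive scaling does not affect the direction, so the weights are
        normalised to total 1; \<open>restrict\<close> supplies the extensionality of points of the
        product space.\<close>
      define x where "x = restrict (\<lambda>v. u v / s) W"
      have sx: "sum x W = 1"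
        using s by (simp add: x_def s_def flip: sum_divide_distrib)
      have supp: "{v \<in> W. x v \<noteq> 0} = {v \<in> W. u v \<noteq> 0}" using s by (auto simp: x_def)
      have xX: "x \<in> topspace X"
        unfolding topX using u s sx supp by (auto simp: S_def) (auto simp: x_def)
      have \<psi>x: "\<psi> x i = y i / s" if "i \<le> d" for i
      proof -
        have "\<psi> x i = \<psi> (\<lambda>v. u v / s) i" unfolding \<psi>_def by (intro sum.cong) (auto simp: x_def)
        then show ?thesis using \<psi>_div \<psi>u [OF that] by simp
      qed
      have "(\<Sum>i\<le>d. (\<psi> x i)\<^sup>2) = (\<Sum>i\<le>d. (y i)\<^sup>2) / s\<^sup>2"
        unfolding sum_divide_distrib by (intro sum.cong) (auto simp: \<psi>x power_divide)
      then have "r x = 1 / s" using y1(1) s by (simp add: r_def real_sqrt_divide)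
      then have "F x = y" using \<psi>x y1(2) s by (auto simp: F_def fun_eq_iff less_Suc_eq_le)
      then show "y \<in> F ` topspace X" using xX by blast
    qed
  qed
  have "homeomorphic_map X (nsphere d) F"
  proof (rule continuous_imp_homeomorphic_map)
    show "compact_space X" unfolding X_def by (rule compact_space_realization [OF \<Gamma>])
    show "Hausdorff_space (nsphere d)"
      unfolding nsphere by (simp add: Hausdorff_space_subtopology Hausdorff_space_product_topology)
  qed (use cont inj surj in auto)
  then show ?thesis
    unfolding is_sphere_complex_def X_def using homeomorphic_map_imp_homeomorphic_space by blast
qed


context exchange_config
begin

text \<open>Modulo the span of \<open>A\<close>, which lies in the interior of the cone over \<open>V\<close>, the faces disjoint from \<open>A\<close>
  span a complete fan. Coordinates on the quotient are those of a maximal face \<open>\<tau> \<supseteq> A\<close> outside \<open>A\<close>.\<close>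
lemma gorenstein:
  assumes A: "A \<subseteq> V" and apex: "\<And>I J. I \<in> A \<Longrightarrow> J \<in> V \<Longrightarrow> R I J"
    and interior: "\<And>J. J \<in> V \<Longrightarrow> \<exists>u. (\<forall>I\<in>V. 0 \<le> u I) \<and> (\<forall>q. comb u q = (\<Sum>I\<in>A. h I q) - h J q)"
  shows "is_gorenstein \<Delta>"
proof -
  define \<Gamma> where "\<Gamma> = {\<sigma>\<in>\<Delta>. \<sigma> \<inter> A = {}}"
  have AR: "R I J" "R J I" if "I \<in> A" "J \<in> V" for I J using apex R_sym that by blast+
  have join: "\<sigma> \<union> \<alpha> \<in> \<Delta>" if "\<sigma> \<in> \<Delta>" "\<alpha> \<subseteq> A" for \<sigma> \<alpha>
    using that A AR unfolding clique_complex_def by blast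
  have e\<Delta>: "{} \<in> \<Delta>" by (simp add: clique_complex_def)
  have sc: "is_simplicial_complex \<Gamma>"
    using finite_complex finite_face e\<Delta> clique_complex_mono unfolding is_simplicial_complex_def \<Gamma>_def by auto blast
  have W: "\<Union>\<Gamma> = V - A"
  proof (intro equalityI subsetI)
    fix v assume "v \<in> V - A"
    then have "{v} \<in> \<Gamma>" using R_refl by (simp add: \<Gamma>_def clique_complex_def)
    then show "v \<in> \<Union>\<Gamma>" by blast
  qed (use face_subset in \<open>auto simp: \<Gamma>_def\<close>)
  have fA: "finite A" using A finite_V finite_subset by blast
  have "A \<in> \<Delta>" using join [OF e\<Delta>, of A] by simp
  then obtain \<tau> where \<tau>: "maximal_face \<tau>" "A \<subseteq> \<tau>" using face_in_maximal_face by blast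
  have \<tau>\<Delta>: "\<tau> \<in> \<Delta>" "\<tau> \<subseteq> V" using \<tau> face_subset by (auto simp: maximal_face_def)
  have f\<tau>: "finite \<tau>" by (rule finite_face [OF \<tau>\<Delta>(1)])
  have "\<exists>c :: 'v \<Rightarrow> int. \<forall>q. h J q = (\<Sum>I\<in>\<tau>. of_int (c I) * h I q)" if "J \<in> V" for J
    using maximal_face_coordinates [OF \<tau>(1) that] by blast
  then obtain c :: "'v \<Rightarrow> 'v \<Rightarrow> int" where c: "\<And>J q. J \<in> V \<Longrightarrow> h J q = (\<Sum>I\<in>\<tau>. of_int (c J I) * h I q)"
    by metis
  \<comment> \<open>Linear extension of the coordinates on \<tau>; forgetting those in
    \<open>A\<close> is the quotient map.\<close>
  define cd where "cd u I = (\<Sum>J\<in>V. u J * of_int (c J I))" for u :: "'v \<Rightarrow> real" and I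
  have exp: "comb v q = (\<Sum>I\<in>\<tau>. cd v I * h I q)" for v q
  proof -
    have "comb v q = (\<Sum>J\<in>V. \<Sum>I\<in>\<tau>. v J * (of_int (c J I) * h I q))"
      unfolding comb_def by (intro sum.cong refl) (simp add: c sum_distrib_left)
    also have "\<dots> = (\<Sum>I\<in>\<tau>. cd v I * h I q)"
      unfolding cd_def by (subst sum.swap) (simp add: sum_distrib_right mult.assoc)
    finally show ?thesis .
  qed
  have cd_eqI: "cd v I = a I" if "\<And>q. comb v q = (\<Sum>I\<in>\<tau>. a I * h I q)" "I \<in> \<tau>" for v a I
    by (rule face_coordinates_unique [OF \<tau>\<Delta>(1) _ that(2)]) (simp add: that(1) flip: exp)
  have cd_\<tau>: "cd v I = v I" if "\<And>J. J \<in> V \<Longrightarrow> J \<notin> \<tau> \<Longrightarrow> v J = 0" "I \<in> \<tau>" for v I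
  proof (rule cd_eqI [OF _ that(2)])
    fix q show "comb v q = (\<Sum>I\<in>\<tau>. v I * h I q)"
      unfolding comb_def by (rule sum.mono_neutral_right) (use \<tau>\<Delta>(2) finite_V that(1) in auto)
  qed
  have cd_add: "cd (\<lambda>I. u I + v I) I = cd u I + cd v I" for u v I
    by (simp add: cd_def sum.distrib algebra_simps)
  have cd_scale: "cd (\<lambda>I. a * u I) I = a * cd u I" for a u I
    by (simp add: cd_def sum_distrib_left algebra_simps)
  have cd_sum: "cd (\<lambda>I. \<Sum>x\<in>X. u x I) I = (\<Sum>x\<in>X. cd (u x) I)" for X and u :: "'v \<Rightarrow> 'v \<Rightarrow> real" and I
    unfolding cd_def by (subst sum.swap) (simp add: sum_distrib_right)
  have cd_eq_comb: "comb u = comb v" if "\<And>I. I \<in> \<tau> \<Longrightarrow> cd u I = cd v I" for u v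
    by (rule ext) (simp add: exp that)
  define B where "B = \<tau> - A"
  have fB: "finite B" using f\<tau> by (simp add: B_def)
  obtain s where s: "bij_betw s {0..<card B} B" using ex_bij_betw_nat_finite [OF fB] by blast
  have restr: "(\<Sum>v\<in>V - A. u v * of_int (c v I)) = cd (\<lambda>v. of_bool (v \<notin> A) * u v) I" for u I
    unfolding cd_def by (rule sum.mono_neutral_cong_left) (use finite_V in auto)
  have "is_sphere_complex \<Gamma>"
  proof (rule complete_fan_sphere [OF sc W [symmetric], where D = "card B" and \<phi> = "\<lambda>v i. of_int (c v (s i))"])
    fix y :: "nat \<Rightarrow> real"
    define y' where "y' I = y (the_inv_into {0..<card B} s I)" for I
    obtain n where n: "\<And>J I. J \<in> V \<Longrightarrow> I \<in> V \<Longrightarrow> 0 \<le> n J I" "\<And>J q. J \<in> V \<Longrightarrow> comb (n J) q = (\<Sum>I\<in>A. h I q) - h J q"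
      using interior by metis
    have ncd: "cd (n J) I = of_bool (I \<in> A) - of_bool (I = J)" if J: "J \<in> \<tau>" and I: "I \<in> \<tau>" for I J
    proof (rule cd_eqI [OF _ I])
      fix q
      have "(\<Sum>I\<in>A. h I q) = (\<Sum>I\<in>\<tau>. of_bool (I \<in> A) * h I q)"
        by (rule sum.mono_neutral_cong_left) (use \<tau>(2) f\<tau> in auto)
      moreover have "h J q = (\<Sum>I\<in>\<tau>. if I = J then h I q else 0)" using J f\<tau> by simp
      moreover have "\<dots> = (\<Sum>I\<in>\<tau>. of_bool (I = J) * h I q)" by (intro sum.cong) auto
      ultimately show "comb (n J) q = (\<Sum>I\<in>\<tau>. (of_bool (I \<in> A) - of_bool (I = J)) * h I q)"
        using n(2) J \<tau>\<Delta>(2) by (simp add: left_diff_distrib sum_subtractf subset_iff)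
    qed
    \<comment> \<open>A negative coordinate at \<open>J\<close> is realised by the nonnegative
      weighting \<open>n J\<close>, whose value is that of \<open>- J\<close> modulo the span of
      \<open>A\<close>.\<close>
    define u0 where "u0 I = of_bool (I \<in> B) * max (y' I) 0 + (\<Sum>J\<in>B. max (- y' J) 0 * n J I)" for I
    have u0nn: "0 \<le> u0 I" if "I \<in> V" for I
      unfolding u0_def using n(1) that \<tau>\<Delta>(2) by (auto intro!: add_nonneg_nonneg sum_nonneg mult_nonneg_nonneg simp: B_def)
    have cdu0: "cd u0 I = y' I" if I: "I \<in> B" for I
    proof -
      have "cd u0 I = max (y' I) 0 + (\<Sum>J\<in>B. max (- y' J) 0 * cd (n J) I)"
        unfolding u0_def cd_add cd_sum cd_scale by (subst cd_\<tau>) (use I in \<open>auto simp: B_def\<close>)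
      also have "(\<Sum>J\<in>B. max (- y' J) 0 * cd (n J) I) = (\<Sum>J\<in>B. if J = I then - max (- y' J) 0 else 0)"
        using I by (intro sum.cong) (auto simp: ncd B_def)
      finally show ?thesis using I fB by simp
    qed
    obtain u where u: "\<And>I. 0 \<le> u I" "{I. u I \<noteq> 0} \<in> \<Delta>" "comb u = comb u0"
      by (rule real_reduce [OF u0nn]) blast+
    have cdu: "cd u I = cd u0 I" if "I \<in> \<tau>" for I
      by (rule cd_eqI [OF _ that]) (simp add: u(3) exp)
    have cdA: "cd (\<lambda>v. of_bool (v \<notin> A) * u v) I = cd u I" if I: "I \<in> B" for I
    proof -
      have "cd (\<lambda>v. of_bool (v \<notin> A) * u v) I + cd (\<lambda>v. of_bool (v \<in> A) * u v) I = cd u I"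
        unfolding cd_add [symmetric] by (rule arg_cong [where f = "\<lambda>u. cd u I"]) auto
      moreover have "cd (\<lambda>v. of_bool (v \<in> A) * u v) I = 0"
        by (subst cd_\<tau>) (use I \<tau>(2) in \<open>auto simp: B_def\<close>)
      ultimately show ?thesis by simp
    qed
    show "\<exists>u. (\<forall>v\<in>V - A. 0 \<le> u v) \<and> {v \<in> V - A. u v \<noteq> 0} \<in> \<Gamma> \<and>
        (\<forall>i<card B. (\<Sum>v\<in>V - A. u v * of_int (c v (s i))) = y i)"
    proof (intro exI conjI allI impI ballI)
      show "{v \<in> V - A. u v \<noteq> 0} \<in> \<Gamma>"
        unfolding \<Gamma>_def using clique_complex_mono [OF u(2), of "{v \<in> V - A. u v \<noteq> 0}"] by auto
      fix i assume i: "i < card B"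
      then have "s i \<in> B" using s by (auto simp: bij_betw_def)
      moreover have "y' (s i) = y i"
        using i s by (simp add: y'_def the_inv_into_f_f bij_betw_def)
      ultimately show "(\<Sum>v\<in>V - A. u v * of_int (c v (s i))) = y i"
        unfolding restr using cdA cdu cdu0 by (simp add: B_def)
    qed (use u in auto)
  next
    fix u u' :: "'v \<Rightarrow> real" and v
    assume nn: "\<And>v. v \<in> V - A \<Longrightarrow> 0 \<le> u v" "\<And>v. v \<in> V - A \<Longrightarrow> 0 \<le> u' v"
      and sp: "{v \<in> V - A. u v \<noteq> 0} \<in> \<Gamma>" "{v \<in> V - A. u' v \<noteq> 0} \<in> \<Gamma>"
      and eq: "\<And>i. i < card B \<Longrightarrow> (\<Sum>v\<in>V - A. u v * of_int (c v (s i))) = (\<Sum>v\<in>V - A. u' v * of_int (c v (s i)))"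
      and v: "v \<in> V - A"
    define z where "z u = (\<lambda>v. of_bool (v \<notin> A) * u v)" for u :: "'v \<Rightarrow> real"
    \<comment> \<open>\<open>N\<close> dominates all coordinates on \<open>A\<close>, so raising
      them to the common value \<open>N\<close> adds nonnegative weights. The results have equal
      coordinates on all of \<tau>, and their supports are still faces by the apex property, so
      uniqueness applies.\<close>
    define N where "N = (\<Sum>a\<in>A. \<bar>cd (z u) a\<bar> + \<bar>cd (z u') a\<bar>)"
    have N: "\<bar>cd (z u) a\<bar> \<le> N" "\<bar>cd (z u') a\<bar> \<le> N" if "a \<in> A" for a
      using member_le_sum [of a A "\<lambda>a. \<bar>cd (z u) a\<bar> + \<bar>cd (z u') a\<bar>"] that fA unfolding N_def by auto
    define g where "g u = (\<lambda>v. z u v + of_bool (v \<in> A) * (N - cd (z u) v))" for u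
    have cdg: "cd (g u) I = (if I \<in> A then N else cd (z u) I)" if I: "I \<in> \<tau>" for u I
      unfolding g_def cd_add by (subst cd_\<tau> [OF _ I]) (use \<tau>(2) in auto)
    have sg: "{I \<in> V. g u I \<noteq> 0} \<in> \<Delta>" if "{v \<in> V - A. u v \<noteq> 0} \<in> \<Gamma>" for u
    proof (rule clique_complex_mono)
      show "{v \<in> V - A. u v \<noteq> 0} \<union> A \<in> \<Delta>" using that join by (auto simp: \<Gamma>_def)
    qed (auto simp: g_def z_def)
    have "g u v = g u' v"
    proof (rule unique_comb)
      show "comb (g u) = comb (g u')"
      proof (rule cd_eq_comb)
        fix I assume I: "I \<in> \<tau>"
        show "cd (g u) I = cd (g u') I"
        proof (cases "I \<in> A")
          case False
          then obtain i where "i < card B" "s i = I"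
            using I s by (force simp: B_def bij_betw_def)
          then have "cd (z u) I = cd (z u') I" using eq [of i] unfolding restr z_def by simp
          then show ?thesis using cdg I by simp
        qed (use cdg I in simp)
      qed
      show "0 \<le> g u I" if "I \<in> V" for I
        using nn(1) [of I] N(1) [of I] that by (auto simp: g_def z_def)
      show "0 \<le> g u' I" if "I \<in> V" for I
        using nn(2) [of I] N(2) [of I] that by (auto simp: g_def z_def)
    qed (use sg sp v in auto)
    then show "u v = u' v" using v by (simp add: g_def z_def)
  qed
  moreover have "\<Delta> = {\<alpha> \<union> \<gamma> | \<alpha> \<gamma>. \<alpha> \<subseteq> A \<and> \<gamma> \<in> \<Gamma>}"
  proof (intro equalityI subsetI)
    fix \<sigma> assume \<sigma>: "\<sigma> \<in> \<Delta>"
    have "\<sigma> = (\<sigma> \<inter> A) \<union> (\<sigma> - A)" "\<sigma> - A \<in> \<Gamma>"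
      using clique_complex_mono [OF \<sigma>, of "\<sigma> - A"] by (auto simp: \<Gamma>_def)
    then show "\<sigma> \<in> {\<alpha> \<union> \<gamma> | \<alpha> \<gamma>. \<alpha> \<subseteq> A \<and> \<gamma> \<in> \<Gamma>}" by blast
  next
    fix \<sigma> assume "\<sigma> \<in> {\<alpha> \<union> \<gamma> | \<alpha> \<gamma>. \<alpha> \<subseteq> A \<and> \<gamma> \<in> \<Gamma>}"
    then obtain \<alpha> \<gamma> where "\<sigma> = \<gamma> \<union> \<alpha>" "\<alpha> \<subseteq> A" "\<gamma> \<in> \<Delta>" by (auto simp: \<Gamma>_def)
    then show "\<sigma> \<in> \<Delta>" using join by blast
  qed
  ultimately show ?thesis
    unfolding is_gorenstein_def using fA sc W by (intro exI [of _ A] exI [of _ \<Gamma>]) auto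
qed

end

section \<open>The f-vector\<close>

context exchange_config
begin

text \<open>Each attained value has exactly one representation supported on a face. The right-hand
  side does not involve \<open>R\<close>, which makes different relations comparable.\<close>

lemma card_face_weights:
  "card {m \<in> nat_weights N. {x. m x \<noteq> 0} \<in> \<Delta>} = card ((\<lambda>m. comb (real \<circ> m)) ` nat_weights N)"
proof (rule bij_betw_same_card [of "\<lambda>m. comb (real \<circ> m)"], unfold bij_betw_def, intro conjI)
  show "inj_on (\<lambda>m. comb (real \<circ> m)) {m \<in> nat_weights N. {x. m x \<noteq> 0} \<in> \<Delta>}"
  proof (rule inj_onI)
    fix m m' assume m: "m \<in> {m \<in> nat_weights N. {x. m x \<noteq> 0} \<in> \<Delta>}" and m': "m' \<in> {m \<in> nat_weights N. {x. m x \<noteq> 0} \<in> \<Delta>}"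
      and eq: "comb (real \<circ> m) = comb (real \<circ> m')"
    have "(real \<circ> m) I = (real \<circ> m') I" if "I \<in> V" for I
    proof (rule unique_comb [OF _ _ _ _ eq that])
      show "{I \<in> V. (real \<circ> m) I \<noteq> 0} \<in> \<Delta>" "{I \<in> V. (real \<circ> m') I \<noteq> 0} \<in> \<Delta>"
        using m m' by (auto elim: clique_complex_mono)
    qed auto
    then have "m x = m' x" for x using m m' by (cases "x \<in> V") (auto simp: nat_weights_def)
    then show "m = m'" by blast
  qed
  show "(\<lambda>m. comb (real \<circ> m)) ` {m \<in> nat_weights N. {x. m x \<noteq> 0} \<in> \<Delta>} = (\<lambda>m. comb (real \<circ> m)) ` nat_weights N"
  proof (intro equalityI subsetI)
    fix z assume "z \<in> (\<lambda>m. comb (real \<circ> m)) ` nat_weights N"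
    then obtain m where m: "m \<in> nat_weights N" "z = comb (real \<circ> m)" by blast
    obtain m' where "m' \<in> nat_weights N" "{x. m' x \<noteq> 0} \<in> \<Delta>" "comb (real \<circ> m') = comb (real \<circ> m)"
      by (rule nat_reduce [OF m(1)]) blast
    then show "z \<in> (\<lambda>m. comb (real \<circ> m)) ` {m \<in> nat_weights N. {x. m x \<noteq> 0} \<in> \<Delta>}"
      using m(2) by (intro image_eqI [of _ _ m']) auto
  qed auto
qed

end

text \<open>These correspond to the compositions of \<open>N\<close> into
  \<open>card \<sigma>\<close> positive parts.\<close>

definition positive_weights :: "'v set \<Rightarrow> nat \<Rightarrow> ('v \<Rightarrow> nat) set" where
  "positive_weights \<sigma> N = {m. {x. m x \<noteq> 0} = \<sigma> \<and> sum m \<sigma> = N}"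

lemma finite_positive_weights:
  assumes "finite \<sigma>" shows "finite (positive_weights \<sigma> N)"
proof (rule finite_subset)
  show "positive_weights \<sigma> N \<subseteq> {m. \<forall>x. (x \<in> \<sigma> \<longrightarrow> m x \<in> {..N}) \<and> (x \<notin> \<sigma> \<longrightarrow> m x = 0)}"
    unfolding positive_weights_def using assms by (auto intro: member_le_sum)
  show "finite \<dots>" by (intro finite_set_of_finite_funs assms) auto
qed

lemma card_positive_weights_le:
  fixes \<sigma> :: "'a set" and \<tau> :: "'b set"
  assumes fin: "finite \<sigma>" "finite \<tau>" and card: "card \<sigma> = card \<tau>"
  shows "card (positive_weights \<sigma> N) \<le> card (positive_weights \<tau> N)"
proof -
  obtain b where b: "bij_betw b \<tau> \<sigma>" using finite_same_card_bij [OF fin(2,1)] card by metis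
  have b': "b y \<in> \<sigma>" if "y \<in> \<tau>" for y using b that by (auto simp: bij_betw_def)
  define t where "t m = (\<lambda>y. if y \<in> \<tau> then m (b y) else 0)" for m :: "'a \<Rightarrow> nat"
  show ?thesis
  proof (rule card_inj_on_le [of t])
    show "inj_on t (positive_weights \<sigma> N)"
    proof (rule inj_onI)
      fix m m' assume m: "m \<in> positive_weights \<sigma> N" "m' \<in> positive_weights \<sigma> N" "t m = t m'"
      show "m = m'"
      proof
        fix x show "m x = m' x"
        proof (cases "x \<in> \<sigma>")
          case True
          then obtain y where "y \<in> \<tau>" "x = b y" using b by (auto simp: bij_betw_def)
          then show ?thesis using fun_cong [OF m(3), of y] by (simp add: t_def)
        next
          case False
          then have "m x = 0" "m' x = 0" using m(1,2) unfolding positive_weights_def by blast+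
          then show ?thesis by simp
        qed
      qed
    qed
    show "t ` positive_weights \<sigma> N \<subseteq> positive_weights \<tau> N"
    proof (intro image_subsetI)
      fix m assume m: "m \<in> positive_weights \<sigma> N"
      have "sum (t m) \<tau> = (\<Sum>y\<in>\<tau>. m (b y))" by (intro sum.cong) (auto simp: t_def)
      then have "sum (t m) \<tau> = sum m \<sigma>" by (simp add: sum.reindex_bij_betw [OF b])
      moreover have "m x \<noteq> 0 \<longleftrightarrow> x \<in> \<sigma>" for x using m unfolding positive_weights_def by blast
      then have "{y. t m y \<noteq> 0} = \<tau>" using b' by (auto simp: t_def split: if_splits)
      ultimately show "t m \<in> positive_weights \<tau> N" using m by (simp add: positive_weights_def)
    qed
  qed (rule finite_positive_weights [OF fin(2)])
qed

lemma card_positive_weights_cong: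
  "finite \<sigma> \<Longrightarrow> finite \<tau> \<Longrightarrow> card \<sigma> = card \<tau> \<Longrightarrow> card (positive_weights \<sigma> N) = card (positive_weights \<tau> N)"
  by (simp add: card_positive_weights_le order_antisym)

lemma positive_weights_empty:
  assumes "finite \<sigma>" "card \<sigma> > N" shows "positive_weights \<sigma> N = {}"
proof -
  have "card \<sigma> \<le> N" if m: "m \<in> positive_weights \<sigma> N" for m
  proof -
    have "card \<sigma> = (\<Sum>x\<in>\<sigma>. 1)" by simp
    also have "\<dots> \<le> sum m \<sigma>" by (rule sum_mono) (use m in \<open>auto simp: positive_weights_def Suc_le_eq\<close>)
    finally show ?thesis using m by (simp add: positive_weights_def)
  qed
  then show ?thesis using assms by fastforce
qed

lemma positive_weights_nonempty:
  assumes "finite \<sigma>" shows "card (positive_weights \<sigma> (card \<sigma>)) > 0"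
proof -
  have "(\<lambda>x. of_bool (x \<in> \<sigma>)) \<in> positive_weights \<sigma> (card \<sigma>)" by (auto simp: positive_weights_def)
  then show ?thesis using finite_positive_weights [OF assms] by (auto simp: card_gt_0_iff)
qed

text \<open>A weight determines its support, so the union is disjoint and the faces can be grouped
  by size.\<close>

lemma card_weights_by_fvec:
  assumes \<Delta>: "finite \<Delta>" "\<And>\<sigma>. \<sigma> \<in> \<Delta> \<Longrightarrow> finite \<sigma>"
    and g: "\<And>\<sigma>. \<sigma> \<in> \<Delta> \<Longrightarrow> card (positive_weights \<sigma> N) = g (card \<sigma>)" "\<And>i. i > N \<Longrightarrow> g i = 0"
  shows "card (\<Union>\<sigma>\<in>\<Delta>. positive_weights \<sigma> N) = (\<Sum>i\<le>N. fvec \<Delta> i * g i)"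
proof -
  have "card (\<Union>\<sigma>\<in>\<Delta>. positive_weights \<sigma> N) = (\<Sum>\<sigma>\<in>\<Delta>. g (card \<sigma>))"
    using \<Delta> finite_positive_weights g(1) by (subst card_UN_disjoint) (auto simp: positive_weights_def)
  also have "\<dots> = (\<Sum>\<sigma> | \<sigma> \<in> \<Delta> \<and> card \<sigma> \<in> {..N}. g (card \<sigma>))"
    using \<Delta>(1) by (intro sum.mono_neutral_right) (auto, metis g(2) less_irrefl not_le)
  also have "\<dots> = (\<Sum>i\<le>N. \<Sum>\<sigma> | \<sigma> \<in> \<Delta> \<and> card \<sigma> \<in> {..N} \<and> card \<sigma> = i. g (card \<sigma>))"
    using \<Delta>(1) by (subst sum.group [symmetric, of _ "{..N}" card]) auto
  also have "\<dots> = (\<Sum>i\<le>N. fvec \<Delta> i * g i)"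
  proof (intro sum.cong refl)
    fix i assume i: "i \<in> {..N}"
    have "{\<sigma> \<in> \<Delta>. card \<sigma> \<in> {..N} \<and> card \<sigma> = i} = {\<sigma> \<in> \<Delta>. card \<sigma> = i}" using i by auto
    then show "(\<Sum>\<sigma> | \<sigma> \<in> \<Delta> \<and> card \<sigma> \<in> {..N} \<and> card \<sigma> = i. g (card \<sigma>)) = fvec \<Delta> i * g i"
      by (simp add: fvec_def)
  qed
  finally show ?thesis .
qed

text \<open>The weight counts form a triangular linear system in the f-vector with positive diagonal
  entries \<open>g N\<close>, so they determine it entry by entry.\<close>

lemma fvec_eqI:
  fixes \<Delta> :: "'v set set" and \<Delta>' :: "'w set set"
  assumes \<Delta>: "finite \<Delta>" "\<And>\<sigma>. \<sigma> \<in> \<Delta> \<Longrightarrow> finite \<sigma>" and \<Delta>': "finite \<Delta>'" "\<And>\<sigma>. \<sigma> \<in> \<Delta>' \<Longrightarrow> finite \<sigma>"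
    and eq: "\<And>N. card (\<Union>\<sigma>\<in>\<Delta>. positive_weights \<sigma> N) = card (\<Union>\<sigma>\<in>\<Delta>'. positive_weights \<sigma> N)"
  shows "fvec \<Delta> = fvec \<Delta>'"
proof
  fix N show "fvec \<Delta> N = fvec \<Delta>' N"
  proof (induction N rule: less_induct)
    case (less N)
    define g where "g i = card (positive_weights {..<i} N)" for i :: nat
    have g1: "card (positive_weights \<sigma> N) = g (card \<sigma>)" if "\<sigma> \<in> \<Delta>" for \<sigma>
      unfolding g_def by (rule card_positive_weights_cong) (use that \<Delta> in auto)
    have g2: "card (positive_weights \<sigma> N) = g (card \<sigma>)" if "\<sigma> \<in> \<Delta>'" for \<sigma>
      unfolding g_def by (rule card_positive_weights_cong) (use that \<Delta>' in auto)
    have g0: "g i = 0" if "i > N" for i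
      unfolding g_def using positive_weights_empty [of "{..<i}" N] that by simp
    have gN: "g N > 0" unfolding g_def using positive_weights_nonempty [of "{..<N}"] by simp
    have "(\<Sum>i\<le>N. fvec \<Delta> i * g i) = (\<Sum>i\<le>N. fvec \<Delta>' i * g i)"
      using eq [of N] card_weights_by_fvec [OF \<Delta> g1 g0] card_weights_by_fvec [OF \<Delta>' g2 g0] by simp
    moreover have "(\<Sum>i<N. fvec \<Delta> i * g i) = (\<Sum>i<N. fvec \<Delta>' i * g i)"
      using less by (intro sum.cong) auto
    ultimately show ?case
      using gN by (simp add: lessThan_Suc_atMost [symmetric])
  qed
qed

text \<open>Makes the maximal face size in \<open>hvec\<close> a function of the f-vector
  alone.\<close>

lemma card_image_eq_fvec: "finite \<Delta> \<Longrightarrow> card ` \<Delta> = {i. fvec \<Delta> i \<noteq> 0}"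
  by (auto simp: fvec_def card_eq_0_iff)

lemma hvec_eqI:
  assumes "finite \<Delta>" "finite \<Delta>'" "fvec \<Delta> = fvec \<Delta>'"
  shows "hvec \<Delta> = hvec \<Delta>'"
  using assms by (simp add: hvec_def fun_eq_iff card_image_eq_fvec)

lemma (in exchange_config) face_weights_eq_Union:
  "{m \<in> nat_weights N. {x. m x \<noteq> 0} \<in> \<Delta>} = (\<Union>\<sigma>\<in>\<Delta>. positive_weights \<sigma> N)"
proof (intro equalityI subsetI)
  fix m assume "m \<in> {m \<in> nat_weights N. {x. m x \<noteq> 0} \<in> \<Delta>}"
  then have m: "\<And>x. x \<notin> V \<Longrightarrow> m x = 0" "sum m V = N" "{x. m x \<noteq> 0} \<in> \<Delta>" by (auto simp: nat_weights_def)
  have "sum m {x. m x \<noteq> 0} = sum m V"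
    by (rule sum.mono_neutral_left) (use face_subset [OF m(3)] finite_V in auto)
  then show "m \<in> (\<Union>\<sigma>\<in>\<Delta>. positive_weights \<sigma> N)" using m by (auto simp: positive_weights_def)
next
  fix m assume "m \<in> (\<Union>\<sigma>\<in>\<Delta>. positive_weights \<sigma> N)"
  then have m: "{x. m x \<noteq> 0} \<in> \<Delta>" "sum m {x. m x \<noteq> 0} = N" by (auto simp: positive_weights_def)
  have "{x. m x \<noteq> 0} \<subseteq> V" by (rule face_subset [OF m(1)])
  moreover from this have "sum m {x. m x \<noteq> 0} = sum m V"
    by (intro sum.mono_neutral_left) (use finite_V in auto)
  ultimately show "m \<in> {m \<in> nat_weights N. {x. m x \<noteq> 0} \<in> \<Delta>}" using m by (auto simp: nat_weights_def)
qed

lemma exchange_config_fvec_eq: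
  assumes "exchange_config V f R w" "exchange_config V f R' w'"
  shows "fvec (clique_complex V R) = fvec (clique_complex V R')"
proof -
  interpret A: exchange_config V f R w by fact
  interpret B: exchange_config V f R' w' by fact
  show ?thesis
  proof (rule fvec_eqI)
    show "card (\<Union>\<sigma>\<in>clique_complex V R. positive_weights \<sigma> N) = card (\<Union>\<sigma>\<in>clique_complex V R'. positive_weights \<sigma> N)" for N
      unfolding A.face_weights_eq_Union [symmetric] B.face_weights_eq_Union [symmetric]
        A.card_face_weights B.card_face_weights ..
  qed (auto intro: A.finite_complex B.finite_complex A.finite_face B.finite_face)
qed

section \<open>Entries of vectors and uniqueness\<close>

lemma ent_in: "I \<in> Vkn k n \<Longrightarrow> 1 \<le> a \<Longrightarrow> a \<le> k \<Longrightarrow> ent I a \<in> I"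
proof -
  assume I: "I \<in> Vkn k n" and a: "1 \<le> a" "a \<le> k"
  then have "finite I" "card I = k" by (auto simp: Vkn_def intro: finite_subset)
  then have "a - 1 < length (sorted_list_of_set I)" using a by simp
  then have "ent I a \<in> set (sorted_list_of_set I)" unfolding ent_def by (rule nth_mem)
  then show ?thesis using \<open>finite I\<close> by simp
qed

lemma ent_range: "I \<in> Vkn k n \<Longrightarrow> 1 \<le> a \<Longrightarrow> a \<le> k \<Longrightarrow> 1 \<le> ent I a \<and> ent I a \<le> n"
  using ent_in [of I k n a] by (auto simp: Vkn_def)

lemma ent_less:
  assumes I: "I \<in> Vkn k n" and ab: "1 \<le> a" "a < b" "b \<le> k"
  shows "ent I a < ent I b"
proof -
  have "finite I" "card I = k" using I by (auto simp: Vkn_def intro: finite_subset)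
  then show ?thesis
    unfolding ent_def using ab by (intro sorted_wrt_nth_less [OF strict_sorted_list_of_set]) auto
qed

lemma ent_add_le:
  assumes I: "I \<in> Vkn k n" and a: "1 \<le> a" "a + d \<le> k"
  shows "ent I a + d \<le> ent I (a + d)"
  using a(2)
proof (induction d)
  case (Suc d)
  then show ?case using ent_less [OF I, of "a + d" "a + Suc d"] a(1) by simp
qed simp

lemma ent_bounds:
  assumes I: "I \<in> Vkn k n" and a: "1 \<le> a" "a \<le> k"
  shows "a \<le> ent I a" "ent I a + k \<le> n + a"
  using ent_add_le [OF I, of 1 "a - 1"] ent_add_le [OF I, of a "k - a"]
    ent_range [OF I, of 1] ent_range [OF I, of k] a by auto

lemma ent_image: "I \<in> Vkn k n \<Longrightarrow> ent I ` {1..k} = I"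
proof (rule card_subset_eq)
  assume I: "I \<in> Vkn k n"
  then show "finite I" by (auto simp: Vkn_def intro: finite_subset)
  show "ent I ` {1..k} \<subseteq> I" using ent_in [OF I] by auto
  have "inj_on (ent I) {1..k}"
    by (rule linorder_inj_onI) (use ent_less [OF I] in force)+
  then show "card (ent I ` {1..k}) = card I" using I by (simp add: card_image Vkn_def)
qed

lemma Vkn_eqI:
  assumes "I \<in> Vkn k n" "J \<in> Vkn k n" "\<And>a. 1 \<le> a \<Longrightarrow> a \<le> k \<Longrightarrow> ent I a = ent J a"
  shows "I = J"
proof -
  have "ent I ` {1..k} = ent J ` {1..k}" using assms(3) by (intro image_cong) auto
  then show ?thesis using ent_image assms(1,2) by metis
qed

lemma Vkn_of_entries:
  assumes step: "\<And>l. 1 \<le> l \<Longrightarrow> l < k \<Longrightarrow> g l < g (Suc l)"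
    and range: "\<And>l. 1 \<le> l \<Longrightarrow> l \<le> k \<Longrightarrow> 1 \<le> g l \<and> g l \<le> n"
  obtains I where "I \<in> Vkn k n" "\<And>l. 1 \<le> l \<Longrightarrow> l \<le> k \<Longrightarrow> ent I l = g l"
proof -
  have mono: "g a < g b" if "1 \<le> a" "a < b" "b \<le> k" for a b
    using that(2,3)
  proof (induction b)
    case (Suc b)
    then show ?case using step [of b] that(1) by (cases "a = b") auto
  qed simp
  define xs where "xs = map g [1..<Suc k]"
  have "sorted_wrt (<) xs"
    unfolding xs_def sorted_wrt_iff_nth_less by (auto intro!: mono simp del: upt_Suc)
  then have sl: "sorted_list_of_set (set xs) = xs"
    by (intro sorted_list_of_set.idem_if_sorted_distinct) (auto simp: strict_sorted_iff)
  have xs: "set xs = g ` {1..k}" by (auto simp: xs_def)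
  have "length (sorted_list_of_set (set xs)) = k" unfolding sl by (simp add: xs_def)
  then have "card (set xs) = k" by simp
  then have "g ` {1..k} \<in> Vkn k n" using range unfolding Vkn_def xs [symmetric] by (auto simp: xs)
  moreover have "ent (g ` {1..k}) l = g l" if "1 \<le> l" "l \<le> k" for l
    unfolding ent_def xs [symmetric] sl using that by (simp add: xs_def del: upt_Suc)
  ultimately show thesis by (rule that)
qed

lemma finite_Vkn: "finite (Vkn k n)"
  by (rule finite_subset [of _ "Pow {1..n}"]) (auto simp: Vkn_def)

lemma chi_nonneg_le_1: "0 \<le> chi k n I p" "chi k n I p \<le> 1"
  by (auto simp: chi_def split: prod.split)

text \<open>The coordinates \<open>(a, b)\<close> depend on entry \<open>a\<close> alone, so any
  position-wise swap preserves the sum.\<close>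

lemma chi_exchange:
  assumes "\<And>a. 1 \<le> a \<Longrightarrow> a \<le> k \<Longrightarrow> (ent I' a = ent I a \<and> ent J' a = ent J a) \<or> (ent I' a = ent J a \<and> ent J' a = ent I a)"
  shows "chi k n I' p + chi k n J' p = chi k n I p + chi k n J p"
proof (cases p)
  case (Pair a b)
  show ?thesis using assms [of a] unfolding Pair by (auto simp: chi_def Pkn_def)
qed

section \<open>Weighted matchings and their marginals\<close>

lemma ex_less_of_sum_eq:
  fixes f g :: "'a \<Rightarrow> real"
  assumes "finite A" "sum f A = sum g A" "x \<in> A" "g x < f x"
  shows "\<exists>y\<in>A. f y < g y"
proof (rule ccontr)
  assume "\<not> ?thesis"
  then have "sum g A < sum f A"
    using assms by (intro sum_strict_mono_ex1) (auto simp: not_less)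
  then show False using assms(2) by simp
qed

text \<open>\<open>m\<close> is a weighted matching, \<open>m p q\<close> being the weight of the arc from \<open>p\<close> to \<open>q\<close>.\<close>
definition matching :: "nat \<Rightarrow> (nat \<Rightarrow> nat \<Rightarrow> nat \<Rightarrow> nat \<Rightarrow> bool) \<Rightarrow> (nat \<Rightarrow> nat \<Rightarrow> real) \<Rightarrow> bool" where
  "matching n X m \<longleftrightarrow> (\<forall>p q. 0 \<le> m p q) \<and> (\<forall>p q. m p q \<noteq> 0 \<longrightarrow> p < q \<and> q \<le> n) \<and>
    (\<forall>p q p' q'. m p q \<noteq> 0 \<longrightarrow> m p' q' \<noteq> 0 \<longrightarrow> \<not> X p q p' q')"

definition matching_unique :: "nat \<Rightarrow> (nat \<Rightarrow> nat \<Rightarrow> nat \<Rightarrow> nat \<Rightarrow> bool) \<Rightarrow> bool" where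
  "matching_unique n X \<longleftrightarrow> (\<forall>m m'. matching n X m \<longrightarrow> matching n X m' \<longrightarrow>
    (\<forall>p. (\<Sum>q\<le>n. m p q) = (\<Sum>q\<le>n. m' p q)) \<longrightarrow> (\<forall>q. (\<Sum>p\<le>n. m p q) = (\<Sum>p\<le>n. m' p q)) \<longrightarrow> m = m')"

text \<open>In the largest row \<open>p\<close> where two matchings differ, let \<open>q\<close> be the column, first in the order \<open>r\<close>, where they
  differ. The matching with the smaller entry there has the larger entry in some later column of row \<open>p\<close> and in
  some earlier row of column \<open>q\<close>; these two arcs form an \<open>X\<close>-pair.\<close>
lemma matching_uniqueI:
  fixes r :: "nat \<Rightarrow> nat \<Rightarrow> bool"
  assumes ext: "\<And>A. finite A \<Longrightarrow> A \<noteq> {} \<Longrightarrow> \<exists>q\<in>A. \<forall>y\<in>A. y = q \<or> r q y"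
    and X: "\<And>x p q q'. x < p \<Longrightarrow> p < q \<Longrightarrow> p < q' \<Longrightarrow> r q q' \<Longrightarrow> X x q p q'"
  shows "matching_unique n X"
proof -
  have False
    if m: "matching n X m" and m': "matching n X m'"
      and row: "\<And>p. (\<Sum>q\<le>n. m p q) = (\<Sum>q\<le>n. m' p q)" and col: "\<And>q. (\<Sum>p\<le>n. m p q) = (\<Sum>p\<le>n. m' p q)"
      and pq: "m' p q < m p q" and p: "\<And>x y. m x y \<noteq> m' x y \<Longrightarrow> x \<le> p"
      and q: "\<And>y. m p y \<noteq> m' p y \<Longrightarrow> y = q \<or> r q y" for m m' p q
  proof -
    have nn: "0 \<le> m x y" "0 \<le> m' x y" for x y using m m' by (auto simp: matching_def)
    have "m p q \<noteq> 0" using pq nn [of p q] by linarith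
    then have pqn: "p < q" "q \<le> n" using m by (auto simp: matching_def)
    obtain q' where q': "m p q' < m' p q'"
      using ex_less_of_sum_eq [of "{..n}" "m p" "m' p" q] row pq pqn by auto
    obtain x where x: "m x q < m' x q"
      using ex_less_of_sum_eq [of "{..n}" "\<lambda>x. m x q" "\<lambda>x. m' x q" p] col pq pqn by auto
    have n0: "m' p q' \<noteq> 0" "m' x q \<noteq> 0" using q' x nn [of p q'] nn [of x q] by linarith+
    have "p < q'" using n0 m' by (auto simp: matching_def)
    moreover have "r q q'" using q [of q'] q' pq by auto
    moreover have "x < p" using p [of x q] x pq by (cases "x = p") auto
    ultimately have "X x q p q'" using X pqn by blast
    then show False using m' n0 by (auto simp: matching_def)
  qed
  note * = this
  show ?thesis unfolding matching_unique_def
  proof (intro allI impI, rule ccontr)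
    fix m m' assume m: "matching n X m" "matching n X m'"
      and row: "\<forall>p. (\<Sum>q\<le>n. m p q) = (\<Sum>q\<le>n. m' p q)" and col: "\<forall>q. (\<Sum>p\<le>n. m p q) = (\<Sum>p\<le>n. m' p q)"
      and "m \<noteq> m'"
    define S where "S = {(p, q). m p q \<noteq> m' p q}"
    have Sn: "S \<subseteq> {..n} \<times> {..n}"
    proof clarify
      fix p q assume "(p, q) \<in> S"
      then have "m p q \<noteq> 0 \<or> m' p q \<noteq> 0" by (auto simp: S_def)
      then have "p < q \<and> q \<le> n" using m unfolding matching_def by blast
      then show "p \<in> {..n} \<and> q \<in> {..n}" by simp
    qed
    then have fS: "finite S" by (rule finite_subset) auto
    have "S \<noteq> {}" using \<open>m \<noteq> m'\<close> by (auto simp: S_def fun_eq_iff)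
    define p where "p = Max (fst ` S)"
    have p: "x \<le> p" if "m x y \<noteq> m' x y" for x y
      unfolding p_def using that fS by (intro Max_ge) (force simp: S_def)+
    have "p \<in> fst ` S" unfolding p_def using fS \<open>S \<noteq> {}\<close> by (intro Max_in) auto
    then have "{y. m p y \<noteq> m' p y} \<noteq> {}" by (auto simp: S_def)
    moreover have "finite {y. m p y \<noteq> m' p y}"
      by (rule finite_subset [of _ "{..n}"]) (use Sn in \<open>auto simp: S_def\<close>)
    ultimately obtain q where q: "m p q \<noteq> m' p q" "\<And>y. m p y \<noteq> m' p y \<Longrightarrow> y = q \<or> r q y"
      using ext [of "{y. m p y \<noteq> m' p y}"] by auto
    from q(1) consider "m' p q < m p q" | "m p q < m' p q" by linarith
    then show False
    proof cases
      case 1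
      then show False using * [of m m' p q] m row col p q by blast
    next
      case 2
      then show False using * [of m' m p q] m row col p q by (metis (full_types))
    qed
  qed
qed

text \<open>Arcs \<open>(x, q)\<close> and \<open>(p, q')\<close> with \<open>x < p\<close>,
  \<open>p < q\<close> and \<open>p < q'\<close> cross if \<open>q < q'\<close> and nest if
  \<open>q' < q\<close>. So columns are scanned upwards here and downwards for nestings.\<close>

lemma matching_unique_crosses: "matching_unique n crosses"
proof (rule matching_uniqueI [where r = "(<)"])
  show "\<exists>q\<in>A. \<forall>y\<in>A. y = q \<or> q < y" if "finite A" "A \<noteq> {}" for A :: "nat set"
    using that by (intro bexI [of _ "Min A"]) (auto simp: order.order_iff_strict dest: Min_le)
qed (auto simp: crosses_def)

lemma matching_unique_nests: "matching_unique n nests"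
proof (rule matching_uniqueI [where r = "(>)"])
  show "\<exists>q\<in>A. \<forall>y\<in>A. y = q \<or> q > y" if "finite A" "A \<noteq> {}" for A :: "nat set"
    using that by (intro bexI [of _ "Max A"]) (auto simp: order.order_iff_strict dest: Max_ge)
qed (auto simp: nests_def)

lemma sum_of_bool_eq_1: "j \<le> (n::nat) \<Longrightarrow> (\<Sum>q\<le>n. of_bool (P \<and> j = q \<and> Q) :: real) = of_bool (P \<and> Q)"
proof -
  assume "j \<le> n"
  have "(\<Sum>q\<le>n. of_bool (P \<and> j = q \<and> Q) :: real) = (\<Sum>q\<le>n. if j = q then of_bool (P \<and> Q) else 0)"
    by (intro sum.cong) auto
  then show ?thesis using \<open>j \<le> n\<close> by simp
qed

text \<open>Induction on the width of the window \<open>{a..b}\<close>: the two windows of width one less determine the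
  marginals of the matching between columns \<open>a\<close> and \<open>b\<close> with given middle entries.\<close>
lemma weights_unique_of_matching_unique:
  fixes u v :: "nat set \<Rightarrow> real"
  assumes X: "matching_unique n X"
    and nn: "\<And>I. I \<in> Vkn k n \<Longrightarrow> 0 \<le> u I" "\<And>I. I \<in> Vkn k n \<Longrightarrow> 0 \<le> v I"
    and Xu: "\<And>I J a b. \<lbrakk>I \<in> Vkn k n; J \<in> Vkn k n; u I \<noteq> 0; u J \<noteq> 0; 1 \<le> a; a < b; b \<le> k;
      \<And>l. a < l \<Longrightarrow> l < b \<Longrightarrow> ent I l = ent J l\<rbrakk> \<Longrightarrow> \<not> X (ent I a) (ent I b) (ent J a) (ent J b)"
    and Xv: "\<And>I J a b. \<lbrakk>I \<in> Vkn k n; J \<in> Vkn k n; v I \<noteq> 0; v J \<noteq> 0; 1 \<le> a; a < b; b \<le> k;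
      \<And>l. a < l \<Longrightarrow> l < b \<Longrightarrow> ent I l = ent J l\<rbrakk> \<Longrightarrow> \<not> X (ent I a) (ent I b) (ent J a) (ent J b)"
    and col: "\<And>a x. 1 \<le> a \<Longrightarrow> a \<le> k \<Longrightarrow>
      (\<Sum>I\<in>Vkn k n. u I * of_bool (ent I a = x)) = (\<Sum>I\<in>Vkn k n. v I * of_bool (ent I a = x))"
    and k: "1 \<le> k" and I: "I \<in> Vkn k n"
  shows "u I = v I"
proof -
  define M where "M u a b g = (\<Sum>I\<in>Vkn k n. u I * of_bool (\<forall>l\<in>{a..b}. ent I l = g l))"
    for u :: "nat set \<Rightarrow> real" and a b and g :: "nat \<Rightarrow> nat"
  have "M u a b g = M v a b g" if "1 \<le> a" "a \<le> b" "b \<le> k" for a b g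
    using that
  proof (induction "b - a" arbitrary: a b g)
    case 0
    then have "a = b" by simp
    then show ?case using col [of a "g a"] 0 by (simp add: M_def)
  next
    case (Suc d)
    then have ab: "1 \<le> a" "a < b" "b \<le> k" by auto
    define mid where "mid I \<longleftrightarrow> (\<forall>l. a < l \<and> l < b \<longrightarrow> ent I l = g l)" for I
    define N where "N u p q = (\<Sum>I\<in>Vkn k n. u I * of_bool (ent I a = p \<and> ent I b = q \<and> mid I))"
      for u :: "nat set \<Rightarrow> real" and p q
    have nz: "\<exists>I\<in>Vkn k n. u I \<noteq> 0 \<and> ent I a = p \<and> ent I b = q \<and> mid I" if "N u p q \<noteq> 0" for u p q
    proof (rule ccontr)
      assume "\<not> ?thesis"
      then have "N u p q = 0" unfolding N_def by (intro sum.neutral) auto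
      then show False using that by simp
    qed
    have match: "matching n X (N u)"
      if nn: "\<And>I. I \<in> Vkn k n \<Longrightarrow> 0 \<le> u I"
        and Xu: "\<And>I J a b. \<lbrakk>I \<in> Vkn k n; J \<in> Vkn k n; u I \<noteq> 0; u J \<noteq> 0; 1 \<le> a; a < b; b \<le> k;
          \<And>l. a < l \<Longrightarrow> l < b \<Longrightarrow> ent I l = ent J l\<rbrakk> \<Longrightarrow> \<not> X (ent I a) (ent I b) (ent J a) (ent J b)" for u
      unfolding matching_def
    proof (intro conjI allI impI)
      show "0 \<le> N u p q" for p q unfolding N_def using nn by (intro sum_nonneg) auto
      show "p < q" "q \<le> n" if "N u p q \<noteq> 0" for p q
        using nz [OF that] ent_less [OF _ ab] ent_range [of _ k n b] ab by auto
      show "\<not> X p q p' q'" if N: "N u p q \<noteq> 0" "N u p' q' \<noteq> 0" for p q p' q'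
      proof -
        obtain I J where "I \<in> Vkn k n" "u I \<noteq> 0" "ent I a = p" "ent I b = q" "mid I"
          "J \<in> Vkn k n" "u J \<noteq> 0" "ent J a = p'" "ent J b = q'" "mid J"
          using nz [OF N(1)] nz [OF N(2)] by blast
        then show ?thesis using Xu [of I J a b] ab by (simp add: mid_def)
      qed
    qed
    \<comment> \<open>Forgetting the endpoint in column \<open>b\<close> leaves the window without
      that column; the range \<open>q \<le> n\<close> loses no vector because entries are at most
      \<open>n\<close>.\<close>
    have row: "(\<Sum>q\<le>n. N u p q) = M u a (b - 1) (g(a := p))" for u p
    proof -
      have "(\<Sum>q\<le>n. N u p q) = (\<Sum>I\<in>Vkn k n. u I * (\<Sum>q\<le>n. of_bool (ent I a = p \<and> ent I b = q \<and> mid I)))"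
        unfolding N_def by (subst sum.swap) (simp only: sum_distrib_left)
      also have "\<dots> = M u a (b - 1) (g(a := p))"
        unfolding M_def
      proof (intro sum.cong refl)
        fix I assume I: "I \<in> Vkn k n"
        have "(\<forall>l\<in>{a..b - 1}. ent I l = (g(a := p)) l) \<longleftrightarrow> ent I a = p \<and> mid I"
          unfolding mid_def using ab by (auto simp: Ball_def)
        then show "u I * (\<Sum>q\<le>n. of_bool (ent I a = p \<and> ent I b = q \<and> mid I)) = u I * of_bool (\<forall>l\<in>{a..b - 1}. ent I l = (g(a := p)) l)"
          using ent_range [OF I, of b] ab by (subst sum_of_bool_eq_1) auto
      qed
      finally show ?thesis .
    qed
    have column: "(\<Sum>p\<le>n. N u p q) = M u (a + 1) b (g(b := q))" for u q
    proof -
      have "(\<Sum>p\<le>n. N u p q) = (\<Sum>I\<in>Vkn k n. u I * (\<Sum>p\<le>n. of_bool (True \<and> ent I a = p \<and> ent I b = q \<and> mid I)))"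
        unfolding N_def by (subst sum.swap) (simp only: sum_distrib_left simp_thms)
      also have "\<dots> = M u (a + 1) b (g(b := q))"
        unfolding M_def
      proof (intro sum.cong refl)
        fix I assume I: "I \<in> Vkn k n"
        have "(\<forall>l\<in>{a + 1..b}. ent I l = (g(b := q)) l) \<longleftrightarrow> ent I b = q \<and> mid I"
          unfolding mid_def using ab by (auto simp: Ball_def)
        then show "u I * (\<Sum>p\<le>n. of_bool (True \<and> ent I a = p \<and> ent I b = q \<and> mid I)) = u I * of_bool (\<forall>l\<in>{a + 1..b}. ent I l = (g(b := q)) l)"
          using ent_range [OF I, of a] ab by (subst sum_of_bool_eq_1) auto
      qed
      finally show ?thesis .
    qed
    have "N u = N v"
    proof (rule X [unfolded matching_unique_def, rule_format])
      show "matching n X (N u)" using match nn(1) Xu by blast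
      show "matching n X (N v)" using match nn(2) Xv by blast
      show "(\<Sum>q\<le>n. N u p q) = (\<Sum>q\<le>n. N v p q)" for p
        unfolding row by (rule Suc(1)) (use Suc(2) ab in auto)
      show "(\<Sum>p\<le>n. N u p q) = (\<Sum>p\<le>n. N v p q)" for q
        unfolding column by (rule Suc(1)) (use Suc(2) ab in auto)
    qed
    moreover have "M u a b g = N u (g a) (g b)" for u
    proof -
      have "(\<forall>l\<in>{a..b}. ent I l = g l) \<longleftrightarrow> ent I a = g a \<and> ent I b = g b \<and> mid I" for I
        unfolding mid_def using ab by (auto simp: Ball_def) (metis le_eq_less_or_eq)
      then show ?thesis by (simp add: M_def N_def)
    qed
    ultimately show ?case by simp
  qed
  then have "M u 1 k (ent I) = M v 1 k (ent I)" using k by simp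
  moreover have "M u 1 k (ent I) = u I" for u
  proof -
    have "M u 1 k (ent I) = (\<Sum>J\<in>Vkn k n. if J = I then u J else 0)"
      unfolding M_def
    proof (intro sum.cong refl)
      fix J assume J: "J \<in> Vkn k n"
      have "(\<forall>l\<in>{1..k}. ent J l = ent I l) \<longleftrightarrow> J = I" using Vkn_eqI [OF J I] by auto
      then show "u J * of_bool (\<forall>l\<in>{1..k}. ent J l = ent I l) = (if J = I then u J else 0)" by simp
    qed
    also have "\<dots> = u I" using I finite_Vkn by simp
    finally show ?thesis .
  qed
  ultimately show ?thesis by simp
qed

text \<open>The coordinates \<open>(a, b)\<close> record the cumulative distribution of entry
  \<open>a\<close>, whose successive differences are the point masses.\<close>

lemma column_marginals_of_chi:
  fixes u v :: "nat set \<Rightarrow> real"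
  assumes total: "sum u (Vkn k n) = sum v (Vkn k n)"
    and chi: "\<And>p. (\<Sum>I\<in>Vkn k n. u I * chi k n I p) = (\<Sum>I\<in>Vkn k n. v I * chi k n I p)"
    and a: "1 \<le> a" "a \<le> k"
  shows "(\<Sum>I\<in>Vkn k n. u I * of_bool (ent I a = x)) = (\<Sum>I\<in>Vkn k n. v I * of_bool (ent I a = x))"
proof -
  have le: "(\<Sum>I\<in>Vkn k n. u I * of_bool (ent I a \<le> y)) = (\<Sum>I\<in>Vkn k n. v I * of_bool (ent I a \<le> y))" for y
  proof -
    \<comment> \<open>Entry \<open>a\<close> lies between \<open>a\<close> and
      \<open>n - k + a\<close>. Only thresholds from \<open>a\<close> up to just below the upper end
      are coordinates; below them the cumulative weight is 0, above them it is the total.\<close>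
    consider "y < a" | "a \<le> y" "y + k < n + a" | "n + a \<le> y + k" by linarith
    then show ?thesis
    proof cases
      case 1
      have "ent I a \<le> y \<longleftrightarrow> False" if "I \<in> Vkn k n" for I using ent_bounds [OF that a] 1 by auto
      then show ?thesis by simp
    next
      case 2
      have "chi k n I (a, y - a + 1) = of_bool (ent I a \<le> y)" for I
        using 2 a by (auto simp: chi_def Pkn_def)
      then show ?thesis using chi [of "(a, y - a + 1)"] by simp
    next
      case 3
      have "ent I a \<le> y \<longleftrightarrow> True" if "I \<in> Vkn k n" for I using ent_bounds [OF that a] 3 by auto
      then show ?thesis using total by simp
    qed
  qed
  show ?thesis
  proof (cases x)
    case 0
    have "ent I a = x \<longleftrightarrow> False" if "I \<in> Vkn k n" for I using ent_bounds [OF that a] a 0 by auto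
    then show ?thesis by simp
  next
    case (Suc y)
    have "(of_bool (ent I a = x) :: real) = of_bool (ent I a \<le> x) - of_bool (ent I a \<le> y)" for I
      using Suc by auto
    then show ?thesis by (simp add: right_diff_distrib sum_subtractf le)
  qed
qed

section \<open>Exchange for noncrossing and nonnesting vectors\<close>

lemma noncrossing_refl: "noncrossing k I I"
  by (auto simp: noncrossing_def crosses_def)

lemma noncrossing_sym: "noncrossing k I J \<Longrightarrow> noncrossing k J I"
  unfolding noncrossing_def crosses_def by metis

lemma nonnesting_refl: "nonnesting k I I"
  by (auto simp: nonnesting_def nests_def)

lemma nonnesting_sym: "nonnesting k I J \<Longrightarrow> nonnesting k J I"
  unfolding nonnesting_def nests_def by blast

section \<open>Crossing pairs: swapping tails\<close>

definition index_pairs :: "nat \<Rightarrow> (nat \<times> nat) set" where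
  "index_pairs k = {(c, d). 1 \<le> c \<and> c < d \<and> d \<le> k}"

lemma finite_index_pairs: "finite (index_pairs k)" and card_index_pairs: "card (index_pairs k) \<le> k * k"
proof -
  have *: "index_pairs k \<subseteq> {1..k} \<times> {1..k}" by (auto simp: index_pairs_def)
  show "finite (index_pairs k)" by (rule finite_subset [OF *]) auto
  show "card (index_pairs k) \<le> k * k" using card_mono [OF _ *] by simp
qed

text \<open>Swapping tails at a crossing of \<open>(a, b)\<close> with equal middle entries only affects pairs \<open>c \<le> a < b \<le> d\<close>. By
  the powers of \<open>\<epsilon>\<close> the pair \<open>(a, b)\<close> dominates, and there the product decreases as the crossing becomes a nesting.\<close>
definition nc_cost :: "nat \<Rightarrow> real \<Rightarrow> nat set \<Rightarrow> real" where
  "nc_cost k \<epsilon> I = (\<Sum>(c, d)\<in>index_pairs k. \<epsilon> ^ (d - c) * (real (ent I c) * real (ent I d)))"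

lemma noncrossing_exchange:
  assumes I: "I \<in> Vkn k n" and J: "J \<in> Vkn k n" and cross: "\<not> noncrossing k I J"
    and \<epsilon>: "0 < \<epsilon>" "\<epsilon> \<le> 1" "\<epsilon> * (real k * real k * (real n * real n)) < 1"
  shows "\<exists>I'\<in>Vkn k n. \<exists>J'\<in>Vkn k n. (\<forall>p. chi k n I' p + chi k n J' p = chi k n I p + chi k n J p) \<and>
    nc_cost k \<epsilon> I' + nc_cost k \<epsilon> J' < nc_cost k \<epsilon> I + nc_cost k \<epsilon> J"
proof -
  obtain a b where ab: "1 \<le> a" "a < b" "b \<le> k" and mid: "\<And>l. a < l \<Longrightarrow> l < b \<Longrightarrow> ent I l = ent J l"
    and cr: "crosses (ent I a) (ent I b) (ent J a) (ent J b)"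
    using cross unfolding noncrossing_def by blast
  have swap: "\<exists>I'\<in>Vkn k n. \<forall>l. 1 \<le> l \<longrightarrow> l \<le> k \<longrightarrow> ent I' l = (if l < b then ent I l else ent J l)"
    if I: "I \<in> Vkn k n" and J: "J \<in> Vkn k n" and mid: "\<And>l. a < l \<Longrightarrow> l < b \<Longrightarrow> ent I l = ent J l"
      and cr: "crosses (ent I a) (ent I b) (ent J a) (ent J b)" for I J
  proof -
    define g where "g l = (if l < b then ent I l else ent J l)" for l
    obtain I' where I': "I' \<in> Vkn k n" "\<And>l. 1 \<le> l \<Longrightarrow> l \<le> k \<Longrightarrow> ent I' l = g l"
    proof (rule Vkn_of_entries [of k g n])
      show "g l < g (Suc l)" if l: "1 \<le> l" "l < k" for l
      proof -
        \<comment> \<open>Only the seam between \<open>b - 1\<close> and \<open>b\<close> needs an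
          argument: if \<open>a = b - 1\<close> the crossing gives the inequality, otherwise both
          vectors agree at \<open>b - 1\<close>.\<close>
        consider "Suc l < b" | "b \<le> l" | "Suc l = b" "l = a" | "Suc l = b" "a < l" using ab by linarith
        then show ?thesis
        proof cases
          case 3
          then show ?thesis using cr by (auto simp: g_def crosses_def)
        next
          case 4
          then show ?thesis using ent_less [OF J, of l "Suc l"] mid [of l] l by (simp add: g_def)
        qed (use ent_less [OF I, of l "Suc l"] ent_less [OF J, of l "Suc l"] l in \<open>auto simp: g_def\<close>)
      qed
      show "1 \<le> g l \<and> g l \<le> n" if "1 \<le> l" "l \<le> k" for l
        using ent_range [OF I that] ent_range [OF J that] by (simp add: g_def)
    qed blast
    then show ?thesis unfolding g_def by blast
  qed
  obtain I' where I': "I' \<in> Vkn k n" "\<And>l. 1 \<le> l \<Longrightarrow> l \<le> k \<Longrightarrow> ent I' l = (if l < b then ent I l else ent J l)"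
    using swap [OF I J mid cr] by blast
  have cr': "crosses (ent J a) (ent J b) (ent I a) (ent I b)" using cr by (auto simp: crosses_def)
  obtain J' where J': "J' \<in> Vkn k n" "\<And>l. 1 \<le> l \<Longrightarrow> l \<le> k \<Longrightarrow> ent J' l = (if l < b then ent J l else ent I l)"
    using swap [OF J I mid [symmetric] cr'] by blast
  define x where "x l = real (ent I l) - real (ent J l)" for l
  have x0: "x l = 0" if "a < l" "l < b" for l using mid [OF that] by (simp add: x_def)
  have xn: "\<bar>x l\<bar> \<le> real n" if "1 \<le> l" "l \<le> k" for l
    using ent_range [OF I that] ent_range [OF J that] by (auto simp: x_def)
  \<comment> \<open>In a crossing the differences at \<open>a\<close> and \<open>b\<close> have the
    same sign, and nonzero integers have size at least 1.\<close>
  have xab: "1 \<le> x a * x b"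
  proof -
    consider "1 \<le> x a \<and> 1 \<le> x b" | "1 \<le> - x a \<and> 1 \<le> - x b" using cr by (auto simp: crosses_def x_def)
    then show ?thesis
    proof cases
      case 1
      then show ?thesis using mult_mono [of 1 "x a" 1 "x b"] by simp
    next
      case 2
      then show ?thesis using mult_mono [of 1 "- x a" 1 "- x b"] by simp
    qed
  qed
  \<comment> \<open>A product changes only if the seam separates \<open>c\<close> from
    \<open>d\<close>, and then
    \<open>i_c i_d + j_c j_d - i_c j_d - j_c i_d = x_c x_d\<close>.\<close>
  define t where "t c d = \<epsilon> ^ (d - c) * (of_bool (c < b \<and> b \<le> d) * (x c * x d))" for c d
  have "nc_cost k \<epsilon> I + nc_cost k \<epsilon> J - (nc_cost k \<epsilon> I' + nc_cost k \<epsilon> J') = (\<Sum>(c, d)\<in>index_pairs k. t c d)"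
  proof -
    have "\<epsilon> ^ (d - c) * (real (ent I c) * real (ent I d)) + \<epsilon> ^ (d - c) * (real (ent J c) * real (ent J d))
      - (\<epsilon> ^ (d - c) * (real (ent I' c) * real (ent I' d)) + \<epsilon> ^ (d - c) * (real (ent J' c) * real (ent J' d))) = t c d"
      if "(c, d) \<in> index_pairs k" for c d
      using that I'(2) [of c] I'(2) [of d] J'(2) [of c] J'(2) [of d]
      by (auto simp: index_pairs_def t_def x_def algebra_simps)
    then show ?thesis
      unfolding nc_cost_def sum.distrib [symmetric] sum_subtractf [symmetric] by (intro sum.cong) auto
  qed
  also have "\<dots> = t a b + (\<Sum>(c, d)\<in>index_pairs k - {(a, b)}. t c d)"
    using finite_index_pairs ab by (subst sum.remove [of _ "(a, b)"]) (auto simp: index_pairs_def)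
  also have "\<dots> > 0"
  proof -
    \<comment> \<open>Any other pair that contributes strictly contains the window from
      \<open>a\<close> to \<open>b\<close>, so it carries at least one more factor \<epsilon>, while
      its product has size at most \<open>n * n\<close>.\<close>
    define B where "B = \<epsilon> ^ (b - a) * (\<epsilon> * (real n * real n))"
    have B0: "0 \<le> B" using \<epsilon> by (simp add: B_def)
    have tB: "- B \<le> t c d" if cd: "(c, d) \<in> index_pairs k - {(a, b)}" for c d
    proof (cases "c \<le> a \<and> b \<le> d")
      case True
      then have "Suc (b - a) \<le> d - c" using cd ab by auto
      then have e: "\<epsilon> ^ (d - c) \<le> \<epsilon> ^ Suc (b - a)" using \<epsilon> by (intro power_decreasing) auto
      have "\<bar>x c * x d\<bar> \<le> real n * real n"
        unfolding abs_mult using xn [of c] xn [of d] cd by (intro mult_mono) (auto simp: index_pairs_def)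
      then have "\<epsilon> ^ (d - c) * \<bar>x c * x d\<bar> \<le> \<epsilon> ^ Suc (b - a) * (real n * real n)"
        using e \<epsilon> by (intro mult_mono) auto
      moreover have "\<bar>t c d\<bar> \<le> \<epsilon> ^ (d - c) * \<bar>x c * x d\<bar>" using \<epsilon> by (simp add: t_def abs_mult)
      ultimately show ?thesis by (simp add: B_def mult_ac abs_le_iff)
    next
      case False
      \<comment> \<open>A left index strictly between \<open>a\<close> and \<open>b\<close>
        contributes nothing, since the entries there agree.\<close>
      then have "t c d = 0" using x0 [of c] ab by (cases "c < b \<and> b \<le> d") (auto simp: t_def)
      then show ?thesis using B0 by simp
    qed
    have "(\<Sum>(c, d)\<in>index_pairs k - {(a, b)}. t c d) \<ge> (\<Sum>(c, d)\<in>index_pairs k - {(a, b)}. - B)"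
      using tB by (intro sum_mono) auto
    moreover have "real (card (index_pairs k - {(a, b)})) * B \<le> real (k * k) * B"
    proof (rule mult_right_mono [OF _ B0])
      have "card (index_pairs k - {(a, b)}) \<le> k * k"
        using card_index_pairs card_Diff1_le by (rule le_trans [rotated])
      then show "real (card (index_pairs k - {(a, b)})) \<le> real (k * k)" by (rule of_nat_mono)
    qed
    ultimately have "(\<Sum>(c, d)\<in>index_pairs k - {(a, b)}. t c d) \<ge> - (real k * real k * B)" by simp
    moreover have "t a b \<ge> \<epsilon> ^ (b - a)"
      using ab xab \<epsilon> mult_left_mono [of 1 "x a * x b" "\<epsilon> ^ (b - a)"] by (simp add: t_def)
    moreover have "\<epsilon> ^ (b - a) > real k * real k * B"
      using mult_strict_left_mono [OF \<epsilon>(3), of "\<epsilon> ^ (b - a)"] \<epsilon>(1) by (simp add: B_def mult_ac)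
    ultimately show ?thesis by linarith
  qed
  finally have "nc_cost k \<epsilon> I' + nc_cost k \<epsilon> J' < nc_cost k \<epsilon> I + nc_cost k \<epsilon> J" by simp
  moreover have "chi k n I' p + chi k n J' p = chi k n I p + chi k n J p" for p
    by (rule chi_exchange) (use I'(2) J'(2) in auto)
  ultimately show ?thesis using I'(1) J'(1) by blast
qed

section \<open>Nesting pairs: componentwise minimum and maximum\<close>

lemma not_nonnesting_incomparable:
  assumes "I \<in> Vkn k n" "J \<in> Vkn k n" "\<not> nonnesting k I J"
  obtains a b where "1 \<le> a" "a \<le> k" "ent I a < ent J a" "1 \<le> b" "b \<le> k" "ent J b < ent I b"
proof -
  obtain a b where "1 \<le> a" "a < b" "b \<le> k" "nests (ent I a) (ent I b) (ent J a) (ent J b)"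
    using assms(3) unfolding nonnesting_def by blast
  then show thesis
    using that [of a b] that [of b a] unfolding nests_def by auto
qed

text \<open>Minimum and maximum keep the total of the two entry sums but push the sums apart, so a
  strictly concave function of the sum, such as minus its square, decreases.\<close>

definition nn_cost :: "nat \<Rightarrow> nat set \<Rightarrow> real" where
  "nn_cost k I = - (\<Sum>a\<in>{1..k}. real (ent I a))\<^sup>2"

lemma nonnesting_exchange:
  assumes I: "I \<in> Vkn k n" and J: "J \<in> Vkn k n" and nest: "\<not> nonnesting k I J"
  shows "\<exists>I'\<in>Vkn k n. \<exists>J'\<in>Vkn k n. (\<forall>p. chi k n I' p + chi k n J' p = chi k n I p + chi k n J p) \<and>
    nn_cost k I' + nn_cost k J' < nn_cost k I + nn_cost k J"
proof -
  obtain I' where I': "I' \<in> Vkn k n" "\<And>l. 1 \<le> l \<Longrightarrow> l \<le> k \<Longrightarrow> ent I' l = min (ent I l) (ent J l)"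
  proof (rule Vkn_of_entries [of k "\<lambda>l. min (ent I l) (ent J l)" n])
    show "min (ent I l) (ent J l) < min (ent I (Suc l)) (ent J (Suc l))" if "1 \<le> l" "l < k" for l
      using ent_less [OF I, of l "Suc l"] ent_less [OF J, of l "Suc l"] that by auto
    show "1 \<le> min (ent I l) (ent J l) \<and> min (ent I l) (ent J l) \<le> n" if "1 \<le> l" "l \<le> k" for l
      using ent_range [OF I that] ent_range [OF J that] by auto
  qed blast
  obtain J' where J': "J' \<in> Vkn k n" "\<And>l. 1 \<le> l \<Longrightarrow> l \<le> k \<Longrightarrow> ent J' l = max (ent I l) (ent J l)"
  proof (rule Vkn_of_entries [of k "\<lambda>l. max (ent I l) (ent J l)" n])
    show "max (ent I l) (ent J l) < max (ent I (Suc l)) (ent J (Suc l))" if "1 \<le> l" "l < k" for l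
      using ent_less [OF I, of l "Suc l"] ent_less [OF J, of l "Suc l"] that by auto
    show "1 \<le> max (ent I l) (ent J l) \<and> max (ent I l) (ent J l) \<le> n" if "1 \<le> l" "l \<le> k" for l
      using ent_range [OF I that] ent_range [OF J that] by auto
  qed blast
  obtain a b where ab: "1 \<le> a" "a \<le> k" "ent I a < ent J a" "1 \<le> b" "b \<le> k" "ent J b < ent I b"
    by (rule not_nonnesting_incomparable [OF assms]) blast
  define s where "s I = (\<Sum>a\<in>{1..k}. real (ent I a))" for I
  have s: "s I' + s J' = s I + s J"
    unfolding s_def sum.distrib [symmetric] using I'(2) J'(2) by (intro sum.cong) auto
  have "s I' < s I" unfolding s_def
  proof (rule sum_strict_mono_ex1)
    show "\<exists>a\<in>{1..k}. real (ent I' a) < real (ent I a)" by (rule bexI [of _ b]) (use I'(2) ab in auto)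
  qed (use I'(2) in auto)
  moreover have "s I' < s J" unfolding s_def
  proof (rule sum_strict_mono_ex1)
    show "\<exists>a\<in>{1..k}. real (ent I' a) < real (ent J a)" by (rule bexI [of _ a]) (use I'(2) ab in auto)
  qed (use I'(2) in auto)
  ultimately have "0 < (s I - s I') * (s J - s I')" by simp
  moreover have "(s I')\<^sup>2 + (s J')\<^sup>2 - (s I)\<^sup>2 - (s J)\<^sup>2 = 2 * ((s I - s I') * (s J - s I'))"
  proof -
    have J's: "s J' = s I + s J - s I'" using s by simp
    show ?thesis unfolding J's power2_eq_square by (simp add: algebra_simps)
  qed
  ultimately have "nn_cost k I' + nn_cost k J' < nn_cost k I + nn_cost k J"
    unfolding nn_cost_def s_def [symmetric] by linarith
  moreover have "chi k n I' p + chi k n J' p = chi k n I p + chi k n J p" for p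
    by (rule chi_exchange) (use I'(2) J'(2) in auto)
  ultimately show ?thesis using I'(1) J'(1) by blast
qed

section \<open>The two exchange configurations\<close>

lemma exchange_config_NC:
  assumes k: "1 \<le> k" and \<epsilon>: "0 < \<epsilon>" "\<epsilon> \<le> 1" "\<epsilon> * (real k * real k * (real n * real n)) < 1"
  shows "exchange_config (Vkn k n) (chi k n) (noncrossing k) (nc_cost k \<epsilon>)"
proof
  show "finite (Vkn k n)" by (rule finite_Vkn)
  show "noncrossing k I I" for I by (rule noncrossing_refl)
  show "noncrossing k J I" if "noncrossing k I J" for I J using that by (rule noncrossing_sym)
next
  fix I J assume "I \<in> Vkn k n" "J \<in> Vkn k n" "\<not> noncrossing k I J"
  then show "\<exists>I'\<in>Vkn k n. \<exists>J'\<in>Vkn k n. (\<forall>p. chi k n I' p + chi k n J' p = chi k n I p + chi k n J p) \<and>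
    nc_cost k \<epsilon> I' + nc_cost k \<epsilon> J' < nc_cost k \<epsilon> I + nc_cost k \<epsilon> J"
    using \<epsilon> by (rule noncrossing_exchange)
next
  fix u v I
  assume nn: "\<And>I. I \<in> Vkn k n \<Longrightarrow> 0 \<le> u I" "\<And>I. I \<in> Vkn k n \<Longrightarrow> (0::real) \<le> v I"
    and su: "{I \<in> Vkn k n. u I \<noteq> 0} \<in> clique_complex (Vkn k n) (noncrossing k)"
    and sv: "{I \<in> Vkn k n. v I \<noteq> 0} \<in> clique_complex (Vkn k n) (noncrossing k)"
    and total: "sum u (Vkn k n) = sum v (Vkn k n)"
    and chi: "\<And>p. (\<Sum>I\<in>Vkn k n. u I * chi k n I p) = (\<Sum>I\<in>Vkn k n. v I * chi k n I p)"
    and I: "I \<in> Vkn k n"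
  show "u I = v I"
  proof (rule weights_unique_of_matching_unique [OF matching_unique_crosses nn _ _ column_marginals_of_chi [OF total chi] k I])
    show "\<not> crosses (ent I a) (ent I b) (ent J a) (ent J b)"
      if "I \<in> Vkn k n" "J \<in> Vkn k n" "u I \<noteq> 0" "u J \<noteq> 0" "1 \<le> a" "a < b" "b \<le> k"
        "\<And>l. a < l \<Longrightarrow> l < b \<Longrightarrow> ent I l = ent J l" for I J a b
    proof -
      have "noncrossing k I J" using su that(1-4) by (auto simp: clique_complex_def)
      then show ?thesis using that(5-8) unfolding noncrossing_def by blast
    qed
    show "\<not> crosses (ent I a) (ent I b) (ent J a) (ent J b)"
      if "I \<in> Vkn k n" "J \<in> Vkn k n" "v I \<noteq> 0" "v J \<noteq> 0" "1 \<le> a" "a < b" "b \<le> k"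
        "\<And>l. a < l \<Longrightarrow> l < b \<Longrightarrow> ent I l = ent J l" for I J a b
    proof -
      have "noncrossing k I J" using sv that(1-4) by (auto simp: clique_complex_def)
      then show ?thesis using that(5-8) unfolding noncrossing_def by blast
    qed
  qed
qed

lemma exchange_config_NN:
  assumes k: "1 \<le> k"
  shows "exchange_config (Vkn k n) (chi k n) (nonnesting k) (nn_cost k)"
proof
  show "finite (Vkn k n)" by (rule finite_Vkn)
  show "nonnesting k I I" for I by (rule nonnesting_refl)
  show "nonnesting k J I" if "nonnesting k I J" for I J using that by (rule nonnesting_sym)
next
  fix I J assume "I \<in> Vkn k n" "J \<in> Vkn k n" "\<not> nonnesting k I J"
  then show "\<exists>I'\<in>Vkn k n. \<exists>J'\<in>Vkn k n. (\<forall>p. chi k n I' p + chi k n J' p = chi k n I p + chi k n J p) \<and>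
    nn_cost k I' + nn_cost k J' < nn_cost k I + nn_cost k J"
    by (rule nonnesting_exchange)
next
  fix u v I
  assume nn: "\<And>I. I \<in> Vkn k n \<Longrightarrow> 0 \<le> u I" "\<And>I. I \<in> Vkn k n \<Longrightarrow> (0::real) \<le> v I"
    and su: "{I \<in> Vkn k n. u I \<noteq> 0} \<in> clique_complex (Vkn k n) (nonnesting k)"
    and sv: "{I \<in> Vkn k n. v I \<noteq> 0} \<in> clique_complex (Vkn k n) (nonnesting k)"
    and total: "sum u (Vkn k n) = sum v (Vkn k n)"
    and chi: "\<And>p. (\<Sum>I\<in>Vkn k n. u I * chi k n I p) = (\<Sum>I\<in>Vkn k n. v I * chi k n I p)"
    and I: "I \<in> Vkn k n"
  show "u I = v I"
  proof (rule weights_unique_of_matching_unique [OF matching_unique_nests nn _ _ column_marginals_of_chi [OF total chi] k I])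
    show "\<not> nests (ent I a) (ent I b) (ent J a) (ent J b)"
      if "I \<in> Vkn k n" "J \<in> Vkn k n" "u I \<noteq> 0" "u J \<noteq> 0" "1 \<le> a" "a < b" "b \<le> k" for I J a b
    proof -
      have "nonnesting k I J" using su that(1-4) by (auto simp: clique_complex_def)
      then show ?thesis using that(5-7) unfolding nonnesting_def by blast
    qed
    show "\<not> nests (ent I a) (ent I b) (ent J a) (ent J b)"
      if "I \<in> Vkn k n" "J \<in> Vkn k n" "v I \<noteq> 0" "v J \<noteq> 0" "1 \<le> a" "a < b" "b \<le> k" for I J a b
    proof -
      have "nonnesting k I J" using sv that(1-4) by (auto simp: clique_complex_def)
      then show ?thesis using that(5-7) unfolding nonnesting_def by blast
    qed
  qed
qed

section \<open>The order polytope\<close>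

lemma down_closed_interval:
  assumes D: "D \<subseteq> {1..m::nat}" and down: "\<And>b. Suc b \<in> D \<Longrightarrow> 1 \<le> b \<Longrightarrow> b \<in> D"
  shows "D = {1..card D}"
proof (cases "D = {}")
  case False
  have f: "finite D" using D finite_subset by blast
  have "Max D - d \<in> D" if "d < Max D" for d
    using that
  proof (induction d)
    case 0
    then show ?case using Max_in [OF f False] by simp
  next
    case (Suc d)
    then show ?case using down [of "Max D - Suc d"] by (simp add: Suc_diff_Suc)
  qed
  then have "b \<in> D" if "1 \<le> b" "b \<le> Max D" for b
    using that by (metis One_nat_def Suc_le_lessD diff_diff_cancel diff_less less_le_trans)
  then have "D = {1..Max D}" using D f by auto
  then show ?thesis by (metis card_atLeastAtMost diff_Suc_1)
qed simp

text \<open>In row \<open>a\<close> the complement of \<open>F\<close> is an initial segment, and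
  its length is the shift of entry \<open>a\<close> from its least value \<open>a\<close>. Closure
  in the first coordinate makes the shifts weakly increasing, hence the entries strictly
  increasing.\<close>

lemma chi_of_filter:
  assumes kn: "k \<le> n" and F: "F \<subseteq> Pkn k n"
    and up: "\<And>a b. (a, b) \<in> F \<Longrightarrow> (a, Suc b) \<in> Pkn k n \<Longrightarrow> (a, Suc b) \<in> F"
    and down: "\<And>a b. (Suc a, b) \<in> F \<Longrightarrow> (a, b) \<in> Pkn k n \<Longrightarrow> (a, b) \<in> F"
  obtains I where "I \<in> Vkn k n" "\<And>p. chi k n I p = of_bool (p \<in> F)"
proof -
  define D where "D a = {b \<in> {1..n - k}. (a, b) \<notin> F}" for a
  have sD: "D a \<subseteq> {1..n - k}" for a by (auto simp: D_def)
  have cD: "card (D a) \<le> n - k" for a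
    using card_mono [OF _ sD] by simp
  have D: "D a = {1..card (D a)}" if "1 \<le> a" "a \<le> k" for a
  proof (rule down_closed_interval)
    show "D a \<subseteq> {1..n - k}" by (rule sD)
    show "b \<in> D a" if "Suc b \<in> D a" "1 \<le> b" for b
      using up [of a b] that \<open>1 \<le> a\<close> \<open>a \<le> k\<close> by (auto simp: D_def Pkn_def)
  qed
  obtain I where I: "I \<in> Vkn k n" "\<And>a. 1 \<le> a \<Longrightarrow> a \<le> k \<Longrightarrow> ent I a = a + card (D a)"
  proof (rule Vkn_of_entries [of k "\<lambda>a. a + card (D a)" n])
    fix a assume a: "1 \<le> a" "a < k"
    have "D a \<subseteq> D (Suc a)" using down [of a] a by (auto simp: D_def Pkn_def)
    then have "card (D a) \<le> card (D (Suc a))" by (intro card_mono) (auto simp: D_def)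
    then show "a + card (D a) < Suc a + card (D (Suc a))" by simp
  next
    fix a assume "1 \<le> a" "a \<le> k"
    then show "1 \<le> a + card (D a) \<and> a + card (D a) \<le> n" using cD [of a] kn by simp
  qed blast
  have "chi k n I (a, b) = of_bool ((a, b) \<in> F)" for a b
  proof (cases "(a, b) \<in> Pkn k n")
    case True
    then have ab: "1 \<le> a" "a \<le> k" "1 \<le> b" "b \<le> n - k" by (auto simp: Pkn_def)
    have "(a, b) \<in> F \<longleftrightarrow> b \<notin> D a" using ab by (simp add: D_def)
    also have "b \<in> D a \<longleftrightarrow> b \<in> {1..card (D a)}"
      by (rule arg_cong [OF D [OF ab(1,2)]])
    also have "b \<notin> {1..card (D a)} \<longleftrightarrow> \<not> b \<le> card (D a)" using ab by simp
    also have "\<dots> \<longleftrightarrow> ent I a \<le> a + b - 1" using I(2) ab by auto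
    finally show ?thesis using True by (simp add: chi_def)
  next
    case False
    then show ?thesis using F by (auto simp: chi_def)
  qed
  then show thesis using I(1) by (intro that [of I]) auto
qed

text \<open>Layer cake: the support of \<open>x\<close> is a filter; subtract its indicator, scaled by the least positive value.\<close>
lemma order_cone_weights:
  fixes x :: "nat \<times> nat \<Rightarrow> real"
  assumes kn: "k \<le> n" and "\<And>p. p \<notin> Pkn k n \<Longrightarrow> x p = 0" "\<And>p. 0 \<le> x p" "\<And>p. x p \<le> t" "0 \<le> t"
    and "\<And>a b. (a, b) \<in> Pkn k n \<Longrightarrow> (a, Suc b) \<in> Pkn k n \<Longrightarrow> x (a, b) \<le> x (a, Suc b)"
    and "\<And>a b. (a, b) \<in> Pkn k n \<Longrightarrow> (Suc a, b) \<in> Pkn k n \<Longrightarrow> x (Suc a, b) \<le> x (a, b)"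
  shows "\<exists>u. (\<forall>I\<in>Vkn k n. 0 \<le> u I) \<and> sum u (Vkn k n) = t \<and> (\<forall>p. (\<Sum>I\<in>Vkn k n. u I * chi k n I p) = x p)"
  using assms(2-)
proof (induction "card {p \<in> Pkn k n. x p > 0}" arbitrary: x t rule: less_induct)
  case less
  have fP: "finite (Pkn k n)" by (simp add: Pkn_def)
  define F where "F = {p \<in> Pkn k n. x p > 0}"
  have fF: "finite F" using fP by (simp add: F_def)
  have xF: "x p = 0" if "p \<notin> F" for p
    using that less(2,3) [of p] by (auto simp: F_def less_eq_real_def)
  obtain J where J: "J \<in> Vkn k n" "\<And>p. chi k n J p = of_bool (p \<in> F)"
  proof (rule chi_of_filter [OF kn, of F])
    show "(a, Suc b) \<in> F" if "(a, b) \<in> F" "(a, Suc b) \<in> Pkn k n" for a b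
      using less(6) [of a b] that by (auto simp: F_def)
    show "(a, b) \<in> F" if "(Suc a, b) \<in> F" "(a, b) \<in> Pkn k n" for a b
      using less(7) [of a b] that by (auto simp: F_def)
  qed (auto simp: F_def)
  have single: "(\<Sum>I\<in>Vkn k n. s * of_bool (I = J) * g I) = s * g J" for s :: real and g
  proof -
    have "(\<Sum>I\<in>Vkn k n. s * of_bool (I = J) * g I) = (\<Sum>I\<in>Vkn k n. if I = J then s * g I else 0)"
      by (intro sum.cong) auto
    then show ?thesis using J(1) finite_Vkn by simp
  qed
  show ?case
  proof (cases "F = {}")
    case True
    then have "x p = 0" for p using xF by simp
    \<comment> \<open>Here \<open>J\<close> is the vertex at the origin, which absorbs the remaining
      total \<open>t\<close>.\<close>
    then show ?thesis
      using J True less(5) single [of t] single [of t "\<lambda>_. 1"] by (intro exI [of _ "\<lambda>I. t * of_bool (I = J)"]) auto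
  next
    case False
    define s where "s = Min (x ` F)"
    have sF: "s \<le> x p" if "p \<in> F" for p unfolding s_def using that fF by simp
    have "s \<in> x ` F" unfolding s_def using fF False by (intro Min_in) auto
    then obtain p0 where p0: "p0 \<in> F" "x p0 = s" by blast
    have s: "0 < s" "s \<le> t" using p0 less(4) [of p0] by (auto simp: F_def)
    define x' where "x' p = x p - s * of_bool (p \<in> F)" for p
    have "\<exists>u. (\<forall>I\<in>Vkn k n. 0 \<le> u I) \<and> sum u (Vkn k n) = t - s \<and> (\<forall>p. (\<Sum>I\<in>Vkn k n. u I * chi k n I p) = x' p)"
    proof (rule less(1))
      have "{p \<in> Pkn k n. x' p > 0} \<subset> F"
      proof
        show "{p \<in> Pkn k n. x' p > 0} \<subseteq> F"
        proof
          fix p assume "p \<in> {p \<in> Pkn k n. x' p > 0}"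
          then show "p \<in> F" using xF [of p] by (cases "p \<in> F") (auto simp: x'_def)
        qed
        have "x' p0 = 0" using p0 by (simp add: x'_def)
        then show "{p \<in> Pkn k n. x' p > 0} \<noteq> F" using p0(1) by force
      qed
      then show "card {p \<in> Pkn k n. x' p > 0} < card {p \<in> Pkn k n. x p > 0}"
        using psubset_card_mono [OF fF] by (simp add: F_def)
      show "x' p = 0" if "p \<notin> Pkn k n" for p using less(2) [OF that] that by (simp add: x'_def F_def)
      show "0 \<le> x' p" for p using sF [of p] less(3) [of p] by (auto simp: x'_def)
      show "x' p \<le> t - s" for p using less(4) [of p] xF [of p] s by (auto simp: x'_def)
      show "0 \<le> t - s" using s by simp
      show "x' (a, b) \<le> x' (a, Suc b)" if "(a, b) \<in> Pkn k n" "(a, Suc b) \<in> Pkn k n" for a b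
      \<comment> \<open>If \<open>(a, b)\<close> is in the filter, both values drop by
        \<open>s\<close>; otherwise the smaller value is 0 and the larger one stays
        nonnegative.\<close>
      proof (cases "(a, b) \<in> F")
        case True
        then have "(a, Suc b) \<in> F" using less(6) [OF that] that by (auto simp: F_def)
        then show ?thesis using True less(6) [OF that] by (simp add: x'_def)
      qed (use xF [of "(a, b)"] sF [of "(a, Suc b)"] less(3) [of "(a, Suc b)"] in \<open>auto simp: x'_def\<close>)
      show "x' (Suc a, b) \<le> x' (a, b)" if "(a, b) \<in> Pkn k n" "(Suc a, b) \<in> Pkn k n" for a b
      proof (cases "(Suc a, b) \<in> F")
        case True
        then have "(a, b) \<in> F" using less(7) [OF that] that by (auto simp: F_def)
        then show ?thesis using True less(7) [OF that] by (simp add: x'_def)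
      qed (use xF [of "(Suc a, b)"] sF [of "(a, b)"] less(3) [of "(a, b)"] in \<open>auto simp: x'_def\<close>)
    qed
    then obtain u where u: "\<forall>I\<in>Vkn k n. 0 \<le> u I" "sum u (Vkn k n) = t - s"
      "\<And>p. (\<Sum>I\<in>Vkn k n. u I * chi k n I p) = x' p" by blast
    show ?thesis
    proof (intro exI [of _ "\<lambda>I. u I + s * of_bool (I = J)"] conjI allI ballI)
      show "0 \<le> u I + s * of_bool (I = J)" if "I \<in> Vkn k n" for I using u(1) that s by simp
      show "(\<Sum>I\<in>Vkn k n. u I + s * of_bool (I = J)) = t"
        unfolding sum.distrib using single [of s "\<lambda>_. 1"] u(2) by simp
      show "(\<Sum>I\<in>Vkn k n. (u I + s * of_bool (I = J)) * chi k n I p) = x p" for p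
        unfolding distrib_right sum.distrib u(3) single J(2) by (simp add: x'_def)
    qed
  qed
qed

lemma chi_mono:
  assumes "I \<in> Vkn k n"
  shows "(a, b) \<in> Pkn k n \<Longrightarrow> (a, Suc b) \<in> Pkn k n \<Longrightarrow> chi k n I (a, b) \<le> chi k n I (a, Suc b)"
    and "(a, b) \<in> Pkn k n \<Longrightarrow> (Suc a, b) \<in> Pkn k n \<Longrightarrow> chi k n I (Suc a, b) \<le> chi k n I (a, b)"
  using ent_less [OF assms, of a "Suc a"] by (auto simp: chi_def Pkn_def)

lemma conv_pts_chi:
  assumes kn: "k \<le> n"
  shows "conv_pts (Vkn k n) (chi k n) = order_polytope k n"
proof (intro equalityI subsetI)
  fix x assume "x \<in> conv_pts (Vkn k n) (chi k n)"
  then obtain u where u: "\<And>I. I \<in> Vkn k n \<Longrightarrow> 0 \<le> u I" "sum u (Vkn k n) = 1"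
    "\<And>p. x p = (\<Sum>I\<in>Vkn k n. u I * chi k n I p)" by (auto simp: conv_pts_def)
  have mono: "x p \<le> x q" if "\<And>I. I \<in> Vkn k n \<Longrightarrow> chi k n I p \<le> chi k n I q" for p q
    unfolding u(3) using that u(1) by (intro sum_mono mult_left_mono) auto
  show "x \<in> order_polytope k n" unfolding order_polytope_def
  proof (intro CollectI conjI allI ballI impI)
    show "x p = 0" if "p \<notin> Pkn k n" for p
      unfolding u(3) using that by (intro sum.neutral) (auto simp: chi_def split: prod.split)
    show "0 \<le> x p" for p unfolding u(3) using u(1) chi_nonneg_le_1 by (intro sum_nonneg) auto
    have "x p \<le> sum u (Vkn k n)" for p unfolding u(3)
      by (intro sum_mono mult_left_le chi_nonneg_le_1 u(1))
    then show "x p \<le> 1" for p using u(2) by simp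
    show "x (a, b) \<le> x (a, b + 1)" if "(a, b) \<in> Pkn k n \<and> (a, b + 1) \<in> Pkn k n" for a b
      using that by (intro mono) (auto intro: chi_mono)
    show "x (a + 1, b) \<le> x (a, b)" if "(a, b) \<in> Pkn k n \<and> (a + 1, b) \<in> Pkn k n" for a b
      using that by (intro mono) (auto intro: chi_mono)
  qed
next
  fix x assume "x \<in> order_polytope k n"
  then have x: "\<And>p. p \<notin> Pkn k n \<Longrightarrow> x p = 0" "\<And>p. p \<in> Pkn k n \<Longrightarrow> 0 \<le> x p" "\<And>p. p \<in> Pkn k n \<Longrightarrow> x p \<le> 1"
    "\<And>a b. (a, b) \<in> Pkn k n \<Longrightarrow> (a, Suc b) \<in> Pkn k n \<Longrightarrow> x (a, b) \<le> x (a, Suc b)"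
    "\<And>a b. (a, b) \<in> Pkn k n \<Longrightarrow> (Suc a, b) \<in> Pkn k n \<Longrightarrow> x (Suc a, b) \<le> x (a, b)"
    by (simp_all add: order_polytope_def del: split_paired_All)
  have "\<exists>u. (\<forall>I\<in>Vkn k n. 0 \<le> u I) \<and> sum u (Vkn k n) = 1 \<and> (\<forall>p. (\<Sum>I\<in>Vkn k n. u I * chi k n I p) = x p)"
  proof (rule order_cone_weights [OF kn])
    show "0 \<le> x p" "x p \<le> 1" for p
      using x(1-3) [of p] by (cases "p \<in> Pkn k n"; simp)+
  qed (use x in simp_all)
  then show "x \<in> conv_pts (Vkn k n) (chi k n)" by (auto simp: conv_pts_def fun_eq_iff)
qed

text \<open>The principal filter at \<open>p\<close> remains a filter without its generator, and the
  two indicators differ exactly at \<open>p\<close>.\<close>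

lemma chi_unit_vector:
  assumes kn: "k \<le> n" and p: "p \<in> Pkn k n"
  shows "\<exists>J\<in>Vkn k n. \<exists>J'\<in>Vkn k n. \<forall>q. chi k n J q - chi k n J' q = of_bool (q = p)"
proof -
  obtain a b where ab: "p = (a, b)" by (cases p)
  define F where "F = {(a', b') \<in> Pkn k n. a' \<le> a \<and> b \<le> b'}"
  obtain J where J: "J \<in> Vkn k n" "\<And>q. chi k n J q = of_bool (q \<in> F)"
    by (rule chi_of_filter [OF kn, of F]) (auto simp: F_def)
  obtain J' where J': "J' \<in> Vkn k n" "\<And>q. chi k n J' q = of_bool (q \<in> F - {p})"
    by (rule chi_of_filter [OF kn, of "F - {p}"]) (auto simp: F_def ab)
  have "p \<in> F" using p by (simp add: F_def ab)
  then have "chi k n J q - chi k n J' q = of_bool (q = p)" for q by (auto simp: J(2) J'(2))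
  then show ?thesis using J(1) J'(1) by blast
qed

lemma chi_origin:
  assumes "k \<le> n" shows "\<exists>I\<in>Vkn k n. \<forall>p. chi k n I p = 0"
  by (rule chi_of_filter [OF assms, of "{}"]) auto

text \<open>The second alternative is the wrap-around: \<open>ent I a = a\<close> forces the first
  \<open>a\<close> entries to be \<open>1..a\<close>, and the other equation forces the remaining
  entries to be the largest elements. These sets are the intervals modulo \<open>n\<close>.\<close>

definition cyclic_intervals :: "nat \<Rightarrow> nat \<Rightarrow> nat set set" where
  "cyclic_intervals k n = {I \<in> Vkn k n. \<forall>a. 1 \<le> a \<longrightarrow> a < k \<longrightarrow>
    ent I (Suc a) = Suc (ent I a) \<or> (ent I a = a \<and> ent I (Suc a) + k = n + Suc a)}"

text \<open>An arc of length one crosses nothing. If \<open>I\<close> takes unit steps at both ends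
  of a window with middle entries, agreement there makes the arc of \<open>J\<close> enclose that of
  \<open>I\<close>. If \<open>I\<close> jumps, its arc has extreme endpoints and encloses that of
  \<open>J\<close>.\<close>

lemma cyclic_interval_noncrossing:
  assumes I: "I \<in> cyclic_intervals k n" and J: "J \<in> Vkn k n"
  shows "noncrossing k I J"
  unfolding noncrossing_def
proof (intro allI impI)
  fix a b assume "1 \<le> a \<and> a < b \<and> b \<le> k \<and> (\<forall>l. a < l \<and> l < b \<longrightarrow> ent I l = ent J l)"
  then have ab: "1 \<le> a" "a < b" "b \<le> k" and mid: "\<And>l. a < l \<Longrightarrow> l < b \<Longrightarrow> ent I l = ent J l" by auto
  have IV: "I \<in> Vkn k n" using I by (simp add: cyclic_intervals_def)
  have step: "ent I (Suc l) = Suc (ent I l) \<or> (ent I l = l \<and> ent I (Suc l) + k = n + Suc l)" if "1 \<le> l" "l < k" for l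
    using I that by (simp add: cyclic_intervals_def)
  have low: "ent I a = a" if "ent I l = l" "a \<le> l" "l \<le> k" for l
    using ent_add_le [OF IV ab(1), of "l - a"] ent_bounds [OF IV, of a] that ab by auto
  have high: "ent I b + k = n + b" if "ent I l + k = n + l" "1 \<le> l" "l \<le> b" for l
    using ent_add_le [OF IV that(2), of "b - l"] ent_bounds [OF IV, of b] that ab by auto
  have Jb: "a \<le> ent J a" "ent J b + k \<le> n + b" using ent_bounds [OF J] ab by auto
  have wrap: "\<not> crosses (ent I a) (ent I b) (ent J a) (ent J b)" if "ent I a = a" "ent I b + k = n + b"
    using that Jb by (auto simp: crosses_def)
  show "\<not> crosses (ent I a) (ent I b) (ent J a) (ent J b)"
  proof (cases "b = Suc a")
    case True
    then show ?thesis using step [of a] wrap ab by (auto simp: crosses_def)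
  next
    case False
    then have b: "a < b - 1" "Suc (b - 1) = b" using ab by auto
    have left: "ent I (Suc a) = Suc (ent I a) \<or> (ent I a = a \<and> ent I (Suc a) + k = n + Suc a)"
      using step [of a] ab by simp
    have right: "ent I b = Suc (ent I (b - 1)) \<or> (ent I (b - 1) = b - 1 \<and> ent I b + k = n + b)"
      using step [of "b - 1"] ab b by simp
    show ?thesis
    proof (cases "ent I (Suc a) = Suc (ent I a) \<and> ent I b = Suc (ent I (b - 1))")
      case True
      have "ent J a < ent J (Suc a)" "ent J (b - 1) < ent J b" using ent_less [OF J] ab b by auto
      moreover have "ent J (Suc a) = ent I (Suc a)" "ent J (b - 1) = ent I (b - 1)"
        using mid [of "Suc a"] mid [of "b - 1"] ab b by auto
      ultimately have "ent J a \<le> ent I a" "ent I b \<le> ent J b" using True by auto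
      then show ?thesis by (auto simp: crosses_def)
    next
      case False
      \<comment> \<open>A jump at either end fixes both endpoints: entries before it are least
        possible, entries after it largest possible.\<close>
      then have "ent I a = a \<and> ent I b + k = n + b"
        using left right low [of "b - 1"] high [of "Suc a"] ab b by auto
      then show ?thesis using wrap by blast
    qed
  qed
qed

lemma shifted_interval:
  assumes "s + k \<le> n"
  obtains I where "I \<in> cyclic_intervals k n" "\<And>l. 1 \<le> l \<Longrightarrow> l \<le> k \<Longrightarrow> ent I l = s + l"
proof -
  obtain I where I: "I \<in> Vkn k n" "\<And>l. 1 \<le> l \<Longrightarrow> l \<le> k \<Longrightarrow> ent I l = s + l"
    by (rule Vkn_of_entries [of k "\<lambda>l. s + l" n]) (use assms in auto)
  moreover from this have "I \<in> cyclic_intervals k n" by (simp add: cyclic_intervals_def)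
  ultimately show thesis using that by blast
qed

lemma wrapped_interval:
  assumes "k \<le> n"
  obtains I where "I \<in> cyclic_intervals k n" "\<And>l. 1 \<le> l \<Longrightarrow> l \<le> k \<Longrightarrow> ent I l = (if l \<le> a then l else n - k + l)"
proof -
  obtain I where I: "I \<in> Vkn k n" "\<And>l. 1 \<le> l \<Longrightarrow> l \<le> k \<Longrightarrow> ent I l = (if l \<le> a then l else n - k + l)"
    by (rule Vkn_of_entries [of k "\<lambda>l. if l \<le> a then l else n - k + l" n]) (use assms in auto)
  moreover from this have "I \<in> cyclic_intervals k n" using assms by (auto simp: cyclic_intervals_def)
  ultimately show thesis using that by blast
qed

text \<open>Each defining inequality of the order cone holds for all cyclic intervals and has slack
  1 for at least one of them. A vertex \<open>J\<close> has slack at most 1, so the sum minus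
  \<open>J\<close> stays in the cone and \<open>order_cone_weights\<close> applies.\<close>

lemma cyclic_intervals_interior:
  assumes kn: "k \<le> n" and J: "J \<in> Vkn k n"
  shows "\<exists>u. (\<forall>I\<in>Vkn k n. 0 \<le> u I) \<and> sum u (Vkn k n) = real (card (cyclic_intervals k n)) - 1 \<and>
    (\<forall>p. (\<Sum>I\<in>Vkn k n. u I * chi k n I p) = (\<Sum>I\<in>cyclic_intervals k n. chi k n I p) - chi k n J p)"
proof -
  define A where "A = cyclic_intervals k n"
  have AV: "A \<subseteq> Vkn k n" by (auto simp: A_def cyclic_intervals_def)
  then have fA: "finite A" using finite_Vkn finite_subset by blast
  \<comment> \<open>\<open>I0\<close> and \<open>I1\<close> give the all-ones and the all-zeros
    point; they provide the slack in the lower bound 0 and in the upper bound by the total.\<close>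
  obtain I0 where I0: "I0 \<in> A" "\<And>l. 1 \<le> l \<Longrightarrow> l \<le> k \<Longrightarrow> ent I0 l = 0 + l"
    using shifted_interval [of 0 k n] kn unfolding A_def by auto
  obtain I1 where I1: "I1 \<in> A" "\<And>l. 1 \<le> l \<Longrightarrow> l \<le> k \<Longrightarrow> ent I1 l = n - k + l"
    using shifted_interval [of "n - k" k n] kn unfolding A_def by auto
  define y where "y p = (\<Sum>I\<in>A. chi k n I p)" for p
  have grow: "y p - chi k n J p \<le> y q - chi k n J q"
    if "\<And>I. I \<in> A \<Longrightarrow> chi k n I p \<le> chi k n I q" "I \<in> A" "chi k n I p = 0" "chi k n I q = 1" for p q I
  proof -
    have "1 \<le> (\<Sum>I\<in>A. chi k n I q - chi k n I p)"
      using member_le_sum [of I A "\<lambda>I. chi k n I q - chi k n I p"] that fA by auto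
    then have "1 \<le> y q - y p" by (simp add: y_def sum_subtractf)
    then show ?thesis using chi_nonneg_le_1 [of k n J p] chi_nonneg_le_1 [of k n J q] by linarith
  qed
  have "\<exists>u. (\<forall>I\<in>Vkn k n. 0 \<le> u I) \<and> sum u (Vkn k n) = real (card A) - 1 \<and>
    (\<forall>p. (\<Sum>I\<in>Vkn k n. u I * chi k n I p) = y p - chi k n J p)"
  proof (rule order_cone_weights [OF kn])
    show out: "y p - chi k n J p = 0" if "p \<notin> Pkn k n" for p
      using that by (auto simp: y_def chi_def split: prod.split)
    have card: "1 \<le> card A" using I0(1) fA by (metis One_nat_def Suc_leI card_gt_0_iff empty_iff)
    then show t: "0 \<le> real (card A) - 1" by simp
    show "0 \<le> y p - chi k n J p" for p
    proof (cases "p \<in> Pkn k n")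
      case True
      then have "chi k n I0 p = 1" using I0(2) by (auto simp: chi_def Pkn_def split: prod.split)
      then have "1 \<le> y p"
        unfolding y_def using member_le_sum [of I0 A "\<lambda>I. chi k n I p"] I0(1) fA chi_nonneg_le_1 by auto
      then show ?thesis using chi_nonneg_le_1 [of k n J p] by linarith
    qed (simp add: out)
    show "y p - chi k n J p \<le> real (card A) - 1" for p
    proof (cases "p \<in> Pkn k n")
      case True
      then have "chi k n I1 p = 0" using I1(2) by (auto simp: chi_def Pkn_def split: prod.split)
      then have "1 \<le> (\<Sum>I\<in>A. 1 - chi k n I p)"
        using member_le_sum [of I1 A "\<lambda>I. 1 - chi k n I p"] I1(1) fA chi_nonneg_le_1 by auto
      then show ?thesis using chi_nonneg_le_1 [of k n J p] by (simp add: y_def sum_subtractf)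
    qed (use out t in simp)
    show "y (a, b) - chi k n J (a, b) \<le> y (a, Suc b) - chi k n J (a, Suc b)"
      if ab: "(a, b) \<in> Pkn k n" "(a, Suc b) \<in> Pkn k n" for a b
    proof -
      have "b + k \<le> n" using ab kn by (auto simp: Pkn_def)
      \<comment> \<open>Entry \<open>a\<close> equal to \<open>a + b\<close> is what separates
        \<open>(a, b)\<close> from \<open>(a, Suc b)\<close>.\<close>
      then obtain I where I: "I \<in> A" "\<And>l. 1 \<le> l \<Longrightarrow> l \<le> k \<Longrightarrow> ent I l = b + l"
        unfolding A_def by (rule shifted_interval) blast
      show ?thesis
      proof (rule grow [OF _ I(1)])
        show "chi k n I' (a, b) \<le> chi k n I' (a, Suc b)" if "I' \<in> A" for I'
          using chi_mono(1) [OF _ ab] AV that by blast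
        show "chi k n I (a, b) = 0" "chi k n I (a, Suc b) = 1"
          using I(2) [of a] ab by (auto simp: chi_def Pkn_def)
      qed
    qed
    show "y (Suc a, b) - chi k n J (Suc a, b) \<le> y (a, b) - chi k n J (a, b)"
      if ab: "(a, b) \<in> Pkn k n" "(Suc a, b) \<in> Pkn k n" for a b
    proof -
      \<comment> \<open>Jumping after position \<open>a\<close> makes entry \<open>a\<close> least
        and entry \<open>Suc a\<close> largest, so the coordinates at \<open>(a, b)\<close> and
        \<open>(Suc a, b)\<close> are 1 and 0 for every \<open>b\<close>.\<close>
      obtain I where I: "I \<in> A" "\<And>l. 1 \<le> l \<Longrightarrow> l \<le> k \<Longrightarrow> ent I l = (if l \<le> a then l else n - k + l)"
        unfolding A_def by (rule wrapped_interval [OF kn, where a = a]) blast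
      show ?thesis
      proof (rule grow [OF _ I(1)])
        show "chi k n I' (Suc a, b) \<le> chi k n I' (a, b)" if "I' \<in> A" for I'
          using chi_mono(2) [OF _ ab] AV that by blast
        show "chi k n I (Suc a, b) = 0" "chi k n I (a, b) = 1"
          using I(2) [of a] I(2) [of "Suc a"] ab by (auto simp: chi_def Pkn_def)
      qed
    qed
  qed
  then show ?thesis by (simp add: y_def A_def)
qed

theorem theorem1p4:
  fixes k n :: nat
  assumes "1 \<le> k" and "k \<le> n - 1"
  shows "is_flag (NC_complex k n) (Vkn k n) \<and>
         is_triangulation (NC_complex k n) (Vkn k n) (chi k n) (order_polytope k n) \<and>
         is_regular (NC_complex k n) (Vkn k n) (Pkn k n) (chi k n) \<and>
         is_unimodular (NC_complex k n) (chi k n) (int_lattice k n) (k * (n - k)) \<and>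
         is_gorenstein (NC_complex k n) \<and>
         fvec (NC_complex k n) = fvec (NN_complex k n) \<and>
         hvec (NC_complex k n) = hvec (NN_complex k n)"
proof -
  have k: "1 \<le> k" "k \<le> n" using assms by auto
  \<comment> \<open>\<open>K\<close> bounds the number of index pairs times the largest product of
    entry differences; the \<open>+ 1\<close> in the denominator of \<epsilon> makes
    \<open>\<epsilon> * K < 1\<close> strict and ensures \<open>\<epsilon> \<le> 1\<close>.\<close>
  define K where "K = real k * real k * (real n * real n)"
  define \<epsilon> where "\<epsilon> = 1 / (K + 1)"
  have "0 \<le> K" by (simp add: K_def)
  then have \<epsilon>: "0 < \<epsilon>" "\<epsilon> \<le> 1" "\<epsilon> * K < 1" by (simp_all add: \<epsilon>_def)
  interpret NC: exchange_config "Vkn k n" "chi k n" "noncrossing k" "nc_cost k \<epsilon>"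
    using exchange_config_NC [OF k(1) \<epsilon>(1,2)] \<epsilon>(3) by (simp add: K_def)
  interpret NN: exchange_config "Vkn k n" "chi k n" "nonnesting k" "nn_cost k"
    by (rule exchange_config_NN [OF k(1)])
  interpret NC: lattice_config "Vkn k n" "chi k n" "noncrossing k" "nc_cost k \<epsilon>" "Pkn k n"
  proof
    show "finite (Pkn k n)" by (simp add: Pkn_def)
    show "chi k n I p = 0" if "p \<notin> Pkn k n" for I p using that by (auto simp: chi_def split: prod.split)
  qed (use chi_origin chi_unit_vector k in auto)
  have flag: "is_flag (NC_complex k n) (Vkn k n)"
    by (auto simp: is_flag_def NC_complex_def clique_complex_def noncrossing_refl)
  have tri: "is_triangulation (NC_complex k n) (Vkn k n) (chi k n) (order_polytope k n)"
    using NC.triangulation conv_pts_chi [OF k(2)] by (simp add: NC_complex_def)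
  have reg: "is_regular (NC_complex k n) (Vkn k n) (Pkn k n) (chi k n)"
    using NC.regular by (simp add: NC_complex_def)
  have "card (Pkn k n) = k * (n - k)" by (simp add: Pkn_def)
  then have uni: "is_unimodular (NC_complex k n) (chi k n) (int_lattice k n) (k * (n - k))"
    using NC.unimodular unfolding NC_complex_def int_lattice_def by metis
  have gor: "is_gorenstein (NC_complex k n)"
    unfolding NC_complex_def
  proof (rule NC.gorenstein [of "cyclic_intervals k n"])
    show "cyclic_intervals k n \<subseteq> Vkn k n" by (auto simp: cyclic_intervals_def)
    show "noncrossing k I J" if "I \<in> cyclic_intervals k n" "J \<in> Vkn k n" for I J
      using that by (rule cyclic_interval_noncrossing)
    fix J assume "J \<in> Vkn k n"
    then obtain u where u: "\<forall>I\<in>Vkn k n. 0 \<le> u I" "sum u (Vkn k n) = real (card (cyclic_intervals k n)) - 1"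
      "\<And>p. (\<Sum>I\<in>Vkn k n. u I * chi k n I p) = (\<Sum>I\<in>cyclic_intervals k n. chi k n I p) - chi k n J p"
      using cyclic_intervals_interior [OF k(2)] by blast
    have "NC.comb u q = (\<Sum>I\<in>cyclic_intervals k n. NC.h I q) - NC.h J q" for q
      using u(2,3) by (cases q) (simp_all add: NC.comb_def)
    then show "\<exists>u. (\<forall>I\<in>Vkn k n. 0 \<le> u I) \<and> (\<forall>q. NC.comb u q = (\<Sum>I\<in>cyclic_intervals k n. NC.h I q) - NC.h J q)"
      using u(1) by blast
  qed
  have fv: "fvec (NC_complex k n) = fvec (NN_complex k n)"
    unfolding NC_complex_def NN_complex_def
    by (rule exchange_config_fvec_eq) (rule NC.exchange_config_axioms NN.exchange_config_axioms)+
  have hv: "hvec (NC_complex k n) = hvec (NN_complex k n)"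
    by (rule hvec_eqI [OF _ _ fv]) (simp_all add: NC_complex_def NN_complex_def NC.finite_complex NN.finite_complex)
  show ?thesis using flag tri reg uni gor fv hv by blast
qed

end
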